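(* Fix $\rho>0$ and assume that $(n-d)/d\to\rho$ as $n\to\infty$. Define $$ f_\rho(r)=\rho\ln\Phi(r)-\frac{r^2}{2},\qquad r\in\mathbb{R}, $$ where $\Phi$ is the cumulative distribution function of a standard normal random variable, and let $r_\rho:=\mathrm{argmax}\, f_\rho\in(0,\infty)$. Then $$ \sqrt{d}\,H_{\mathrm{typ}}\xrightarrow{P} r_\rho, $$ where $\xrightarrow{P}$ denotes convergence in probability.
   Context: Asymptotic setting: $\mathbb{N}\ni n\to\infty$ and $d=d(n)\in\{2,\ldots,n-1\}$ is a function of $n$ which is either constant or tends to infinity. All limits are as $n\to\infty$. Let $X_1,\ldots,X_n$ be i.i.d. random vectors uniformly distributed on the unit sphere $\mathbb{S}^{d-1}\subset\mathbb{R}^d$, and let $P_{n,d}=[X_1,\ldots,X_n]$ be their convex hull. A facet ($(d-1)$-dimensional face) of $P_{n,d}$ has height $h\in[-1,1]$ if its supporting hyperplane is $\{x\in\mathbb{R}^d:\langle x,u\rangle=h\}$ for some $u\in\mathbb{S}^{d-1}$ and $P_{n,d}\subset\{x:\langle x,u\rangle\le h\}$ (heights can be negative). The typical height $H_{\mathrm{typ}}$ (depending on $n,d$) is the random variable with distribution $$\mathbb{P}(H_{\mathrm{typ}}\in\cdot)=\mathbb{P}\big([X_1,\ldots,X_d]\text{ has height in }\cdot \;\big|\; [X_1,\ldots,X_d]\text{ is a facet of }P_{n,d}\big).$$ *)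

theory Defs
  imports "HOL-Probability.Probability"
begin

text \<open>
  The dimension varies along a sequence, so it cannot be a type: a point of \<open>\<real>\<^sup>d\<close> is a function in
  \<open>{..<d} \<rightarrow>\<^sub>E UNIV\<close>, the space of the product measure \<open>Pi\<^sub>M {..<d} (\<lambda>_. lborel)\<close>, which is
  \<open>d\<close>-dimensional Lebesgue measure.
\<close>

definition Rd :: "nat \<Rightarrow> (nat \<Rightarrow> real) set" where
  "Rd d = ({..<d} \<rightarrow>\<^sub>E UNIV)"

definition borel_Rd :: "nat \<Rightarrow> (nat \<Rightarrow> real) measure" where
  "borel_Rd d = Pi\<^sub>M {..<d} (\<lambda>_. borel)"

definition inner_Rd :: "nat \<Rightarrow> (nat \<Rightarrow> real) \<Rightarrow> (nat \<Rightarrow> real) \<Rightarrow> real" where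
  "inner_Rd d x y = (\<Sum>k<d. x k * y k)"

definition norm_Rd :: "nat \<Rightarrow> (nat \<Rightarrow> real) \<Rightarrow> real" where
  "norm_Rd d x = sqrt (inner_Rd d x x)"

definition sphere_Rd :: "nat \<Rightarrow> (nat \<Rightarrow> real) set" where
  "sphere_Rd d = {x \<in> Rd d. norm_Rd d x = 1}"

definition ball_Rd :: "nat \<Rightarrow> (nat \<Rightarrow> real) set" where
  "ball_Rd d = {x \<in> Rd d. norm_Rd d x \<le> 1}"

text \<open>
  Normalized surface measure, as the cone measure
  \<open>A \<mapsto> vol {r x | x \<in> A, 0 < r \<le> 1} / vol (ball_Rd d)\<close>, regarded as a measure on all of \<open>\<real>\<^sup>d\<close>.
  The origin, where the radial projection is meaningless, is a null set for \<open>d \<ge> 1\<close>.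
\<close>

definition uniform_sphere :: "nat \<Rightarrow> (nat \<Rightarrow> real) measure" where
  "uniform_sphere d =
     distr (uniform_measure (Pi\<^sub>M {..<d} (\<lambda>_. lborel)) (ball_Rd d)) (borel_Rd d)
       (\<lambda>x. \<lambda>k\<in>{..<d}. x k / norm_Rd d x)"

definition conv_hull_Rd :: "nat \<Rightarrow> nat set \<Rightarrow> (nat \<Rightarrow> nat \<Rightarrow> real) \<Rightarrow> (nat \<Rightarrow> real) set" where
  "conv_hull_Rd d I x =
     {(\<lambda>k\<in>{..<d}. \<Sum>i\<in>I. w i * x i k) | w. (\<forall>i\<in>I. 0 \<le> w i) \<and> (\<Sum>i\<in>I. w i) = (1::real)}"

definition aff_indep_Rd :: "nat \<Rightarrow> nat \<Rightarrow> (nat \<Rightarrow> nat \<Rightarrow> real) \<Rightarrow> bool" where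
  "aff_indep_Rd d m p \<longleftrightarrow>
     (\<forall>c :: nat \<Rightarrow> real.
        (\<Sum>i<m. c i) = 0 \<and> (\<forall>k<d. (\<Sum>i<m. c i * p i k) = 0) \<longrightarrow> (\<forall>i<m. c i = 0))"

definition has_dim_Rd :: "nat \<Rightarrow> (nat \<Rightarrow> real) set \<Rightarrow> nat \<Rightarrow> bool" where
  "has_dim_Rd d F m \<longleftrightarrow>
     (\<exists>p. (\<forall>i<m + 1. p i \<in> F) \<and> aff_indep_Rd d (m + 1) p) \<and>
     \<not> (\<exists>p. (\<forall>i<m + 2. p i \<in> F) \<and> aff_indep_Rd d (m + 2) p)"

text \<open>
  \<open>{x. \<langle>x, u\<rangle> = h}\<close> is a hyperplane that supports \<open>P\<close> with outer unit normal \<open>u\<close> and cuts out the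
  face \<open>F\<close>. The number \<open>h\<close> may be negative.
\<close>

definition supports_at :: "nat \<Rightarrow> (nat \<Rightarrow> real) set \<Rightarrow> (nat \<Rightarrow> real) set \<Rightarrow> (nat \<Rightarrow> real) \<Rightarrow> real \<Rightarrow> bool" where
  "supports_at d P F u h \<longleftrightarrow>
     u \<in> sphere_Rd d \<and> P \<subseteq> {x \<in> Rd d. inner_Rd d x u \<le> h} \<and>
     F = P \<inter> {x \<in> Rd d. inner_Rd d x u = h}"

definition is_facet :: "nat \<Rightarrow> (nat \<Rightarrow> real) set \<Rightarrow> (nat \<Rightarrow> real) set \<Rightarrow> bool" where
  "is_facet d P F \<longleftrightarrow> (\<exists>u h. supports_at d P F u h) \<and> has_dim_Rd d F (d - 1)"

definition has_height :: "nat \<Rightarrow> (nat \<Rightarrow> real) set \<Rightarrow> (nat \<Rightarrow> real) set \<Rightarrow> real \<Rightarrow> bool" where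
  "has_height d P F h \<longleftrightarrow> (\<exists>u. supports_at d P F u h)"

definition iid_uniform_sphere ::
    "'a measure \<Rightarrow> nat \<Rightarrow> nat \<Rightarrow> (nat \<Rightarrow> 'a \<Rightarrow> nat \<Rightarrow> real) \<Rightarrow> bool" where
  "iid_uniform_sphere M n d X \<longleftrightarrow>
     prob_space M \<and> prob_space.indep_vars M (\<lambda>_. borel_Rd d) X {1..n} \<and>
     (\<forall>i\<in>{1..n}. distr M (borel_Rd d) (X i) = uniform_sphere d)"

definition is_typical_height ::
    "'a measure \<Rightarrow> nat \<Rightarrow> nat \<Rightarrow> (nat \<Rightarrow> 'a \<Rightarrow> nat \<Rightarrow> real) \<Rightarrow> 'b measure \<Rightarrow> ('b \<Rightarrow> real) \<Rightarrow> bool" where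
  "is_typical_height M n d X N H \<longleftrightarrow>
     prob_space N \<and> H \<in> borel_measurable N \<and>
     (\<forall>B \<in> sets borel.
        \<P>(\<eta> in N. H \<eta> \<in> B) =
        \<P>(\<omega> in M.
            (\<exists>h\<in>B. has_height d (conv_hull_Rd d {1..n} (\<lambda>i. X i \<omega>))
                              (conv_hull_Rd d {1..d} (\<lambda>i. X i \<omega>)) h)
            \<bar> is_facet d (conv_hull_Rd d {1..n} (\<lambda>i. X i \<omega>))
                         (conv_hull_Rd d {1..d} (\<lambda>i. X i \<omega>))))"

definition converges_in_prob ::
    "(nat \<Rightarrow> 'b measure) \<Rightarrow> (nat \<Rightarrow> 'b \<Rightarrow> real) \<Rightarrow> real \<Rightarrow> bool" where
  "converges_in_prob N Y c \<longleftrightarrow>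
     (\<forall>\<epsilon>>0. (\<lambda>n. \<P>(\<eta> in N n. \<bar>Y n \<eta> - c\<bar> > \<epsilon>)) \<longlonglongrightarrow> 0)"

definition f_rho :: "real \<Rightarrow> real \<Rightarrow> real" where
  "f_rho \<rho> r = \<rho> * ln (cdf std_normal_distribution r) - r\<^sup>2 / 2"

definition r_rho :: "real \<Rightarrow> real" where
  "r_rho \<rho> = arg_max (f_rho \<rho>) (\<lambda>_. True)"

end

theory Submission
  imports Defs "Jordan_Normal_Form.Determinant" "HOL-Real_Asymp.Real_Asymp"
begin

text \<open>
  Write \<open>A\<close> for the matrix with rows \<open>X\<^sub>1, \<dots>, X\<^sub>d\<close> and \<open>w = A\<^sup>-\<^sup>1 1\<close>. The hyperplane through these points is
  \<open>{x. \<langle>x, w\<rangle> = 1}\<close>, at distance \<open>1 / |w|\<close> from the origin, and the simplex is a facet iff the other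
  points all lie on one side of it. For fixed \<open>A\<close>, substitute \<open>y = A w\<close>; taking expectations and slicing the sphere
  orthogonally to \<open>w\<close> gives the law of \<open>1 / |A\<^sup>-\<^sup>1 y|\<close> for almost every \<open>y\<close>, and, both sides being continuous in \<open>y\<close>,
  at \<open>y = 1\<close>. Hence the distance has density proportional to
  \<open>(1 - h\<^sup>2) powr ((d\<^sup>2 - 2 d - 1) / 2)\<close> on \<open>[0, 1]\<close>, and the typical height has density proportional to
  \<open>(1 - h\<^sup>2) powr ((d\<^sup>2 - 2 d - 1) / 2) * F h ^ (n - d)\<close> on \<open>[-1, 1]\<close>, where \<open>F\<close> is the distribution function of one
  coordinate of \<open>X\<^sub>1\<close>. With \<open>h = r / sqrt d\<close> this density is \<open>exp (d * (f_rho \<rho> r + o(1)))\<close>, so the mass concentrates at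
  the maximum of \<open>f_rho \<rho>\<close>.
\<close>

subsection \<open>Volume scaling of linear maps\<close>

text \<open>The vector y = 1 is a null set, so no substitution reaches it directly. Letting y run
  over the whole space turns w into a Lebesgue variable; Fubini then allows w to be fixed instead of
  A, and a reflection that carries the direction of w to the first axis makes A w a multiple of the
  vector of first coordinates, whose law is explicit. The value at y = 1 is reached through a
  sequence of good points, so the height law is available for continuous test functions only. As the
  dimension is not a type, every change of variables is assembled from the affine substitution on
  the line, polar coordinates included. The constant of the height density stays abstract: it
  cancels in the conditional probability. With h = r / sqrt d, the power of 1 - h^2, whose exponent
  is close to d^2 / 2, is about exp (- d r^2 / 2), and F h ^ (n - d) is about Phi r to the power rho
  d; this is where \<open>f_rho\<close> comes from. A negative height means that all other points
  lie beyond the hyperplane as seen from the origin. Since F (- h) is the mass beyond h, both signs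
  fit into one integral over the line.\<close>

abbreviation leb :: "nat set \<Rightarrow> (nat \<Rightarrow> real) measure" where
  "leb I \<equiv> Pi\<^sub>M I (\<lambda>_. lborel)"

interpretation leb: product_sigma_finite "\<lambda>_::nat. lborel :: real measure"
  by standard

text \<open>Change of variables as an identity of integrals; for a linear \<open>T\<close> the
  constant is the absolute value of the determinant. With \<open>c\<close> on the side of the
  composed integral the identity is free of inverses, and maps compose with their constants
  multiplying.\<close>

definition scales_volume :: "nat set \<Rightarrow> ((nat \<Rightarrow> real) \<Rightarrow> nat \<Rightarrow> real) \<Rightarrow> real \<Rightarrow> bool" where
  "scales_volume I T c \<longleftrightarrow> 0 \<le> c \<and> T \<in> measurable (leb I) (leb I) \<and>
     (\<forall>f \<in> borel_measurable (leb I). ennreal c * (\<integral>\<^sup>+x. f (T x) \<partial>leb I) = (\<integral>\<^sup>+x. f x \<partial>leb I))"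

lemma scales_volumeD:
  assumes "scales_volume I T c" "f \<in> borel_measurable (leb I)"
  shows "ennreal c * (\<integral>\<^sup>+x. f (T x) \<partial>leb I) = (\<integral>\<^sup>+x. f x \<partial>leb I)"
  using assms unfolding scales_volume_def by blast

lemma scales_volume_compose:
  assumes S: "scales_volume I S a" and T: "scales_volume I T b"
  shows "scales_volume I (\<lambda>x. T (S x)) (a * b)"
  unfolding scales_volume_def
proof safe
  show "0 \<le> a * b" using S T by (simp add: scales_volume_def)
  have [measurable]: "S \<in> measurable (leb I) (leb I)" "T \<in> measurable (leb I) (leb I)"
    using S T by (auto simp: scales_volume_def)
  show "(\<lambda>x. T (S x)) \<in> measurable (leb I) (leb I)" by measurable
  fix f :: "(nat \<Rightarrow> real) \<Rightarrow> ennreal" assume [measurable]: "f \<in> borel_measurable (leb I)"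
  have "ennreal (a * b) * (\<integral>\<^sup>+x. f (T (S x)) \<partial>leb I) =
      ennreal b * (ennreal a * (\<integral>\<^sup>+x. (\<lambda>y. f (T y)) (S x) \<partial>leb I))"
    using S T by (simp add: scales_volume_def ennreal_mult mult_ac)
  also have "\<dots> = ennreal b * (\<integral>\<^sup>+x. f (T x) \<partial>leb I)"
    by (subst scales_volumeD[OF S]) auto
  also have "\<dots> = (\<integral>\<^sup>+x. f x \<partial>leb I)"
    by (subst scales_volumeD[OF T]) auto
  finally show "ennreal (a * b) * (\<integral>\<^sup>+x. f (T (S x)) \<partial>leb I) = (\<integral>\<^sup>+x. f x \<partial>leb I)" .
qed

lemma scales_volume_cong:
  assumes "scales_volume I S a" "\<And>x. x \<in> extensional I \<Longrightarrow> S x = T x" "a = b"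
  shows "scales_volume I T b"
proof -
  have eq: "x \<in> space (leb I) \<Longrightarrow> S x = T x" for x
    using assms(2) by (auto simp: space_PiM PiE_def)
  have "T \<in> measurable (leb I) (leb I) \<longleftrightarrow> S \<in> measurable (leb I) (leb I)"
    by (rule measurable_cong) (simp add: eq)
  moreover have "(\<integral>\<^sup>+x. f (T x) \<partial>leb I) = (\<integral>\<^sup>+x. f (S x) \<partial>leb I)" for f :: "(nat \<Rightarrow> real) \<Rightarrow> ennreal"
    by (rule nn_integral_cong) (simp add: eq)
  ultimately show ?thesis using assms(1,3) by (simp add: scales_volume_def)
qed

lemma scales_volume_id: "scales_volume I (\<lambda>x. x) 1"
  by (auto simp: scales_volume_def)

text \<open>With the other coordinates fixed, the new coordinate \<open>k\<close> is affine in the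
  old one with slope \<open>e k\<close>, so Fubini reduces the claim to the affine substitution on
  the line. Every linear map treated below is a composition of maps of this kind.\<close>

lemma scales_volume_coordinate:
  assumes I: "finite I" "k \<in> I" and e: "e k \<noteq> 0"
  shows "scales_volume I (\<lambda>x. x(k := (\<Sum>j\<in>I. e j * x j))) \<bar>e k\<bar>"
  unfolding scales_volume_def
proof safe
  let ?T = "\<lambda>x. x(k := (\<Sum>j\<in>I. e j * x j))"
  let ?J = "I - {k}"
  have ins: "insert k ?J = I" using I by auto
  show T: "?T \<in> measurable (leb I) (leb I)"
  proof (rule measurable_PiM_single')
    fix i assume i: "i \<in> I"
    have [measurable]: "(\<lambda>x. x i) \<in> borel_measurable (leb I)"
      using measurable_component_singleton[OF i, of "\<lambda>_. lborel"] by simp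
    have [measurable]: "(\<lambda>x. x j) \<in> borel_measurable (leb I)" if "j \<in> I" for j
      using measurable_component_singleton[OF that, of "\<lambda>_. lborel"] by simp
    have "(\<lambda>x. \<Sum>j\<in>I. e j * x j) \<in> borel_measurable (leb I)" by measurable
    then show "(\<lambda>x. ?T x i) \<in> measurable (leb I) lborel"
      by (cases "i = k") simp_all
  qed (use I in \<open>auto simp: space_PiM PiE_def extensional_def\<close>)
  note [measurable] = T
  fix f :: "(nat \<Rightarrow> real) \<Rightarrow> ennreal" assume f[measurable]: "f \<in> borel_measurable (leb I)"
  have f'[measurable]: "f \<in> borel_measurable (leb (insert k ?J))" using ins by simp
  have "(\<integral>\<^sup>+x. f (?T x) \<partial>leb I) = (\<integral>\<^sup>+x. f (?T x) \<partial>leb (insert k ?J))" using ins by simp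
  also have "\<dots> = (\<integral>\<^sup>+x. \<integral>\<^sup>+y. f (?T (x(k := y))) \<partial>lborel \<partial>leb ?J)"
    using T f I ins by (subst leb.product_nn_integral_insert) auto
  also have "\<bar>e k\<bar> * \<dots> = (\<integral>\<^sup>+x. \<bar>e k\<bar> * (\<integral>\<^sup>+y. f (?T (x(k := y))) \<partial>lborel) \<partial>leb ?J)"
  proof (subst nn_integral_cmult)
    have "(\<lambda>(x,y). x(k := y)) \<in> measurable (leb ?J \<Otimes>\<^sub>M lborel) (leb (insert k ?J))"
      by (rule measurable_add_dim)
    then have 1: "(\<lambda>z. (case z of (x,y) \<Rightarrow> x(k := y))) \<in> measurable (leb ?J \<Otimes>\<^sub>M lborel) (leb I)"
      using ins by simp
    have "(\<lambda>z. f (?T (case z of (x,y) \<Rightarrow> x(k := y)))) \<in> borel_measurable (leb ?J \<Otimes>\<^sub>M lborel)"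
      by (rule measurable_compose[OF measurable_compose[OF 1 T] f])
    then have "(\<lambda>(x,y). f (?T (x(k := y)))) \<in> borel_measurable (leb ?J \<Otimes>\<^sub>M lborel)"
      by (simp add: case_prod_beta')
    then show "(\<lambda>x. \<integral>\<^sup>+y. f (?T (x(k := y))) \<partial>lborel) \<in> borel_measurable (leb ?J)"
      by (rule lborel.borel_measurable_nn_integral)
  qed simp
  also have "\<dots> = (\<integral>\<^sup>+x. \<integral>\<^sup>+y. f (x(k := y)) \<partial>lborel \<partial>leb ?J)"
  proof (rule nn_integral_cong)
    fix x assume x: "x \<in> space (leb ?J)"
    define c where "c = (\<Sum>j\<in>?J. e j * x j)"
    have "(\<Sum>j\<in>I. e j * (x(k := y)) j) = c + e k * y" for y
    proof -
      have "(\<Sum>j\<in>I. e j * (x(k := y)) j) = e k * y + (\<Sum>j\<in>?J. e j * (x(k := y)) j)"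
        using I by (subst sum.remove[of _ k]) auto
      also have "(\<Sum>j\<in>?J. e j * (x(k := y)) j) = c" unfolding c_def by (rule sum.cong) auto
      finally show ?thesis by simp
    qed
    then have *: "?T (x(k := y)) = x(k := c + e k * y)" for y by simp
    have m: "(\<lambda>y. f (x(k := y))) \<in> borel_measurable borel"
      using measurable_compose[OF measurable_component_update[OF x, of k] f'] by simp
    show "\<bar>e k\<bar> * (\<integral>\<^sup>+y. f (?T (x(k := y))) \<partial>lborel) = (\<integral>\<^sup>+y. f (x(k := y)) \<partial>lborel)"
      unfolding * by (rule nn_integral_real_affine[OF m e, symmetric])
  qed
  also have "\<dots> = (\<integral>\<^sup>+x. f x \<partial>leb (insert k ?J))"
    using f I ins by (subst leb.product_nn_integral_insert) auto
  finally show "ennreal \<bar>e k\<bar> * (\<integral>\<^sup>+x. f (?T x) \<partial>leb I) = (\<integral>\<^sup>+x. f x \<partial>leb I)"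
    using ins by simp
qed auto

text \<open>Coordinate \<open>k\<close> is never changed, so the coordinates in \<open>J\<close> can
  be sheared one at a time, each with slope 1.\<close>

lemma scales_volume_shears:
  assumes I: "finite I" "k \<in> I" and J: "J \<subseteq> I - {k}"
  shows "scales_volume I (\<lambda>x. \<lambda>i\<in>I. if i \<in> J then x i + a i * x k else x i) 1"
proof -
  have "finite J" using I J by (meson finite_Diff finite_subset)
  then show ?thesis using J
  proof (induction J)
    case empty
    show ?case by (rule scales_volume_cong[OF scales_volume_id]) (auto simp: extensional_restrict)
  next
    case (insert l J)
    define e where "e = (\<lambda>j. if j = l then 1 else if j = k then a l else 0)"
    have l: "l \<in> I" "l \<noteq> k" "e l \<noteq> 0" using insert by (auto simp: e_def)
    have sum: "(\<Sum>j\<in>I. e j * y j) = y l + a l * y k" for y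
    proof -
      have "(\<Sum>j\<in>I. e j * y j) = (\<Sum>j\<in>{l, k}. e j * y j)"
        using l I by (intro sum.mono_neutral_right) (auto simp: e_def)
      then show ?thesis using l by (simp add: e_def)
    qed
    have C: "scales_volume I (\<lambda>x. x(l := (\<Sum>j\<in>I. e j * x j))) \<bar>e l\<bar>"
      by (rule scales_volume_coordinate) (use l I in auto)
    have IH: "scales_volume I (\<lambda>x. \<lambda>i\<in>I. if i \<in> J then x i + a i * x k else x i) 1"
      by (rule insert.IH) (use insert.prems in auto)
    show ?case
    proof (rule scales_volume_cong[OF scales_volume_compose[OF IH C]])
      fix x :: "nat \<Rightarrow> real"
      show "(\<lambda>x. x(l := (\<Sum>j\<in>I. e j * x j))) ((\<lambda>x. \<lambda>i\<in>I. if i \<in> J then x i + a i * x k else x i) x) =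
          (\<lambda>i\<in>I. if i \<in> insert l J then x i + a i * x k else x i)"
        unfolding sum using l I insert.hyps(2) insert.prems by (auto simp: fun_eq_iff)
    qed (simp add: e_def)
  qed
qed

text \<open>This is the matrix determinant lemma, det (1 + a b^T) = 1 + <a, b>, by four elementary
  maps: store B = <b, x> in coordinate \<open>k\<close>, shear the other coordinates by a i * B,
  rescale coordinate \<open>k\<close>, and solve for the true coordinate \<open>k\<close>. The outer
  two maps contribute \<open>b k\<close> and 1 / \<open>b k\<close>, which cancel.\<close>

lemma scales_volume_rank_one:
  assumes I: "finite I" "k \<in> I" and b: "b k \<noteq> 0"
    and nz: "1 + (\<Sum>j\<in>I. a j * b j) \<noteq> 0"
  shows "scales_volume I (\<lambda>x. \<lambda>i\<in>I. x i + a i * (\<Sum>j\<in>I. b j * x j)) \<bar>1 + (\<Sum>j\<in>I. a j * b j)\<bar>"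
proof -
  let ?s = "1 + (\<Sum>j\<in>I. a j * b j)"
  \<comment> \<open>Pairing the image x + B a with b gives (1 + <a, b>) B, which is what
    \<open>e3\<close> puts into coordinate \<open>k\<close>; \<open>e4\<close> then recovers the
    coordinate itself from this pairing and the other coordinates, dividing by the pivot
    \<open>b k\<close>.\<close>
  define e3 where "e3 = (\<lambda>j. if j = k then ?s else 0)"
  define e4 where "e4 = (\<lambda>j. if j = k then 1 / b k else - b j / b k)"
  have S1: "scales_volume I (\<lambda>x. x(k := (\<Sum>j\<in>I. b j * x j))) \<bar>b k\<bar>"
    by (rule scales_volume_coordinate) (use I b in auto)
  have S2: "scales_volume I (\<lambda>x. \<lambda>i\<in>I. if i \<in> I - {k} then x i + a i * x k else x i) 1"
    by (rule scales_volume_shears) (use I in auto)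
  have S3: "scales_volume I (\<lambda>x. x(k := (\<Sum>j\<in>I. e3 j * x j))) \<bar>e3 k\<bar>"
    by (rule scales_volume_coordinate) (use I nz in \<open>auto simp: e3_def\<close>)
  have S4: "scales_volume I (\<lambda>x. x(k := (\<Sum>j\<in>I. e4 j * x j))) \<bar>e4 k\<bar>"
    by (rule scales_volume_coordinate) (use I b in \<open>auto simp: e4_def\<close>)
  have sum3: "(\<Sum>j\<in>I. e3 j * y j) = ?s * y k" for y
    using I by (simp add: e3_def if_distrib[of "\<lambda>t. t * _"] sum.delta cong: if_cong)
  have sum4: "(\<Sum>j\<in>I. e4 j * y j) = (y k - (\<Sum>j\<in>I-{k}. b j * y j)) / b k" for y
  proof -
    have "(\<Sum>j\<in>I. e4 j * y j) = e4 k * y k + (\<Sum>j\<in>I-{k}. e4 j * y j)"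
      using I by (subst sum.remove[of _ k]) auto
    also have "(\<Sum>j\<in>I-{k}. e4 j * y j) = (\<Sum>j\<in>I-{k}. - (b j * y j) / b k)"
      by (rule sum.cong) (auto simp: e4_def)
    also have "\<dots> = - (\<Sum>j\<in>I-{k}. b j * y j) / b k"
      by (simp add: sum_divide_distrib sum_negf)
    finally show ?thesis by (simp add: e4_def diff_divide_distrib)
  qed
  have key: "(?s * B - (\<Sum>j\<in>I-{k}. b j * (x j + a j * B))) / b k = x k + a k * B"
    if "B = (\<Sum>j\<in>I. b j * x j)" for x B
  proof -
    have 1: "B = b k * x k + (\<Sum>j\<in>I-{k}. b j * x j)"
      unfolding that using I by (subst sum.remove[of _ k]) auto
    have 2: "(\<Sum>j\<in>I. a j * b j) = a k * b k + (\<Sum>j\<in>I-{k}. a j * b j)"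
      using I by (subst sum.remove[of _ k]) auto
    have 3: "(\<Sum>j\<in>I-{k}. b j * (x j + a j * B)) = (\<Sum>j\<in>I-{k}. b j * x j) + (\<Sum>j\<in>I-{k}. a j * b j) * B"
      by (simp add: algebra_simps sum.distrib sum_distrib_left)
    have "?s * B - (\<Sum>j\<in>I-{k}. b j * (x j + a j * B)) = B - (\<Sum>j\<in>I-{k}. b j * x j) + a k * b k * B"
      unfolding 2 3 by (simp add: algebra_simps)
    also have "\<dots> = b k * (x k + a k * B)" by (subst (1) 1) (simp add: algebra_simps)
    finally show ?thesis using b by simp
  qed
  show ?thesis
  proof (rule scales_volume_cong[OF scales_volume_compose[OF scales_volume_compose[OF
          scales_volume_compose[OF S1 S2] S3] S4]])
    fix x :: "nat \<Rightarrow> real" assume x: "x \<in> extensional I"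
    define B where "B = (\<Sum>j\<in>I. b j * x j)"
    define z where "z = (\<lambda>i\<in>I. if i \<in> I - {k} then (x(k := B)) i + a i * (x(k := B)) k else (x(k := B)) i)"
    have z: "z k = B" "\<And>i. i \<in> I - {k} \<Longrightarrow> z i = x i + a i * B" "\<And>i. i \<notin> I \<Longrightarrow> z i = undefined"
      using I by (auto simp: z_def)
    have "(\<Sum>j\<in>I - {k}. b j * (z(k := ?s * z k)) j) = (\<Sum>j\<in>I - {k}. b j * (x j + a j * B))"
      by (rule sum.cong) (simp_all add: z)
    then have "((z(k := ?s * z k)) k - (\<Sum>j\<in>I - {k}. b j * (z(k := ?s * z k)) j)) / b k = x k + a k * B"
      using key[OF B_def] z(1) by simp
    then have "(z(k := ?s * z k))(k := ((z(k := ?s * z k)) k - (\<Sum>j\<in>I - {k}. b j * (z(k := ?s * z k)) j)) / b k)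
        = (\<lambda>i\<in>I. x i + a i * B)"
      using I by (simp add: fun_eq_iff z)
    then show "(\<lambda>x. x(k := \<Sum>j\<in>I. e4 j * x j)) ((\<lambda>x. x(k := \<Sum>j\<in>I. e3 j * x j))
       ((\<lambda>x. \<lambda>i\<in>I. if i \<in> I - {k} then x i + a i * x k else x i)
          ((\<lambda>x. x(k := \<Sum>j\<in>I. b j * x j)) x))) =
      (\<lambda>i\<in>I. x i + a i * (\<Sum>j\<in>I. b j * x j))"
      unfolding sum3 sum4 B_def[symmetric] z_def[symmetric] .
  next
    show "\<bar>b k\<bar> * 1 * \<bar>e3 k\<bar> * \<bar>e4 k\<bar> = \<bar>?s\<bar>"
      using b by (simp add: e3_def e4_def)
  qed
qed

subsection \<open>Determinants and a reflection\<close>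

text \<open>Points are functions on the naturals, so a tuple of points serves as a matrix directly;
  entries with an index of at least \<open>d\<close> are ignored.\<close>

definition det_fun :: "nat \<Rightarrow> (nat \<Rightarrow> nat \<Rightarrow> real) \<Rightarrow> real" where
  "det_fun d a = Determinant.det (Matrix.mat d d (\<lambda>(i, j). a i j))"

lemma det_fun_cong:
  assumes "\<And>i j. i < d \<Longrightarrow> j < d \<Longrightarrow> a i j = b i j"
  shows "det_fun d a = det_fun d b"
proof -
  have "Matrix.mat d d (\<lambda>(i, j). a i j) = Matrix.mat d d (\<lambda>(i, j). b i j)"
    by (rule eq_matI) (use assms in auto)
  then show ?thesis by (simp add: det_fun_def)
qed

lemma det_fun_leibniz:
  "det_fun d a = (\<Sum>p | p permutes {0..<d}. signof p * (\<Prod>i = 0..<d. a i (p i)))"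
proof -
  have "(\<Prod>i = 0..<d. Matrix.mat d d (\<lambda>(i, j). a i j) $$ (i, p i)) = (\<Prod>i = 0..<d. a i (p i))"
    if "p permutes {0..<d}" for p
    by (rule prod.cong) (use permutes_in_image[OF that] in auto)
  then show ?thesis
    unfolding det_fun_def by (subst det_def'[of _ d]) auto
qed

lemma mat_mult_eq:
  "Matrix.mat d d (\<lambda>(i, j). a i j) * Matrix.mat d d (\<lambda>(i, j). b i j) =
     Matrix.mat d d (\<lambda>(i, j). \<Sum>k<d. a i k * b k j :: real)"
  by (rule eq_matI) (auto simp: scalar_prod_def lessThan_atLeast0)

lemma det_fun_mult: "det_fun d (\<lambda>i j. \<Sum>k<d. a i k * b k j) = det_fun d a * det_fun d b"
  unfolding det_fun_def mat_mult_eq[symmetric] by (rule det_mult[of _ d]) auto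

lemma mat_one_eq: "Matrix.mat d d (\<lambda>(i, j). if i = j then 1 else 0) = (1\<^sub>m d :: real mat)"
  by (rule eq_matI) auto

lemma det_fun_one: "det_fun d (\<lambda>i j. if i = j then 1 else 0) = 1"
  unfolding det_fun_def mat_one_eq by simp

lemma det_fun_transpose: "det_fun d (\<lambda>i j. a j i) = det_fun d a"
proof -
  have "Matrix.mat d d (\<lambda>(i, j). a j i) = transpose_mat (Matrix.mat d d (\<lambda>(i, j). a i j))"
    by (rule eq_matI) auto
  then show ?thesis
    unfolding det_fun_def by (metis det_transpose mat_carrier)
qed

lemma det_fun_cramer_column:
  assumes "k < d"
  shows "det_fun d (\<lambda>i j. if j = k then (\<Sum>l<d. a i l * x l) else a i j) = x k * det_fun d a"
proof -
  let ?A = "Matrix.mat d d (\<lambda>(i, j). a i j)"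
  let ?x = "Matrix.vec d x"
  have "replace_col ?A (?A *\<^sub>v ?x) k =
      Matrix.mat d d (\<lambda>(i, j). if j = k then (\<Sum>l<d. a i l * x l) else a i j)"
    unfolding replace_col_def by (rule eq_matI) (auto simp: scalar_prod_def lessThan_atLeast0)
  moreover have "Determinant.det (replace_col ?A (?A *\<^sub>v ?x) k) = vec_index ?x k * Determinant.det ?A"
    by (rule cramer_lemma_mat[of _ d]) (use assms in auto)
  ultimately show ?thesis using assms by (simp add: det_fun_def)
qed

lemma det_fun_cramer_row:
  assumes "k < d"
  shows "det_fun d (\<lambda>i j. if i = k then (\<Sum>l<d. e l * a l j) else a i j) = e k * det_fun d a"
proof -
  have "det_fun d (\<lambda>i j. if i = k then (\<Sum>l<d. e l * a l j) else a i j) =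
     det_fun d (\<lambda>i j. if j = k then (\<Sum>l<d. a l i * e l) else a j i)"
    by (subst det_fun_transpose[symmetric]) (rule det_fun_cong, auto simp: mult.commute)
  also have "\<dots> = e k * det_fun d (\<lambda>i j. a j i)"
    by (rule det_fun_cramer_column[OF assms])
  also have "det_fun d (\<lambda>i j. a j i) = det_fun d a" by (rule det_fun_transpose)
  finally show ?thesis .
qed

text \<open>The cofactors along row \<open>k\<close> do not involve that row, so one coefficient
  vector serves all \<open>v\<close>. Later arguments use only this linearity in a single
  row.\<close>

lemma det_fun_laplace_row:
  assumes "k < d"
  obtains c where "\<And>v. det_fun d (a(k := v)) = (\<Sum>j<d. v j * c j)"
proof
  fix v
  let ?A = "\<lambda>v. Matrix.mat d d (\<lambda>(i, j). (a(k := v)) i j)"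
  have cof: "cofactor (?A v) k j = cofactor (?A (\<lambda>_. 0)) k j" if "j < d" for j
  proof -
    have "mat_delete (?A v) k j = mat_delete (?A (\<lambda>_. 0)) k j"
      unfolding mat_delete_def by (rule eq_matI) auto
    then show ?thesis by (simp add: cofactor_def)
  qed
  have "det_fun d (a(k := v)) = (\<Sum>j<d. ?A v $$ (k, j) * cofactor (?A v) k j)"
    unfolding det_fun_def by (rule laplace_expansion_row) (use assms in auto)
  also have "\<dots> = (\<Sum>j<d. v j * cofactor (?A (\<lambda>_. 0)) k j)"
    by (rule sum.cong) (use assms cof in auto)
  finally show "det_fun d (a(k := v)) = (\<Sum>j<d. v j * cofactor (?A (\<lambda>_. 0)) k j)" .
qed

lemma det_fun_nonzero_inverse:
  assumes "det_fun d a \<noteq> 0"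
  obtains b where "\<And>i j. i < d \<Longrightarrow> j < d \<Longrightarrow> (\<Sum>k<d. a i k * b k j) = (if i = j then 1 else 0)"
    and "\<And>i j. i < d \<Longrightarrow> j < d \<Longrightarrow> (\<Sum>k<d. b i k * a k j) = (if i = j then 1 else 0)"
proof -
  let ?A = "Matrix.mat d d (\<lambda>(i, j). a i j)"
  let ?B = "adj_mat ?A"
  define b where "b i j = ?B $$ (i, j) / det_fun d a" for i j
  have A: "?A \<in> carrier_mat d d" by auto
  note adj = adj_mat[OF A]
  have dim: "dim_row ?B = d" "dim_col ?B = d" using adj(1) by auto
  have 1: "(\<Sum>k<d. a i k * ?B $$ (k, j)) = (if i = j then det_fun d a else 0)" if "i < d" "j < d" for i j
  proof -
    have "(?A * ?B) $$ (i, j) = (\<Sum>k<d. a i k * ?B $$ (k, j))"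
      using that dim by (auto simp: scalar_prod_def lessThan_atLeast0)
    then show ?thesis unfolding adj(2) det_fun_def using that by (simp split: if_splits)
  qed
  have 2: "(\<Sum>k<d. ?B $$ (i, k) * a k j) = (if i = j then det_fun d a else 0)" if "i < d" "j < d" for i j
  proof -
    have "(?B * ?A) $$ (i, j) = (\<Sum>k<d. ?B $$ (i, k) * a k j)"
      using that dim by (auto simp: scalar_prod_def lessThan_atLeast0)
    then show ?thesis unfolding adj(3) det_fun_def using that by (simp split: if_splits)
  qed
  show thesis
  proof (rule that[of b])
    fix i j assume "i < d" "j < d"
    then show "(\<Sum>k<d. a i k * b k j) = (if i = j then 1 else 0)"
      "(\<Sum>k<d. b i k * a k j) = (if i = j then 1 else 0)"
      using 1[of i j] 2[of i j] assms by (auto simp: b_def simp flip: sum_divide_distrib)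
  qed
qed

text \<open>Cramer's rule is taken as the definition because measurability and continuity in
  \<open>a\<close> and \<open>y\<close> are then inherited from determinants. For singular
  \<open>a\<close> the division gives 0, so the function is total.\<close>

definition cramer_sol :: "nat \<Rightarrow> (nat \<Rightarrow> nat \<Rightarrow> real) \<Rightarrow> (nat \<Rightarrow> real) \<Rightarrow> nat \<Rightarrow> real" where
  "cramer_sol d a y = (\<lambda>j\<in>{..<d}. det_fun d (\<lambda>i k. if k = j then y i else a i k) / det_fun d a)"

lemma cramer_sol_unique:
  assumes "det_fun d a \<noteq> 0" "w \<in> extensional {..<d}" "\<And>i. i < d \<Longrightarrow> (\<Sum>j<d. a i j * w j) = y i"
  shows "cramer_sol d a y = w"
proof (rule extensionalityI[of _ "{..<d}"])
  fix j assume "j \<in> {..<d}"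
  then have j: "j < d" by simp
  have "det_fun d (\<lambda>i k. if k = j then y i else a i k) =
      det_fun d (\<lambda>i k. if k = j then (\<Sum>l<d. a i l * w l) else a i k)"
    by (rule det_fun_cong) (simp add: assms(3))
  also have "\<dots> = w j * det_fun d a" by (rule det_fun_cramer_column[OF j])
  finally show "cramer_sol d a y j = w j" using assms(1) j by (simp add: cramer_sol_def)
qed (use assms(2) in \<open>simp_all add: cramer_sol_def\<close>)

lemma cramer_sol_solves:
  assumes nz: "det_fun d a \<noteq> 0" and i: "i < d"
  shows "(\<Sum>j<d. a i j * cramer_sol d a y j) = y i"
proof -
  obtain b where b: "\<And>i j. i < d \<Longrightarrow> j < d \<Longrightarrow> (\<Sum>k<d. a i k * b k j) = (if i = j then 1 else 0)"
    using det_fun_nonzero_inverse[OF nz] by metis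
  define w where "w = (\<lambda>j\<in>{..<d}. \<Sum>l<d. b j l * y l)"
  have w: "(\<Sum>j<d. a i j * w j) = y i" if "i < d" for i
  proof -
    have "(\<Sum>j<d. a i j * w j) = (\<Sum>j<d. \<Sum>l<d. a i j * b j l * y l)"
      by (rule sum.cong) (auto simp: w_def sum_distrib_left mult.assoc)
    also have "\<dots> = (\<Sum>l<d. (\<Sum>j<d. a i j * b j l) * y l)"
      by (subst sum.swap) (simp add: sum_distrib_right)
    also have "\<dots> = (\<Sum>l<d. (if i = l then y l else 0))"
      by (rule sum.cong) (use b that in auto)
    also have "\<dots> = y i" using that by simp
    finally show ?thesis .
  qed
  have "w \<in> extensional {..<d}" unfolding w_def by (rule restrict_extensional)
  then have "cramer_sol d a y = w" by (rule cramer_sol_unique[OF nz _ w])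
  then show ?thesis using w i by simp
qed

text \<open>
  The determinant of \<open>lead k a\<close> is the \<open>k\<close>-th leading principal minor of \<open>a\<close>. Passing from \<open>lead k a\<close> to
  \<open>lead (Suc k) a\<close> changes one coordinate of the image, so if no minor vanishes, no pivoting is needed below.
\<close>

definition lead :: "nat \<Rightarrow> (nat \<Rightarrow> nat \<Rightarrow> real) \<Rightarrow> nat \<Rightarrow> nat \<Rightarrow> real" where
  "lead k a = (\<lambda>i j. if i < k then a i j else if i = j then 1 else 0)"

lemma scales_volume_linear:
  assumes nz: "\<And>k. k \<le> d \<Longrightarrow> det_fun d (lead k a) \<noteq> 0"
  shows "scales_volume {..<d} (\<lambda>x. \<lambda>i\<in>{..<d}. \<Sum>j<d. a i j * x j) \<bar>det_fun d a\<bar>"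
proof -
  have "scales_volume {..<d} (\<lambda>x. \<lambda>i\<in>{..<d}. \<Sum>j<d. lead k a i j * x j) \<bar>det_fun d (lead k a)\<bar>"
    if "k \<le> d" for k
    using that
  proof (induction k)
    case 0
    show ?case
      by (rule scales_volume_cong[OF scales_volume_id])
        (auto simp: lead_def fun_eq_iff extensional_def det_fun_one if_distrib[of "\<lambda>t. t * _"] cong: if_cong)
  next
    case (Suc k)
    then have k: "k < d" by simp
    obtain b where b: "\<And>i j. i < d \<Longrightarrow> j < d \<Longrightarrow> (\<Sum>l<d. b i l * lead k a l j) = (if i = j then 1 else 0)"
      using det_fun_nonzero_inverse[OF nz[of k]] k by (metis less_imp_le)
    \<comment> \<open>\<open>e\<close> holds the coefficients of row \<open>k\<close> of
      \<open>a\<close> in terms of the rows of \<open>lead k a\<close>. Applied to the image under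
      \<open>lead k a\<close> it therefore produces coordinate \<open>k\<close> of the image under
      \<open>a\<close>, and \<open>e k\<close> is the ratio of consecutive minors.\<close>
    define e where "e l = (\<Sum>i<d. a k i * b i l)" for l
    have e: "(\<Sum>l<d. e l * lead k a l j) = a k j" if "j < d" for j
    proof -
      have "(\<Sum>l<d. e l * lead k a l j) = (\<Sum>l<d. \<Sum>i<d. a k i * (b i l * lead k a l j))"
        by (simp add: e_def sum_distrib_right mult.assoc)
      also have "\<dots> = (\<Sum>i<d. a k i * (\<Sum>l<d. b i l * lead k a l j))"
        by (subst sum.swap) (simp add: sum_distrib_left)
      also have "\<dots> = (\<Sum>i<d. if i = j then a k i else 0)"
        by (rule sum.cong) (use b that in auto)
      also have "\<dots> = a k j" using that by simp
      finally show ?thesis .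
    qed
    have det: "det_fun d (lead (Suc k) a) = e k * det_fun d (lead k a)"
    proof -
      have "det_fun d (lead (Suc k) a) = det_fun d (\<lambda>i j. if i = k then (\<Sum>l<d. e l * lead k a l j) else lead k a i j)"
        by (rule det_fun_cong) (auto simp: e, auto simp: lead_def)
      then show ?thesis by (simp only: det_fun_cramer_row[OF k])
    qed
    have ek: "e k \<noteq> 0" using det nz[of "Suc k"] Suc.prems by auto
    have C: "scales_volume {..<d} (\<lambda>x. x(k := (\<Sum>j<d. e j * x j))) \<bar>e k\<bar>"
      by (rule scales_volume_coordinate) (use k ek in auto)
    have IH: "scales_volume {..<d} (\<lambda>x. \<lambda>i\<in>{..<d}. \<Sum>j<d. lead k a i j * x j) \<bar>det_fun d (lead k a)\<bar>"
      by (rule Suc.IH) (use Suc.prems in simp)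
    show ?case
    proof (rule scales_volume_cong[OF scales_volume_compose[OF IH C]])
      fix x :: "nat \<Rightarrow> real"
      have "(\<Sum>l<d. e l * (\<lambda>i\<in>{..<d}. \<Sum>j<d. lead k a i j * x j) l) =
          (\<Sum>l<d. \<Sum>j<d. e l * lead k a l j * x j)"
        by (rule sum.cong) (auto simp: sum_distrib_left mult.assoc)
      also have "\<dots> = (\<Sum>j<d. (\<Sum>l<d. e l * lead k a l j) * x j)"
        by (subst sum.swap) (simp add: sum_distrib_right)
      also have "\<dots> = (\<Sum>j<d. a k j * x j)"
        by (rule sum.cong) (auto simp: e)
      finally have *: "(\<Sum>l<d. e l * (\<lambda>i\<in>{..<d}. \<Sum>j<d. lead k a i j * x j) l) = (\<Sum>j<d. a k j * x j)" .
      show "(\<lambda>x. x(k := (\<Sum>j<d. e j * x j))) ((\<lambda>x. \<lambda>i\<in>{..<d}. \<Sum>j<d. lead k a i j * x j) x) =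
          (\<lambda>i\<in>{..<d}. \<Sum>j<d. lead (Suc k) a i j * x j)"
        unfolding * using k by (auto simp: fun_eq_iff lead_def less_Suc_eq intro!: sum.cong)
    qed (simp add: det abs_mult mult.commute)
  qed
  from this[of d] have "scales_volume {..<d} (\<lambda>x. \<lambda>i\<in>{..<d}. \<Sum>j<d. lead d a i j * x j) \<bar>det_fun d (lead d a)\<bar>"
    by simp
  then show ?thesis
  proof (rule scales_volume_cong)
    have "det_fun d (lead d a) = det_fun d a" by (rule det_fun_cong) (simp add: lead_def)
    then show "\<bar>det_fun d (lead d a)\<bar> = \<bar>det_fun d a\<bar>" by simp
  qed (auto simp: fun_eq_iff lead_def)
qed

text \<open>
  \<open>swap_refl d u\<close> is the reflection that exchanges \<open>u\<close> and the first basis vector; for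
  \<open>u\<close> equal to that vector, \<open>v = 0\<close> and \<open>swap_refl d u\<close> is the identity because \<open>x / 0 = 0\<close>.
\<close>

definition swap_refl :: "nat \<Rightarrow> (nat \<Rightarrow> real) \<Rightarrow> (nat \<Rightarrow> real) \<Rightarrow> nat \<Rightarrow> real" where
  "swap_refl d u x = (let v = (\<lambda>i. (if i = 0 then 1 else 0) - u i) in
     (\<lambda>i\<in>{..<d}. x i - 2 * inner_Rd d v x / inner_Rd d v v * v i))"

lemma inner_Rd_nonneg: "inner_Rd d x x \<ge> 0"
  by (simp add: inner_Rd_def sum_nonneg)

lemma inner_Rd_zero_iff: "inner_Rd d x x = 0 \<longleftrightarrow> (\<forall>i<d. x i = 0)"
  by (auto simp: inner_Rd_def sum_nonneg_eq_0_iff)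

lemma inner_Rd_commute: "inner_Rd d x y = inner_Rd d y x"
  by (simp add: inner_Rd_def mult.commute)

lemma inner_Rd_cong: "(\<And>i. i < d \<Longrightarrow> x i = x' i) \<Longrightarrow> (\<And>i. i < d \<Longrightarrow> y i = y' i) \<Longrightarrow> inner_Rd d x y = inner_Rd d x' y'"
  unfolding inner_Rd_def by (rule sum.cong) auto

lemma inner_Rd_lincomb: "inner_Rd d (\<lambda>i. x i - c * v i) y = inner_Rd d x y - c * inner_Rd d v y"
  by (simp add: inner_Rd_def algebra_simps sum_subtractf sum_distrib_left)

lemma swap_refl_apply:
  fixes d u defines "v \<equiv> (\<lambda>i. (if i = 0 then 1 else 0) - u i)"
  shows "i < d \<Longrightarrow> swap_refl d u x i = x i - 2 * inner_Rd d v x / inner_Rd d v v * v i"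
  by (simp add: swap_refl_def v_def Let_def)

lemma inner_swap_refl_left:
  fixes d u defines "v \<equiv> (\<lambda>i. (if i = 0 then 1 else 0) - u i)"
  shows "inner_Rd d (swap_refl d u x) y = inner_Rd d x y - 2 * inner_Rd d v x / inner_Rd d v v * inner_Rd d v y"
proof -
  have "inner_Rd d (swap_refl d u x) y = inner_Rd d (\<lambda>i. x i - (2 * inner_Rd d v x / inner_Rd d v v) * v i) y"
    by (rule inner_Rd_cong) (simp_all add: swap_refl_apply v_def)
  then show ?thesis by (simp only: inner_Rd_lincomb)
qed

lemma inner_swap_refl: "inner_Rd d (swap_refl d u x) (swap_refl d u y) = inner_Rd d x y"
proof -
  define v where "v = (\<lambda>i. (if i = 0 then 1 else 0) - u i)"
  note L = inner_swap_refl_left[of d u, folded v_def]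
  have "inner_Rd d (swap_refl d u x) (swap_refl d u y) =
    inner_Rd d x (swap_refl d u y) - 2 * inner_Rd d v x / inner_Rd d v v * inner_Rd d v (swap_refl d u y)"
    by (rule L)
  also have "inner_Rd d x (swap_refl d u y) = inner_Rd d y x - 2 * inner_Rd d v y / inner_Rd d v v * inner_Rd d v x"
    by (subst inner_Rd_commute) (rule L)
  also have "inner_Rd d v (swap_refl d u y) = inner_Rd d y v - 2 * inner_Rd d v y / inner_Rd d v v * inner_Rd d v v"
    by (subst inner_Rd_commute) (rule L)
  finally show ?thesis
    by (cases "inner_Rd d v v = 0") (simp_all add: inner_Rd_commute field_simps)
qed

text \<open>The reflection is self-adjoint and sends the unit vector \<open>u\<close> to the first
  basis vector, so pairing with \<open>u\<close> reads off coordinate 0. In coordinates this rests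
  on <v, v> = 2 (1 - u 0) = - 2 <v, u>.\<close>

lemma inner_swap_refl_u:
  assumes u: "u \<in> sphere_Rd d" and d: "0 < d"
  shows "inner_Rd d (swap_refl d u x) u = x 0"
proof -
  define v where "v = (\<lambda>i. (if i = 0 then 1 else 0) - u i)"
  have uu: "inner_Rd d u u = 1"
    using u inner_Rd_nonneg[of d u] by (simp add: sphere_Rd_def norm_Rd_def)
  have v: "inner_Rd d v y = y 0 - inner_Rd d u y" for y
  proof -
    have "inner_Rd d v y = (\<Sum>k<d. (if k = 0 then y k else 0)) - inner_Rd d u y"
      by (simp add: inner_Rd_def v_def algebra_simps sum_subtractf if_distrib[of "\<lambda>t. _ * t"] cong: if_cong)
    then show ?thesis using d by simp
  qed
  have vu: "inner_Rd d v u = u 0 - 1" using v uu by simp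
  have vv: "inner_Rd d v v = 2 * (1 - u 0)"
    using v[of v] vu by (simp add: v_def[THEN fun_cong, of 0] inner_Rd_commute)
  show ?thesis
  proof (cases "u 0 = 1")
    case True
    then have "\<forall>i<d. v i = 0" using vv inner_Rd_zero_iff[of d v] by simp
    then have "inner_Rd d v x = 0" by (simp add: inner_Rd_def)
    then show ?thesis
      unfolding inner_swap_refl_left v_def[symmetric] using v[of x] by (simp add: inner_Rd_commute)
  next
    case False
    then show ?thesis
      unfolding inner_swap_refl_left v_def[symmetric] vv vu v[of x]
      by (simp add: inner_Rd_commute[of d x u] field_simps)
  qed
qed

text \<open>A rank-one perturbation with a = - 2 v / <v, v> and b = v has determinant 1 - 2 = - 1.
  Any nonzero coordinate of \<open>v\<close> serves as the pivot.\<close>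

lemma scales_volume_swap_refl: "scales_volume {..<d} (swap_refl d u) 1"
proof -
  define v where "v = (\<lambda>i. (if i = 0 then 1 else 0) - u i)"
  have eq: "swap_refl d u x = (\<lambda>i\<in>{..<d}. x i + (- 2 / inner_Rd d v v * v i) * (\<Sum>j<d. v j * x j))" for x
    by (auto simp: swap_refl_def v_def Let_def inner_Rd_def[of d _ x] algebra_simps fun_eq_iff)
  show ?thesis
  proof (cases "\<exists>k<d. v k \<noteq> 0")
    case True
    then obtain k where k: "k < d" "v k \<noteq> 0" by auto
    then have vv: "inner_Rd d v v \<noteq> 0" by (auto simp: inner_Rd_zero_iff)
    have "(\<Sum>j<d. (- 2 / inner_Rd d v v * v j) * v j) = - 2 / inner_Rd d v v * inner_Rd d v v"
      by (simp only: inner_Rd_def[of d v v] sum_distrib_left mult.assoc)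
    then have s: "1 + (\<Sum>j<d. (- 2 / inner_Rd d v v * v j) * v j) = -1" using vv by simp
    show ?thesis
      unfolding eq
      by (rule scales_volume_cong[OF scales_volume_rank_one[of _ k v "\<lambda>j. - 2 / inner_Rd d v v * v j"]])
        (use k s in auto)
  next
    case False
    then show ?thesis
      by (intro scales_volume_cong[OF scales_volume_id]) (auto simp: eq fun_eq_iff extensional_def)
  qed
qed

text \<open>\<open>q\<close> is the matrix of the reflection, acting on rows from the right; it is
  an involution, so its determinant squares to 1. If \<open>v\<close> vanishes, the constant
  \<open>c\<close> is 2 / 0 = 0 and \<open>q\<close> is the identity.\<close>

lemma det_fun_swap_refl: "\<bar>det_fun d (\<lambda>i. swap_refl d u (a i))\<bar> = \<bar>det_fun d a\<bar>"
proof -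
  define v where "v = (\<lambda>i. (if i = 0 then 1 else 0) - u i)"
  define c where "c = 2 / inner_Rd d v v"
  define q where "q i j = (if i = j then 1 else 0) - c * v i * v j" for i j :: nat
  have sumd: "(\<Sum>k<d. (if i = k then (1::real) else 0) * f k) = f i" if "i < d" for f :: "nat \<Rightarrow> real" and i
    using that by (simp add: if_distrib[of "\<lambda>t. t * _"] cong: if_cong)
  have sumd': "(\<Sum>k<d. f k * (if k = i then (1::real) else 0)) = f i" if "i < d" for f :: "nat \<Rightarrow> real" and i
    using that by (simp add: if_distrib[of "\<lambda>t. _ * t"] cong: if_cong)
  have "det_fun d (\<lambda>i. swap_refl d u (a i)) = det_fun d (\<lambda>i j. \<Sum>k<d. a i k * q k j)"
  proof (rule det_fun_cong)
    fix i j assume "i < d" "j < d"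
    have "(\<Sum>k<d. a i k * q k j) = (\<Sum>k<d. a i k * (if k = j then 1 else 0)) - (\<Sum>k<d. c * (v k * a i k) * v j)"
      unfolding q_def by (simp only: right_diff_distrib sum_subtractf mult_ac)
    also have "\<dots> = a i j - c * inner_Rd d v (a i) * v j"
      using \<open>j < d\<close> by (simp only: sumd' inner_Rd_def sum_distrib_left sum_distrib_right)
    finally show "swap_refl d u (a i) j = (\<Sum>k<d. a i k * q k j)"
      using \<open>j < d\<close> by (simp add: swap_refl_apply v_def c_def)
  qed
  also have "\<dots> = det_fun d a * det_fun d q" by (rule det_fun_mult)
  finally have 1: "det_fun d (\<lambda>i. swap_refl d u (a i)) = det_fun d a * det_fun d q" .
  have "det_fun d q * det_fun d q = det_fun d (\<lambda>i j. \<Sum>k<d. q i k * q k j)" by (rule det_fun_mult[symmetric])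
  also have "\<dots> = det_fun d (\<lambda>i j. if i = j then 1 else 0)"
  proof (rule det_fun_cong)
    fix i j assume ij: "i < d" "j < d"
    have "(\<Sum>k<d. q i k * q k j) = (\<Sum>k<d. (if i = k then 1 else 0) * q k j) - (\<Sum>k<d. c * v i * v k * q k j)"
      by (simp add: q_def[of i] algebra_simps sum_subtractf)
    also have "\<dots> = q i j - (\<Sum>k<d. (c * v i * v k) * (if k = j then 1 else 0)) + (\<Sum>k<d. c * v i * v k * (c * v k * v j))"
      using ij by (simp only: sumd q_def[of _ j] right_diff_distrib sum_subtractf)
    also have "(\<Sum>k<d. (c * v i * v k) * (if k = j then 1 else 0)) = c * v i * v j"
      using ij by (simp only: sumd')
    also have "(\<Sum>k<d. c * v i * v k * (c * v k * v j)) = c * c * v i * v j * inner_Rd d v v"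
      by (simp only: inner_Rd_def sum_distrib_left mult_ac)
    also have "q i j - c * v i * v j + c * c * v i * v j * inner_Rd d v v = (if i = j then 1 else 0)"
      by (cases "inner_Rd d v v = 0") (simp_all add: q_def c_def field_simps)
    finally show "(\<Sum>k<d. q i k * q k j) = (if i = j then 1 else 0)" .
  qed
  also have "\<dots> = 1" by (rule det_fun_one)
  finally have "\<bar>det_fun d q\<bar> = 1" by (metis abs_mult abs_one abs_mult_self_eq abs_abs power2_eq_square power2_eq_1_iff abs_minus_cancel)
  then show ?thesis using 1 by (simp add: abs_mult)
qed

subsection \<open>Polar coordinates\<close>

text \<open>The index set is a parameter because polar coordinates are used twice: on all
  coordinates, and on the coordinates \<open>{1..<d}\<close> of a slice.\<close>

definition normI :: "nat set \<Rightarrow> (nat \<Rightarrow> real) \<Rightarrow> real" where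
  "normI I x = sqrt (\<Sum>k\<in>I. x k * x k)"

definition dirI :: "nat set \<Rightarrow> (nat \<Rightarrow> real) \<Rightarrow> nat \<Rightarrow> real" where
  "dirI I x = (\<lambda>k\<in>I. x k / normI I x)"

lemma normI_nonneg: "normI I x \<ge> 0"
  by (simp add: normI_def sum_nonneg)

lemma sets_leb: "sets (leb I) = sets (Pi\<^sub>M I (\<lambda>_. borel))"
  by (rule sets_PiM_cong) auto

lemma measurable_coordinate_borel: "i \<in> I \<Longrightarrow> (\<lambda>x. x i) \<in> borel_measurable (Pi\<^sub>M I (\<lambda>_. borel))"
  using measurable_component_singleton[of i I "\<lambda>_. borel :: real measure"] by simp

lemma measurable_coordinate_leb: "i \<in> I \<Longrightarrow> (\<lambda>x. x i) \<in> borel_measurable (leb I)"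
  using measurable_component_singleton[of i I "\<lambda>_. lborel :: real measure"] by simp

lemma normI_measurable[measurable]: "normI I \<in> borel_measurable (Pi\<^sub>M I (\<lambda>_. borel))"
  unfolding normI_def
  supply measurable_coordinate_borel[measurable] by measurable

lemma normI_measurable_leb[measurable]: "normI I \<in> borel_measurable (leb I)"
  unfolding normI_def
  supply measurable_coordinate_leb[measurable] by measurable

lemma dirI_measurable_leb[measurable]: "dirI I \<in> measurable (leb I) (Pi\<^sub>M I (\<lambda>_. borel))"
  unfolding dirI_def
  by (intro measurable_restrict borel_measurable_divide measurable_coordinate_leb normI_measurable_leb)

lemma normI_scale: "normI I (\<lambda>i\<in>I. c * x i) = \<bar>c\<bar> * normI I x"
proof -
  have "(\<Sum>k\<in>I. (\<lambda>i\<in>I. c * x i) k * (\<lambda>i\<in>I. c * x i) k) = c\<^sup>2 * (\<Sum>k\<in>I. x k * x k)"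
    unfolding sum_distrib_left by (rule sum.cong) (auto simp: power2_eq_square)
  then show ?thesis by (simp add: normI_def real_sqrt_mult)
qed

lemma dirI_scale: "c > 0 \<Longrightarrow> dirI I (\<lambda>i\<in>I. c * x i) = dirI I x"
  unfolding dirI_def normI_scale by (auto simp: fun_eq_iff)

lemma scales_volume_scaling:
  assumes I: "finite I" and c: "c \<noteq> 0"
  shows "scales_volume I (\<lambda>x. \<lambda>i\<in>I. c * x i) (\<bar>c\<bar> ^ card I)"
proof -
  have "scales_volume I (\<lambda>x. \<lambda>i\<in>I. if i \<in> J then c * x i else x i) (\<bar>c\<bar> ^ card J)" if "J \<subseteq> I" for J
    using finite_subset[OF that I] that
  proof (induction J)
    case empty
    show ?case by (rule scales_volume_cong[OF scales_volume_id]) (auto simp: extensional_restrict)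
  next
    case (insert l J)
    have l: "l \<in> I" using insert.prems by simp
    have sum: "(\<Sum>j\<in>I. (if j = l then c else 0) * y j) = c * y l" for y :: "nat \<Rightarrow> real"
      using l I by (simp add: if_distrib[of "\<lambda>t. t * _"] sum.delta cong: if_cong)
    have C: "scales_volume I (\<lambda>x. x(l := (\<Sum>j\<in>I. (if j = l then c else 0) * x j))) \<bar>if l = l then c else 0\<bar>"
      by (rule scales_volume_coordinate) (use l I c in auto)
    have IH: "scales_volume I (\<lambda>x. \<lambda>i\<in>I. if i \<in> J then c * x i else x i) (\<bar>c\<bar> ^ card J)"
      by (rule insert.IH) (use insert.prems in auto)
    show ?case
    proof (rule scales_volume_cong[OF scales_volume_compose[OF IH C]])
      fix x :: "nat \<Rightarrow> real"
      show "(\<lambda>x. x(l := (\<Sum>j\<in>I. (if j = l then c else 0) * x j))) ((\<lambda>x. \<lambda>i\<in>I. if i \<in> J then c * x i else x i) x) =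
          (\<lambda>i\<in>I. if i \<in> insert l J then c * x i else x i)"
        unfolding sum using l insert.hyps by (auto simp: fun_eq_iff)
    qed (use insert.hyps in simp)
  qed
  from this[of I] have "scales_volume I (\<lambda>x. \<lambda>i\<in>I. if i \<in> I then c * x i else x i) (\<bar>c\<bar> ^ card I)" by simp
  then show ?thesis by (rule scales_volume_cong) (auto simp: fun_eq_iff)
qed

lemma AE_leb_coordinate_nonzero:
  assumes I: "finite I" "k \<in> I"
  shows "AE x in leb I. x k \<noteq> 0"
proof -
  have "emeasure (leb I) (Pi\<^sub>E I (\<lambda>i. if i = k then {0} else UNIV)) =
      (\<Prod>i\<in>I. emeasure lborel (if i = k then {0} else UNIV :: real set))"
    by (rule leb.emeasure_PiM) (use I in auto)
  also have "\<dots> = 0" by (rule prod_zero) (use I in auto)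
  finally have N: "Pi\<^sub>E I (\<lambda>i. if i = k then {0::real} else UNIV) \<in> null_sets (leb I)"
    by (intro null_setsI) (use I in auto)
  show ?thesis
    by (rule AE_I'[OF N]) (auto simp: space_PiM PiE_def Pi_def)
qed

lemma AE_leb_normI_pos:
  assumes I: "finite I" "I \<noteq> {}"
  shows "AE x in leb I. normI I x > 0"
proof -
  obtain k where k: "k \<in> I" using I by auto
  have "AE x in leb I. x k \<noteq> 0" by (rule AE_leb_coordinate_nonzero) (use I k in auto)
  then show ?thesis
  proof eventually_elim
    case (elim x)
    then have "0 < x k * x k" by (simp add: zero_less_mult_iff) linarith
    also have "\<dots> \<le> (\<Sum>k\<in>I. x k * x k)" using I k by (intro member_le_sum) auto
    finally show ?case by (simp add: normI_def)
  qed
qed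

text \<open>For finite nonempty \<open>I\<close> and nonzero \<alpha> this is the surface measure of
  the unit sphere divided by the absolute value of \<alpha>: the weight integrates radially to that
  constant. Presenting it as the image of a weighted Lebesgue measure is what lets
  \<open>polar\<close> be proved by linear substitutions.\<close>

definition cone :: "real \<Rightarrow> nat set \<Rightarrow> (nat \<Rightarrow> real) measure" where
  "cone \<alpha> I = distr
     (density (leb I) (\<lambda>x. ennreal (indicator {1..} (normI I x powr \<alpha>) / normI I x powr \<alpha> * normI I x powr (- real (card I)))))
     (Pi\<^sub>M I (\<lambda>_. borel)) (dirI I)"

lemma sets_cone[simp, measurable_cong]: "sets (cone \<alpha> I) = sets (Pi\<^sub>M I (\<lambda>_. borel))"
  by (simp add: cone_def)

lemma space_cone[simp]: "space (cone \<alpha> I) = space (Pi\<^sub>M I (\<lambda>_. borel))"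
  by (simp add: cone_def)

lemma nn_integral_cone:
  assumes [measurable]: "f \<in> borel_measurable (Pi\<^sub>M I (\<lambda>_. borel))"
  shows "(\<integral>\<^sup>+z. f z \<partial>cone \<alpha> I) = (\<integral>\<^sup>+x. ennreal (indicator {1..} (normI I x powr \<alpha>) /
    normI I x powr \<alpha> * normI I x powr (- real (card I))) * f (dirI I x) \<partial>leb I)"
proof -
  define w where "w = (\<lambda>x. ennreal (indicator {1..} (normI I x powr \<alpha>) / normI I x powr \<alpha> * normI I x powr (- real (card I))))"
  have w[measurable]: "w \<in> borel_measurable (leb I)" unfolding w_def by measurable
  have "(\<integral>\<^sup>+z. f z \<partial>cone \<alpha> I) = (\<integral>\<^sup>+x. f (dirI I x) \<partial>density (leb I) w)"
    unfolding cone_def w_def[symmetric] by (rule nn_integral_distr) measurable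
  also have "\<dots> = (\<integral>\<^sup>+x. w x * f (dirI I x) \<partial>leb I)"
    by (rule nn_integral_density) measurable
  finally show ?thesis unfolding w_def .
qed

text \<open>
  Polar integration, with \<open>normI I x powr \<alpha>\<close> as the radial variable. Both sides equal
  \<open>\<integral>\<integral> H (dir x, s |x|\<^sup>\<alpha>) k (|x|\<^sup>\<alpha>) s\<^sup>\<beta>\<^sup>-\<^sup>1 ds dx\<close> where \<open>k r = 1/r\<close> for \<open>r \<ge> 1\<close>:
  scale \<open>s\<close> for fixed \<open>x\<close>, or scale \<open>x\<close> for fixed \<open>s\<close>. So only linear substitutions are needed.
\<close>

lemma polar:
  fixes H :: "(nat \<Rightarrow> real) \<times> real \<Rightarrow> ennreal"
  assumes I: "finite I" "I \<noteq> {}" and \<alpha>: "\<alpha> \<noteq> 0"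
    and H[measurable]: "H \<in> borel_measurable (Pi\<^sub>M I (\<lambda>_. borel) \<Otimes>\<^sub>M borel)"
  shows "(\<integral>\<^sup>+x. H (dirI I x, normI I x powr \<alpha>) \<partial>leb I) =
    (\<integral>\<^sup>+z. \<integral>\<^sup>+v. H (z, v) * ennreal (v powr (card I / \<alpha> - 1)) * indicator {0<..} v \<partial>lborel \<partial>cone \<alpha> I)"
proof -
  define m where "m = card I"
  define \<beta> where "\<beta> = m / \<alpha>"
  define k :: "real \<Rightarrow> real" where "k r = indicator {1..} r / r" for r
  have k[measurable]: "k \<in> borel_measurable borel" unfolding k_def by measurable
  have k0: "k r \<ge> 0" for r by (simp add: k_def indicator_def)
  interpret L: sigma_finite_measure "leb I" by (rule leb.sigma_finite[OF I(1)])
  interpret P: pair_sigma_finite "leb I" "lborel :: real measure" ..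
  let ?J = "\<lambda>x s. H (dirI I x, s * normI I x powr \<alpha>) * ennreal (k (normI I x powr \<alpha>)) *
      ennreal (s powr (\<beta> - 1)) * indicator {0<..} s"
  have Jm[measurable]: "(\<lambda>(x, s). ?J x s) \<in> borel_measurable (leb I \<Otimes>\<^sub>M lborel)" by measurable
  let ?h = "\<lambda>z v. H (z, v) * ennreal (v powr (\<beta> - 1)) * indicator {0<..} v"
  have hm: "(\<lambda>z. \<integral>\<^sup>+v. ?h z v \<partial>lborel) \<in> borel_measurable (Pi\<^sub>M I (\<lambda>_. borel))" by measurable
  have 1: "(\<integral>\<^sup>+x. \<integral>\<^sup>+s. ?J x s \<partial>lborel \<partial>leb I) = (\<integral>\<^sup>+z. \<integral>\<^sup>+v. ?h z v \<partial>lborel \<partial>cone \<alpha> I)"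
    unfolding nn_integral_cone[OF hm]
  proof (rule nn_integral_cong_AE, rule eventually_mono[OF AE_leb_normI_pos[OF I]])
    fix x assume pos: "normI I x > 0"
    have "dirI I x \<in> space (Pi\<^sub>M I (\<lambda>_. borel))" by (auto simp: dirI_def space_PiM)
    then have [measurable]: "(\<lambda>v. H (dirI I x, v)) \<in> borel_measurable borel"
      by (rule measurable_compose[OF measurable_Pair1' H])
    define a where "a = normI I x powr \<alpha>"
    have a: "a > 0" using pos by (simp add: a_def)
    have am: "a powr - \<beta> = normI I x powr - real m"
      using pos \<alpha> by (simp add: a_def powr_powr \<beta>_def)
    have "(\<integral>\<^sup>+v. ?h (dirI I x) v \<partial>lborel) = \<bar>a\<bar> * (\<integral>\<^sup>+s. ?h (dirI I x) (0 + a * s) \<partial>lborel)"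
      by (rule nn_integral_real_affine) (use a in simp_all)
    also have "(\<integral>\<^sup>+s. ?h (dirI I x) (0 + a * s) \<partial>lborel) =
        (\<integral>\<^sup>+s. ennreal (a powr (\<beta> - 1)) *
          (H (dirI I x, s * a) * ennreal (s powr (\<beta> - 1)) * indicator {0<..} s) \<partial>lborel)"
      by (rule nn_integral_cong) (use a in \<open>auto simp: indicator_def zero_less_mult_iff powr_mult ennreal_mult mult_ac\<close>)
    finally have A: "(\<integral>\<^sup>+v. ?h (dirI I x) v \<partial>lborel) = ennreal a * (ennreal (a powr (\<beta> - 1)) *
        (\<integral>\<^sup>+s. H (dirI I x, s * a) * ennreal (s powr (\<beta> - 1)) * indicator {0<..} s \<partial>lborel))"
      using a by (subst (asm) nn_integral_cmult) auto
    have "ennreal (a powr - \<beta>) * (ennreal a * ennreal (a powr (\<beta> - 1))) = ennreal (a powr - \<beta> * (a powr 1 * a powr (\<beta> - 1)))"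
      using a by (simp add: ennreal_mult)
    also have "a powr - \<beta> * (a powr 1 * a powr (\<beta> - 1)) = 1"
      unfolding powr_add[symmetric] using a by simp
    finally have one: "ennreal (a powr - \<beta>) * (ennreal a * ennreal (a powr (\<beta> - 1))) = 1" by simp
    have B: "ennreal (a powr - \<beta>) * (\<integral>\<^sup>+v. ?h (dirI I x) v \<partial>lborel) =
      (\<integral>\<^sup>+s. H (dirI I x, s * a) * ennreal (s powr (\<beta> - 1)) * indicator {0<..} s \<partial>lborel)"
      unfolding A using one by (simp add: mult.assoc[symmetric])
    have "(\<integral>\<^sup>+s. ?J x s \<partial>lborel) = ennreal (k a) *
        (\<integral>\<^sup>+s. H (dirI I x, s * a) * ennreal (s powr (\<beta> - 1)) * indicator {0<..} s \<partial>lborel)"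
      unfolding a_def[symmetric] by (subst nn_integral_cmult[symmetric]) (auto simp: mult_ac)
    also have "\<dots> = ennreal (k a * normI I x powr - real m) * (\<integral>\<^sup>+v. ?h (dirI I x) v \<partial>lborel)"
      unfolding B[symmetric] am using k0 by (simp add: ennreal_mult mult.assoc)
    finally show "(\<integral>\<^sup>+s. ?J x s \<partial>lborel) = ennreal (indicator {1..} (normI I x powr \<alpha>) /
        normI I x powr \<alpha> * normI I x powr - real (card I)) * (\<integral>\<^sup>+v. ?h (dirI I x) v \<partial>lborel)"
      by (simp add: k_def a_def m_def)
  qed
  have 2: "(\<integral>\<^sup>+x. \<integral>\<^sup>+s. ?J x s \<partial>lborel \<partial>leb I) = (\<integral>\<^sup>+s. \<integral>\<^sup>+x. ?J x s \<partial>leb I \<partial>lborel)"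
    by (rule P.Fubini'[symmetric]) simp
  let ?K = "\<lambda>x s. H (dirI I x, normI I x powr \<alpha>) * (ennreal (k (normI I x powr \<alpha> / s) / s) * indicator {0<..} s)"
  have 3: "(\<integral>\<^sup>+x. ?J x s \<partial>leb I) = (\<integral>\<^sup>+x. ?K x s \<partial>leb I)" for s
  proof (cases "s > 0")
    case s: True
    \<comment> \<open>Chosen so that scaling \<open>x\<close> by \<open>c\<close> divides the radial
      variable \<open>normI I x powr \<alpha>\<close> by \<open>s\<close>.\<close>
    define c where "c = s powr (- 1 / \<alpha>)"
    have c: "c > 0" using s by (simp add: c_def)
    have "c powr \<alpha> = s powr (- 1)" unfolding c_def powr_powr using \<alpha> by simp
    then have ca: "c powr \<alpha> = 1 / s" using s by (simp add: powr_minus_divide)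
    have cm: "c ^ card I = s powr - \<beta>"
      using s by (simp add: c_def powr_realpow[symmetric] powr_powr \<beta>_def m_def)
    have T: "scales_volume I (\<lambda>x. \<lambda>i\<in>I. c * x i) (\<bar>c\<bar> ^ card I)"
      by (rule scales_volume_scaling) (use I c in auto)
    let ?g = "\<lambda>x. H (dirI I x, s * normI I x powr \<alpha>) * ennreal (k (normI I x powr \<alpha>))"
    have na: "normI I (\<lambda>i\<in>I. c * x i) powr \<alpha> = normI I x powr \<alpha> / s" for x
      unfolding normI_scale using c normI_nonneg[of I x] ca by (simp add: powr_mult)
    have "(\<integral>\<^sup>+x. ?g x \<partial>leb I) = ennreal (\<bar>c\<bar> ^ card I) * (\<integral>\<^sup>+x. ?g (\<lambda>i\<in>I. c * x i) \<partial>leb I)"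
      by (rule scales_volumeD[OF T, symmetric]) measurable
    also have "\<bar>c\<bar> ^ card I = s powr - \<beta>" using c cm by simp
    also have "(\<lambda>x. ?g (\<lambda>i\<in>I. c * x i)) = (\<lambda>x. H (dirI I x, normI I x powr \<alpha>) * ennreal (k (normI I x powr \<alpha> / s)))"
      unfolding na dirI_scale[OF c] using s by simp
    finally have g: "(\<integral>\<^sup>+x. ?g x \<partial>leb I) = ennreal (s powr - \<beta>) *
       (\<integral>\<^sup>+x. H (dirI I x, normI I x powr \<alpha>) * ennreal (k (normI I x powr \<alpha> / s)) \<partial>leb I)" .
    have "(\<integral>\<^sup>+x. ?J x s \<partial>leb I) = ennreal (s powr (\<beta> - 1)) * (\<integral>\<^sup>+x. ?g x \<partial>leb I)"
      using s by (subst nn_integral_cmult[symmetric]) (auto simp: mult_ac)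
    also have "\<dots> = ennreal (1 / s) *
       (\<integral>\<^sup>+x. H (dirI I x, normI I x powr \<alpha>) * ennreal (k (normI I x powr \<alpha> / s)) \<partial>leb I)"
    proof -
      have "s powr (\<beta> - 1) * s powr - \<beta> = s powr (- 1)" unfolding powr_add[symmetric] by simp
      then have "ennreal (s powr (\<beta> - 1)) * ennreal (s powr - \<beta>) = ennreal (1 / s)"
        using s by (simp add: powr_minus_divide flip: ennreal_mult)
      then show ?thesis unfolding g by (simp add: mult.assoc[symmetric])
    qed
    also have "\<dots> = (\<integral>\<^sup>+x. ?K x s \<partial>leb I)"
      using s k0 by (subst nn_integral_cmult[symmetric])
        (auto intro!: nn_integral_cong simp: divide_inverse mult_ac ennreal_mult)
    finally show ?thesis .
  qed simp
  have 4: "(\<integral>\<^sup>+s. \<integral>\<^sup>+x. ?K x s \<partial>leb I \<partial>lborel) = (\<integral>\<^sup>+x. \<integral>\<^sup>+s. ?K x s \<partial>lborel \<partial>leb I)"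
    by (rule P.Fubini') measurable
  also have "\<dots> = (\<integral>\<^sup>+x. H (dirI I x, normI I x powr \<alpha>) \<partial>leb I)"
  proof (rule nn_integral_cong_AE, rule eventually_mono[OF AE_leb_normI_pos[OF I]])
    fix x assume pos: "normI I x > 0"
    have "dirI I x \<in> space (Pi\<^sub>M I (\<lambda>_. borel))" by (auto simp: dirI_def space_PiM)
    then have [measurable]: "(\<lambda>v. H (dirI I x, v)) \<in> borel_measurable borel"
      by (rule measurable_compose[OF measurable_Pair1' H])
    define a where "a = normI I x powr \<alpha>"
    have a: "a > 0" using pos by (simp add: a_def)
    \<comment> \<open>\<open>k (a / s)\<close> is nonzero only for s <= a, where
      \<open>k (a / s) / s\<close> equals 1 / a; the integral over (0, a] is therefore 1. The kernel
      \<open>k\<close> was chosen for this normalisation.\<close>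
    have "(\<integral>\<^sup>+s. ennreal (k (a / s) / s) * indicator {0<..} s \<partial>lborel) =
        (\<integral>\<^sup>+s. ennreal (1 / a) * indicator {0<..a} s \<partial>lborel)"
      by (rule nn_integral_cong) (use a in \<open>auto simp: k_def indicator_def field_simps\<close>)
    also have "\<dots> = ennreal (1 / a) * ennreal a"
      using a by (subst nn_integral_cmult_indicator) auto
    also have "\<dots> = 1" using a by (simp flip: ennreal_mult)
    finally show "(\<integral>\<^sup>+s. ?K x s \<partial>lborel) = H (dirI I x, normI I x powr \<alpha>)"
      unfolding a_def[symmetric] by (subst nn_integral_cmult) auto
  qed
  finally show ?thesis using 1 2 3 by (simp add: \<beta>_def m_def)
qed

lemma emeasure_unit_ball_finite:
  assumes I: "finite I"
  shows "emeasure (leb I) {x \<in> space (leb I). normI I x \<le> 1} < \<infinity>"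
proof -
  have "emeasure (leb I) {x \<in> space (leb I). normI I x \<le> 1} \<le> emeasure (leb I) (Pi\<^sub>E I (\<lambda>_. {-1..1}))"
  proof (rule emeasure_mono)
    show "{x \<in> space (leb I). normI I x \<le> 1} \<subseteq> Pi\<^sub>E I (\<lambda>_. {-1..1})"
    proof
      fix x assume "x \<in> {x \<in> space (leb I). normI I x \<le> 1}"
      then have x: "x \<in> space (leb I)" "normI I x \<le> 1" by auto
      have "x i \<in> {-1..1}" if i: "i \<in> I" for i
      proof -
        have "x i * x i \<le> (\<Sum>k\<in>I. x k * x k)" using I i by (intro member_le_sum) auto
        also have "\<dots> \<le> 1" using x(2) by (simp add: normI_def)
        finally have "(x i)\<^sup>2 \<le> 1" by (simp add: power2_eq_square)
        then have "\<bar>x i\<bar> \<le> 1" by (simp add: abs_square_le_1)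
        then show ?thesis by auto
      qed
      then show "x \<in> Pi\<^sub>E I (\<lambda>_. {-1..1})" using x(1) by (auto simp: space_PiM PiE_def)
    qed
  qed (use I in auto)
  also have "\<dots> = (\<Prod>i\<in>I. emeasure lborel {-1..1::real})" by (rule leb.emeasure_PiM) (use I in auto)
  also have "\<dots> < \<infinity>" by (simp add: ennreal_power power_less_top_ennreal)
  finally show ?thesis .
qed

text \<open>\<open>polar\<close> is applied to the indicator of the unit ball, expressed through the
  radial variable by \<open>S\<close>: the total mass times a radial constant is at most the volume
  of the ball. The radial constant is positive because \<open>S\<close> contains an interval of
  length 1.\<close>

lemma finite_measure_cone:
  assumes I: "finite I" "I \<noteq> {}" and \<alpha>: "\<alpha> \<noteq> 0"
  shows "finite_measure (cone \<alpha> I)"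
proof
  define S :: "real set" where "S = {v. v > 0 \<and> v powr (1 / \<alpha>) \<le> 1}"
  have S[measurable]: "S \<in> sets borel" unfolding S_def by measurable
  let ?c = "\<integral>\<^sup>+v. indicator S v * ennreal (v powr (card I / \<alpha> - 1)) * indicator {0<..} v \<partial>lborel"
  have S_int: "if \<alpha> > 0 then {0<..1} \<subseteq> S else {1..2} \<subseteq> S"
  proof -
    have "v powr (1 / \<alpha>) \<le> 1" if "\<alpha> < 0" "v \<ge> 1" for v
      using that powr_mono[of "1 / \<alpha>" 0 v] by simp
    then show ?thesis using \<alpha> by (auto simp: S_def powr_le1)
  qed
  have pos: "?c > 0"
  proof (rule ccontr)
    assume "\<not> ?c > 0"
    then have "AE v in lborel. indicator S v * ennreal (v powr (card I / \<alpha> - 1)) * indicator {0<..} v = 0"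
      by (subst nn_integral_0_iff_AE[symmetric]) auto
    then have "AE v in lborel. v \<notin> S"
      by eventually_elim (auto simp: S_def)
    then have "emeasure lborel S = 0" by (subst (asm) AE_iff_measurable[OF _ refl]) auto
    moreover have "emeasure lborel S \<ge> 1"
    proof (cases "\<alpha> > 0")
      case True
      then have "emeasure lborel {0<..1::real} \<le> emeasure lborel S" using S_int by (intro emeasure_mono) auto
      then show ?thesis by simp
    next
      case False
      then have "emeasure lborel {1..2::real} \<le> emeasure lborel S" using S_int by (intro emeasure_mono) auto
      then show ?thesis by simp
    qed
    ultimately show False by simp
  qed
  have "emeasure (cone \<alpha> I) (space (cone \<alpha> I)) * ?c =
     (\<integral>\<^sup>+z. \<integral>\<^sup>+v. (\<lambda>(z, v). indicator S v) (z, v) * ennreal (v powr (card I / \<alpha> - 1)) * indicator {0<..} v \<partial>lborel \<partial>cone \<alpha> I)"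
    by (simp add: mult.commute)
  also have "\<dots> = (\<integral>\<^sup>+x. (\<lambda>(z, v). indicator S v) (dirI I x, normI I x powr \<alpha>) \<partial>leb I)"
    by (rule polar[OF I \<alpha>, symmetric]) measurable
  also have "\<dots> \<le> (\<integral>\<^sup>+x. indicator {x \<in> space (leb I). normI I x \<le> 1} x \<partial>leb I)"
    by (rule nn_integral_mono)
      (use \<alpha> normI_nonneg[of I] in \<open>auto simp: indicator_def S_def powr_powr split: if_splits\<close>)
  also have "\<dots> = emeasure (leb I) {x \<in> space (leb I). normI I x \<le> 1}"
    by (rule nn_integral_indicator) measurable
  also have "\<dots> < \<infinity>" by (rule emeasure_unit_ball_finite[OF I(1)])
  finally have "emeasure (cone \<alpha> I) (space (cone \<alpha> I)) * ?c < \<infinity>" .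
  then show "emeasure (cone \<alpha> I) (space (cone \<alpha> I)) \<noteq> \<infinity>"
    using pos by (auto simp: ennreal_top_mult split: if_splits)
qed

lemma normI_dirI: "normI I x > 0 \<Longrightarrow> finite I \<Longrightarrow> normI I (dirI I x) = 1"
proof -
  assume p: "normI I x > 0" and I: "finite I"
  have "(\<Sum>k\<in>I. dirI I x k * dirI I x k) = (\<Sum>k\<in>I. x k * x k) / (normI I x)\<^sup>2"
    unfolding sum_divide_distrib by (rule sum.cong) (auto simp: dirI_def power2_eq_square)
  also have "(\<Sum>k\<in>I. x k * x k) = (normI I x)\<^sup>2" by (simp add: normI_def sum_nonneg)
  finally show ?thesis using p by (simp add: normI_def[of I "dirI I x"])
qed

lemma AE_cone: assumes I: "finite I" "I \<noteq> {}" shows "AE z in cone \<alpha> I. normI I z = 1"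
proof -
  have "AE x in density (leb I) f. normI I (dirI I x) = 1"
    if [measurable]: "f \<in> borel_measurable (leb I)" for f :: "(nat \<Rightarrow> real) \<Rightarrow> ennreal"
    using AE_leb_normI_pos[OF I] by (subst AE_density) (auto elim!: eventually_mono simp: normI_dirI I)
  then show ?thesis unfolding cone_def by (subst AE_distr_iff) auto
qed

subsection \<open>Slices of the sphere\<close>

declare One_nat_def[simp del]

lemma norm_Rd_eq: "norm_Rd d = normI {..<d}"
  by (simp add: norm_Rd_def normI_def inner_Rd_def fun_eq_iff)

lemma Rd_eq: "Rd d = space (leb {..<d})"
  by (simp add: Rd_def space_PiM)

lemma ball_Rd_eq: "ball_Rd d = {x \<in> space (leb {..<d}). normI {..<d} x \<le> 1}"
  by (simp add: ball_Rd_def norm_Rd_eq Rd_eq)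

lemma ball_Rd_sets[measurable]: "ball_Rd d \<in> sets (leb {..<d})"
  unfolding ball_Rd_eq by measurable

lemma sets_uniform_sphere[simp, measurable_cong]: "sets (uniform_sphere d) = sets (Pi\<^sub>M {..<d} (\<lambda>_. borel))"
  by (simp add: uniform_sphere_def borel_Rd_def)

lemma nn_integral_uniform_sphere:
  assumes [measurable]: "f \<in> borel_measurable (Pi\<^sub>M {..<d} (\<lambda>_. borel))"
  shows "(\<integral>\<^sup>+x. f x \<partial>uniform_sphere d) =
    (\<integral>\<^sup>+x. f (dirI {..<d} x) * indicator (ball_Rd d) x \<partial>leb {..<d}) / emeasure (leb {..<d}) (ball_Rd d)"
proof -
  have eq: "uniform_sphere d = distr (uniform_measure (leb {..<d}) (ball_Rd d)) (Pi\<^sub>M {..<d} (\<lambda>_. borel)) (dirI {..<d})"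
    unfolding uniform_sphere_def borel_Rd_def norm_Rd_eq dirI_def[abs_def] ..
  show ?thesis
    unfolding eq by (subst nn_integral_distr) (auto simp: nn_integral_uniform_measure)
qed

lemma swap_refl_measurable[measurable]: "swap_refl d u \<in> measurable (Pi\<^sub>M {..<d} (\<lambda>_. borel)) (Pi\<^sub>M {..<d} (\<lambda>_. borel))"
proof -
  have "swap_refl d u \<in> measurable (leb {..<d}) (leb {..<d})"
    using scales_volume_swap_refl[of d u] by (simp add: scales_volume_def)
  then show ?thesis
    by (simp add: measurable_cong_sets[OF sets_leb sets_leb])
qed

lemma normI_swap_refl: "normI {..<d} (swap_refl d u x) = normI {..<d} x"
  using inner_swap_refl[of d u x x] by (simp add: normI_def inner_Rd_def)

lemma inner_Rd_scale: "inner_Rd d v (\<lambda>i\<in>{..<d}. x i / c) = inner_Rd d v x / c"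
  unfolding inner_Rd_def sum_divide_distrib by (rule sum.cong) auto

lemma dirI_swap_refl: "dirI {..<d} (swap_refl d u x) = swap_refl d u (dirI {..<d} x)"
proof
  fix i
  show "dirI {..<d} (swap_refl d u x) i = swap_refl d u (dirI {..<d} x) i"
  proof (cases "i < d")
    case True
    define v where "v = (\<lambda>i. (if i = 0 then 1 else 0) - u i)"
    have alg: "(p - 2 * B / C * q) / N = p / N - 2 * (B / N) / C * q" for p B C q N :: real
      by (simp add: diff_divide_distrib)
    have D: "dirI {..<d} y i = y i / normI {..<d} y" for y using True by (simp add: dirI_def)
    have "inner_Rd d v (dirI {..<d} x) = inner_Rd d v x / normI {..<d} x"
      unfolding dirI_def by (rule inner_Rd_scale)
    then show ?thesis
      unfolding swap_refl_apply[OF True] D normI_swap_refl v_def[symmetric] by (simp only: alg)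
  next
    case False
    then show ?thesis by (simp add: dirI_def swap_refl_def Let_def)
  qed
qed

text \<open>The reflection preserves Lebesgue measure and the ball and commutes with the radial
  projection, so the cone measure is invariant. This holds for every \<open>u\<close>, since each
  \<open>swap_refl d u\<close> is a reflection or the identity.\<close>

lemma uniform_sphere_swap_refl:
  assumes f[measurable]: "f \<in> borel_measurable (Pi\<^sub>M {..<d} (\<lambda>_. borel))"
  shows "(\<integral>\<^sup>+x. f (swap_refl d u x) \<partial>uniform_sphere d) = (\<integral>\<^sup>+x. f x \<partial>uniform_sphere d)"
proof -
  have "ennreal 1 * (\<integral>\<^sup>+x. (\<lambda>y. f (dirI {..<d} y) * indicator (ball_Rd d) y) (swap_refl d u x) \<partial>leb {..<d}) =
    (\<integral>\<^sup>+y. f (dirI {..<d} y) * indicator (ball_Rd d) y \<partial>leb {..<d})"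
    by (rule scales_volumeD[OF scales_volume_swap_refl]) measurable
  moreover have "(\<integral>\<^sup>+x. (\<lambda>y. f (dirI {..<d} y) * indicator (ball_Rd d) y) (swap_refl d u x) \<partial>leb {..<d}) =
    (\<integral>\<^sup>+x. f (swap_refl d u (dirI {..<d} x)) * indicator (ball_Rd d) x \<partial>leb {..<d})"
  proof (rule nn_integral_cong)
    fix x assume "x \<in> space (leb {..<d})"
    moreover have "swap_refl d u x \<in> space (leb {..<d})"
      unfolding swap_refl_def Let_def space_PiM by (intro restrict_PiE_iff[THEN iffD2]) simp
    ultimately have "swap_refl d u x \<in> ball_Rd d \<longleftrightarrow> x \<in> ball_Rd d"
      by (simp add: ball_Rd_eq normI_swap_refl)
    then show "(\<lambda>y. f (dirI {..<d} y) * indicator (ball_Rd d) y) (swap_refl d u x) =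
      f (swap_refl d u (dirI {..<d} x)) * indicator (ball_Rd d) x"
      by (simp add: dirI_swap_refl indicator_def)
  qed
  ultimately show ?thesis by (simp add: nn_integral_uniform_sphere)
qed

text \<open>Radius of the slice of the unit sphere at height \<open>t\<close>. Cutting off at 0
  makes it vanish for |t| >= 1, so positive powers of it can be integrated over the whole
  line.\<close>

definition srad :: "real \<Rightarrow> real" where "srad t = sqrt (max 0 (1 - t\<^sup>2))"

definition sphere_pt :: "nat \<Rightarrow> real \<Rightarrow> (nat \<Rightarrow> real) \<Rightarrow> nat \<Rightarrow> real" where
  "sphere_pt d t z = (\<lambda>k\<in>{..<d}. if k = 0 then t else srad t * z k)"

lemma srad_nonneg: "0 \<le> srad t" by (simp add: srad_def)

lemma srad_le_1: "srad t \<le> 1" by (simp add: srad_def)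

lemma srad_measurable[measurable]: "srad \<in> borel_measurable borel"
  unfolding srad_def by measurable

lemma srad_zero: "\<bar>t\<bar> \<ge> 1 \<Longrightarrow> srad t = 0"
  using one_le_power[of "\<bar>t\<bar>" 2] by (simp add: srad_def)

lemma measurable_first_rest:
  fixes d :: nat
  assumes [measurable]: "f \<in> borel_measurable M" "g \<in> borel_measurable M"
    and h: "h \<in> measurable M (Pi\<^sub>M {1..<d} (\<lambda>_. borel))"
  shows "(\<lambda>p. \<lambda>k\<in>{..<d}. if k = 0 then f p else g p * h p k :: real) \<in> measurable M (Pi\<^sub>M {..<d} (\<lambda>_. borel))"
proof (rule measurable_restrict)
  fix k assume k: "k \<in> {..<d}"
  show "(\<lambda>p. if k = 0 then f p else g p * h p k) \<in> borel_measurable M"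
  proof (cases "k = 0")
    case False
    then have "1 \<le> k" by simp
    then have "(\<lambda>p. h p k) \<in> borel_measurable M"
      using k by (intro measurable_compose[OF h measurable_coordinate_borel]) auto
    then show ?thesis using False by simp
  qed simp
qed

lemma sphere_pt_measurable[measurable (raw)]:
  assumes "f \<in> borel_measurable M" "h \<in> measurable M (Pi\<^sub>M {1..<d} (\<lambda>_. borel))"
  shows "(\<lambda>p. sphere_pt d (f p) (h p)) \<in> measurable M (Pi\<^sub>M {..<d} (\<lambda>_. borel))"
  unfolding sphere_pt_def
  by (rule measurable_first_rest) (use assms in measurable)

text \<open>Fubini splits off coordinate 0 as y; polar coordinates on the rest have the squared
  radius v as radial variable (\<alpha> = 2). In terms of the total squared radius V = y^2 + v and
  of t = y / sqrt V, the direction depends on t and z alone and the V-integral factors out. The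
  bound d >= 4 makes \<open>d - 3\<close> positive, so that \<open>srad t ^ (d - 3)\<close> vanishes
  outside (-1, 1).\<close>

lemma nn_integral_slice:
  assumes d: "d \<ge> 4" and f[measurable]: "f \<in> borel_measurable (Pi\<^sub>M {..<d} (\<lambda>_. borel))"
  shows "(\<integral>\<^sup>+x. f (dirI {..<d} x) * indicator (ball_Rd d) x \<partial>leb {..<d}) =
    (\<integral>\<^sup>+V. ennreal (V powr ((real d - 2) / 2)) * indicator {0<..1} V \<partial>lborel) *
    (\<integral>\<^sup>+t. \<integral>\<^sup>+z. ennreal (srad t ^ (d - 3)) * f (sphere_pt d t z) \<partial>cone 2 {1..<d} \<partial>lborel)"
proof -
  let ?I = "{1..<d}"
  define \<gamma> where "\<gamma> = card ?I / 2 - 1"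
  have I: "finite ?I" "?I \<noteq> {}" using d by auto
  interpret N: finite_measure "cone 2 ?I" by (rule finite_measure_cone) (use I in auto)
  interpret P: pair_sigma_finite "cone 2 ?I" "lborel :: real measure" ..
  have ins: "{..<d} = insert 0 ?I" using d by auto
  \<comment> \<open>Direction of the point with first coordinate \<open>y\<close> whose remaining
    coordinates have squared length \<open>v\<close> and direction \<open>z\<close>.\<close>
  define G where "G y v z = (\<lambda>k\<in>{..<d}. if k = 0 then y / sqrt (y\<^sup>2 + v) else sqrt v / sqrt (y\<^sup>2 + v) * z k)"
    for y v :: real and z :: "nat \<Rightarrow> real"
  have G[measurable (raw)]: "(\<lambda>p. G (a p) (b p) (h p)) \<in> measurable M (Pi\<^sub>M {..<d} (\<lambda>_. borel))"
    if "a \<in> borel_measurable M" "b \<in> borel_measurable M" "h \<in> measurable M (Pi\<^sub>M {1..<d} (\<lambda>_. borel))"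
    for a b h and M :: "'c measure"
    unfolding G_def by (rule measurable_first_rest) (use that in measurable)
  have dirG: "dirI {..<d} (x(0 := y)) = G y (normI ?I x powr 2) (dirI ?I x)"
    and nG: "(normI {..<d} (x(0 := y)))\<^sup>2 = y\<^sup>2 + normI ?I x powr 2" for x y
  proof -
    have "(\<Sum>k<d. (x(0 := y)) k * (x(0 := y)) k) = y * y + (\<Sum>k\<in>?I. (x(0 := y)) k * (x(0 := y)) k)"
      using I unfolding ins by (subst sum.insert) auto
    also have "(\<Sum>k\<in>?I. (x(0 := y)) k * (x(0 := y)) k) = (\<Sum>k\<in>?I. x k * x k)"
      by (rule sum.cong) auto
    finally have s: "(\<Sum>k<d. (x(0 := y)) k * (x(0 := y)) k) = y\<^sup>2 + (normI ?I x)\<^sup>2"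
      by (simp add: normI_def power2_eq_square sum_nonneg)
    have p2: "normI ?I x powr 2 = (normI ?I x)\<^sup>2" using normI_nonneg[of ?I x] by simp
    show "(normI {..<d} (x(0 := y)))\<^sup>2 = y\<^sup>2 + normI ?I x powr 2"
      unfolding p2 s[symmetric] normI_def[of "{..<d}"] by (simp add: sum_nonneg del: fun_upd_apply)
    have n: "normI {..<d} (x(0 := y)) = sqrt (y\<^sup>2 + (normI ?I x)\<^sup>2)"
      unfolding normI_def[of "{..<d}"] s ..
    have z: "x k = 0" if "normI ?I x = 0" "k \<in> ?I" for k
    proof -
      have "(\<Sum>k\<in>?I. x k * x k) = 0" using that(1) by (simp add: normI_def)
      then have "x k * x k = 0" using that(2) by (subst (asm) sum_nonneg_eq_0_iff) auto
      then show ?thesis by simp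
    qed
    show "dirI {..<d} (x(0 := y)) = G y (normI ?I x powr 2) (dirI ?I x)"
    proof
      fix k
      show "dirI {..<d} (x(0 := y)) k = G y (normI ?I x powr 2) (dirI ?I x) k"
        unfolding dirI_def[of "{..<d}"] n p2 G_def
        using z[of k] normI_nonneg[of ?I x] by (auto simp: dirI_def)
    qed
  qed
  define H where "H y v z = f (G y v z) * indicator {..1} (y\<^sup>2 + v)" for y v z
  have H[measurable (raw)]: "(\<lambda>p. H (a p) (b p) (h p)) \<in> borel_measurable M"
    if [measurable]: "a \<in> borel_measurable M" "b \<in> borel_measurable M" "h \<in> measurable M (Pi\<^sub>M {1..<d} (\<lambda>_. borel))"
    for a b h and M :: "'c measure"
    unfolding H_def by measurable
  have "(\<integral>\<^sup>+x. f (dirI {..<d} x) * indicator (ball_Rd d) x \<partial>leb {..<d}) =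
      (\<integral>\<^sup>+y. \<integral>\<^sup>+x. f (dirI {..<d} (x(0 := y))) * indicator (ball_Rd d) (x(0 := y)) \<partial>leb ?I \<partial>lborel)"
    unfolding ins by (rule leb.product_nn_integral_insert_rev) (use I f in \<open>auto simp flip: ins\<close>)
  also have "\<dots> = (\<integral>\<^sup>+y. \<integral>\<^sup>+x. (\<lambda>(z, v). H y v z) (dirI ?I x, normI ?I x powr 2) \<partial>leb ?I \<partial>lborel)"
  proof (intro nn_integral_cong)
    fix y :: real and x assume x: "x \<in> space (leb ?I)"
    then have "x(0 := y) \<in> space (leb {..<d})" by (auto simp: space_PiM ins PiE_def extensional_def)
    then have "x(0 := y) \<in> ball_Rd d \<longleftrightarrow> (normI {..<d} (x(0 := y)))\<^sup>2 \<le> 1"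
      using normI_nonneg[of "{..<d}" "x(0 := y)"] by (simp add: ball_Rd_eq abs_square_le_1)
    then show "f (dirI {..<d} (x(0 := y))) * indicator (ball_Rd d) (x(0 := y)) =
        (\<lambda>(z, v). H y v z) (dirI ?I x, normI ?I x powr 2)"
      unfolding nG dirG by (simp add: H_def indicator_def)
  qed
  also have "\<dots> = (\<integral>\<^sup>+y. \<integral>\<^sup>+z. \<integral>\<^sup>+v. H y v z * ennreal (v powr \<gamma>) * indicator {0<..} v \<partial>lborel \<partial>cone 2 ?I \<partial>lborel)"
    by (rule nn_integral_cong, subst polar[OF I]) (auto simp: \<gamma>_def)
  also have "\<dots> = (\<integral>\<^sup>+y. \<integral>\<^sup>+z. \<integral>\<^sup>+V. H y (V - y\<^sup>2) z * ennreal ((V - y\<^sup>2) powr \<gamma>) * indicator {0<..} (V - y\<^sup>2) \<partial>lborel \<partial>cone 2 ?I \<partial>lborel)"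
  proof (rule nn_integral_cong, rule nn_integral_cong)
    fix y :: real and z assume z: "z \<in> space (cone 2 ?I)"
    then have z'[measurable]: "(\<lambda>v. z) \<in> measurable borel (Pi\<^sub>M {1..<d} (\<lambda>_. borel))" by simp
    have "(\<integral>\<^sup>+v. H y v z * ennreal (v powr \<gamma>) * indicator {0<..} v \<partial>lborel) =
      ennreal \<bar>1\<bar> * (\<integral>\<^sup>+V. H y (- y\<^sup>2 + 1 * V) z * ennreal ((- y\<^sup>2 + 1 * V) powr \<gamma>) * indicator {0<..} (- y\<^sup>2 + 1 * V) \<partial>lborel)"
      by (rule nn_integral_real_affine) auto
    then show "(\<integral>\<^sup>+v. H y v z * ennreal (v powr \<gamma>) * indicator {0<..} v \<partial>lborel) =
      (\<integral>\<^sup>+V. H y (V - y\<^sup>2) z * ennreal ((V - y\<^sup>2) powr \<gamma>) * indicator {0<..} (V - y\<^sup>2) \<partial>lborel)"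
      by simp
  qed
  also have "\<dots> = (\<integral>\<^sup>+z. \<integral>\<^sup>+y. \<integral>\<^sup>+V. H y (V - y\<^sup>2) z * ennreal ((V - y\<^sup>2) powr \<gamma>) * indicator {0<..} (V - y\<^sup>2) \<partial>lborel \<partial>lborel \<partial>cone 2 ?I)"
    by (rule P.Fubini') measurable
  also have "\<dots> = (\<integral>\<^sup>+z. \<integral>\<^sup>+V. \<integral>\<^sup>+y. H y (V - y\<^sup>2) z * ennreal ((V - y\<^sup>2) powr \<gamma>) * indicator {0<..} (V - y\<^sup>2) \<partial>lborel \<partial>lborel \<partial>cone 2 ?I)"
  proof (rule nn_integral_cong)
    fix z assume z: "z \<in> space (cone 2 ?I)"
    then have z'[measurable]: "(\<lambda>v. z) \<in> measurable M (Pi\<^sub>M {1..<d} (\<lambda>_. borel))" for M :: "(real \<times> real) measure"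
      by simp
    show "(\<integral>\<^sup>+y. \<integral>\<^sup>+V. H y (V - y\<^sup>2) z * ennreal ((V - y\<^sup>2) powr \<gamma>) * indicator {0<..} (V - y\<^sup>2) \<partial>lborel \<partial>lborel) =
      (\<integral>\<^sup>+V. \<integral>\<^sup>+y. H y (V - y\<^sup>2) z * ennreal ((V - y\<^sup>2) powr \<gamma>) * indicator {0<..} (V - y\<^sup>2) \<partial>lborel \<partial>lborel)"
      by (rule lborel_pair.Fubini') measurable
  qed
  also have "\<dots> = (\<integral>\<^sup>+z. \<integral>\<^sup>+V. (ennreal (V powr ((real d - 2) / 2)) * indicator {0<..1} V) *
      (\<integral>\<^sup>+t. ennreal (srad t ^ (d - 3)) * f (sphere_pt d t z) \<partial>lborel) \<partial>lborel \<partial>cone 2 ?I)"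
  proof (intro nn_integral_cong)
    fix V :: real and z assume z: "z \<in> space (cone 2 ?I)"
    then have z'[measurable]: "(\<lambda>v. z) \<in> measurable borel (Pi\<^sub>M {1..<d} (\<lambda>_. borel))" by simp
    let ?g = "\<lambda>y. H y (V - y\<^sup>2) z * ennreal ((V - y\<^sup>2) powr \<gamma>) * indicator {0<..} (V - y\<^sup>2)"
    have dg: "(real d - 2) / 2 = 1 / 2 + \<gamma>" "\<gamma> = real (d - 3) / 2"
      using d by (auto simp: \<gamma>_def field_simps)
    show "(\<integral>\<^sup>+y. ?g y \<partial>lborel) = (ennreal (V powr ((real d - 2) / 2)) * indicator {0<..1} V) *
      (\<integral>\<^sup>+t. ennreal (srad t ^ (d - 3)) * f (sphere_pt d t z) \<partial>lborel)"
    proof (cases "V > 0 \<and> V \<le> 1")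
      case False
      then have g0: "?g y = 0" for y
      proof (cases "V \<le> 0")
        case True
        then have "V - y\<^sup>2 \<le> 0" by (smt (verit) zero_le_power2)
        then show ?thesis by simp
      qed (simp add: H_def)
      have "V \<notin> {0<..1}" using False by auto
      then show ?thesis unfolding g0 by simp
    next
      case True
      then have V: "V > 0" "V \<le> 1" by auto
      \<comment> \<open>The substitution is y = sqrt V * t; its Jacobian sqrt V together with V powr
        \<gamma> gives the exponent (d - 2) / 2.\<close>
      have "(\<integral>\<^sup>+y. ?g y \<partial>lborel) = ennreal \<bar>sqrt V\<bar> * (\<integral>\<^sup>+t. ?g (0 + sqrt V * t) \<partial>lborel)"
        by (rule nn_integral_real_affine) (use V in auto)
      also have "(\<integral>\<^sup>+t. ?g (0 + sqrt V * t) \<partial>lborel) =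
        (\<integral>\<^sup>+t. ennreal (V powr \<gamma>) * (ennreal (srad t ^ (d - 3)) * f (sphere_pt d t z)) \<partial>lborel)"
      proof (rule nn_integral_cong)
        fix t :: real
        have a: "V - (0 + sqrt V * t)\<^sup>2 = V * (1 - t\<^sup>2)"
          using V by (simp add: power_mult_distrib algebra_simps)
        show "?g (0 + sqrt V * t) = ennreal (V powr \<gamma>) * (ennreal (srad t ^ (d - 3)) * f (sphere_pt d t z))"
        proof (cases "\<bar>t\<bar> < 1")
          case True
          then have t: "1 - t\<^sup>2 > 0" by (simp add: abs_square_less_1)
          have s: "srad t = sqrt (1 - t\<^sup>2)" using t by (simp add: srad_def)
          have "(1 - t\<^sup>2) powr \<gamma> = srad t ^ (d - 3)"
            unfolding s dg(2) using t by (simp add: powr_half_sqrt[symmetric] powr_realpow[symmetric] powr_powr)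
          then have c: "(V * (1 - t\<^sup>2)) powr \<gamma> = V powr \<gamma> * srad t ^ (d - 3)"
            using V t by (simp add: powr_mult)
          have b: "(0 + sqrt V * t)\<^sup>2 + V * (1 - t\<^sup>2) = V"
            using V by (simp add: power_mult_distrib algebra_simps)
          have g: "G (0 + sqrt V * t) (V * (1 - t\<^sup>2)) z = sphere_pt d t z"
            unfolding G_def sphere_pt_def b using V
            by (auto simp: real_sqrt_mult s fun_eq_iff)
          have pos: "V * (1 - t\<^sup>2) > 0" using V(1) t by (rule mult_pos_pos)
          show ?thesis
            unfolding a H_def b c g using V pos by (simp add: ennreal_mult srad_nonneg mult_ac)
        next
          case False
          then have "srad t = 0" by (intro srad_zero) simp
          moreover have "t\<^sup>2 \<ge> 1" using False one_le_power[of "\<bar>t\<bar>" 2] by simp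
          then have "V * (1 - t\<^sup>2) \<le> 0" using V by (simp add: mult_nonneg_nonpos)
          ultimately show ?thesis unfolding a using d by simp
        qed
      qed
      also have "\<dots> = ennreal (V powr \<gamma>) * (\<integral>\<^sup>+t. ennreal (srad t ^ (d - 3)) * f (sphere_pt d t z) \<partial>lborel)"
        by (rule nn_integral_cmult) measurable
      also have "ennreal \<bar>sqrt V\<bar> * \<dots> = ennreal (sqrt V * V powr \<gamma>) * (\<integral>\<^sup>+t. ennreal (srad t ^ (d - 3)) * f (sphere_pt d t z) \<partial>lborel)"
        using V by (simp add: ennreal_mult mult.assoc)
      also have "sqrt V * V powr \<gamma> = V powr ((real d - 2) / 2)"
        unfolding dg(1) powr_add using V by (simp add: powr_half_sqrt)
      finally show ?thesis using V by simp
    qed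
  qed
  also have "\<dots> = (\<integral>\<^sup>+z. (\<integral>\<^sup>+V. ennreal (V powr ((real d - 2) / 2)) * indicator {0<..1} V \<partial>lborel) *
      (\<integral>\<^sup>+t. ennreal (srad t ^ (d - 3)) * f (sphere_pt d t z) \<partial>lborel) \<partial>cone 2 ?I)"
    by (intro nn_integral_cong nn_integral_multc) measurable
  also have "\<dots> = (\<integral>\<^sup>+V. ennreal (V powr ((real d - 2) / 2)) * indicator {0<..1} V \<partial>lborel) *
      (\<integral>\<^sup>+z. \<integral>\<^sup>+t. ennreal (srad t ^ (d - 3)) * f (sphere_pt d t z) \<partial>lborel \<partial>cone 2 ?I)"
    by (rule nn_integral_cmult) measurable
  also have "(\<integral>\<^sup>+z. \<integral>\<^sup>+t. ennreal (srad t ^ (d - 3)) * f (sphere_pt d t z) \<partial>lborel \<partial>cone 2 ?I) =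
    (\<integral>\<^sup>+t. \<integral>\<^sup>+z. ennreal (srad t ^ (d - 3)) * f (sphere_pt d t z) \<partial>cone 2 ?I \<partial>lborel)"
    by (rule P.Fubini'[symmetric]) measurable
  finally show ?thesis .
qed

text \<open>Scaled so that no constant remains in the slice formula; \<open>nu d\<close> is not a probability measure.\<close>

definition nu :: "nat \<Rightarrow> (nat \<Rightarrow> real) measure" where
  "nu d = scale_measure ((\<integral>\<^sup>+V. ennreal (V powr ((real d - 2) / 2)) * indicator {0<..1} V \<partial>lborel) /
     emeasure (leb {..<d}) (ball_Rd d)) (cone 2 {1..<d})"

lemma sets_nu[simp, measurable_cong]: "sets (nu d) = sets (Pi\<^sub>M {1..<d} (\<lambda>_. borel))"
  by (simp add: nu_def)

text \<open>Inserting the reflection by invariance slices the sphere orthogonally to any unit vector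
  \<open>u\<close>; \<open>t\<close> is then the coordinate along \<open>u\<close>. The radial
  integral and the volume of the ball are absorbed in \<open>nu\<close>.\<close>

lemma uniform_sphere_slice:
  assumes d: "d \<ge> 4" and f[measurable]: "f \<in> borel_measurable (Pi\<^sub>M {..<d} (\<lambda>_. borel))"
  shows "(\<integral>\<^sup>+x. f x \<partial>uniform_sphere d) =
    (\<integral>\<^sup>+t. ennreal (srad t ^ (d - 3)) * (\<integral>\<^sup>+z. f (swap_refl d u (sphere_pt d t z)) \<partial>nu d) \<partial>lborel)"
proof -
  let ?C = "\<integral>\<^sup>+V. ennreal (V powr ((real d - 2) / 2)) * indicator {0<..1} V \<partial>lborel"
  let ?V = "emeasure (leb {..<d}) (ball_Rd d)"
  have m: "(\<lambda>z. f (swap_refl d u (sphere_pt d t z))) \<in> borel_measurable (Pi\<^sub>M {1..<d} (\<lambda>_. borel))" for t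
    by measurable
  have I: "finite {1..<d}" "{1..<d} \<noteq> {}" using d by auto
  interpret N: finite_measure "cone 2 {1..<d}" by (rule finite_measure_cone) (use I in auto)
  have "(\<integral>\<^sup>+x. f x \<partial>uniform_sphere d) = (\<integral>\<^sup>+x. f (swap_refl d u x) \<partial>uniform_sphere d)"
    by (rule uniform_sphere_swap_refl[symmetric]) measurable
  also have "\<dots> = ?C * (\<integral>\<^sup>+t. \<integral>\<^sup>+z. ennreal (srad t ^ (d - 3)) * f (swap_refl d u (sphere_pt d t z)) \<partial>cone 2 {1..<d} \<partial>lborel) / ?V"
    by (subst nn_integral_uniform_sphere, measurable, subst nn_integral_slice[OF d]) measurable
  also have "\<dots> = ?C / ?V * (\<integral>\<^sup>+t. ennreal (srad t ^ (d - 3)) * (\<integral>\<^sup>+z. f (swap_refl d u (sphere_pt d t z)) \<partial>cone 2 {1..<d}) \<partial>lborel)"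
    by (subst nn_integral_cmult) (auto simp: ennreal_times_divide ennreal_divide_times mult_ac)
  also have "\<dots> = (\<integral>\<^sup>+t. ?C / ?V * (ennreal (srad t ^ (d - 3)) * (\<integral>\<^sup>+z. f (swap_refl d u (sphere_pt d t z)) \<partial>cone 2 {1..<d})) \<partial>lborel)"
    by (rule nn_integral_cmult[symmetric]) measurable
  also have "\<dots> = (\<integral>\<^sup>+t. ennreal (srad t ^ (d - 3)) * (\<integral>\<^sup>+z. f (swap_refl d u (sphere_pt d t z)) \<partial>nu d) \<partial>lborel)"
    unfolding nu_def by (rule nn_integral_cong, subst nn_integral_scale_measure) (auto simp: mult_ac)
  finally show ?thesis .
qed

lemma AE_nu: assumes "d \<ge> 4" shows "AE z in nu d. normI {1..<d} z = 1"
proof -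
  have "AE z in cone 2 {1..<d}. normI {1..<d} z = 1" by (rule AE_cone) (use assms in auto)
  then obtain N where N: "{z \<in> space (cone 2 {1..<d}). normI {1..<d} z \<noteq> 1} \<subseteq> N" "N \<in> null_sets (cone 2 {1..<d})"
    by (auto simp: eventually_ae_filter)
  then have "N \<in> null_sets (nu d)" by (auto simp: nu_def null_sets_def)
  then show ?thesis by (rule AE_I') (use N in \<open>auto simp: nu_def space_scale_measure\<close>)
qed

text \<open>The slice formula for the constant 1 says that the mass times an integral over
  \<open>t\<close> equals 1, so the mass cannot be infinite. That \<open>uniform_sphere d\<close> is
  a probability measure is carried as an assumption; it is supplied by \<open>iid_joint_law\<close>,
  where the sphere measure is the law of a random vector.\<close>

lemma finite_measure_nu:
  assumes d: "d \<ge> 4" and P: "prob_space (uniform_sphere d)"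
  shows "finite_measure (nu d)"
proof
  interpret prob_space "uniform_sphere d" by fact
  have "1 = (\<integral>\<^sup>+x. 1 \<partial>uniform_sphere d)" by (simp add: emeasure_space_1)
  also have "\<dots> = (\<integral>\<^sup>+t. ennreal (srad t ^ (d - 3)) * emeasure (nu d) (space (nu d)) \<partial>lborel)"
    by (subst uniform_sphere_slice[OF d, where u = undefined]) auto
  also have "\<dots> = (\<integral>\<^sup>+t. ennreal (srad t ^ (d - 3)) \<partial>lborel) * emeasure (nu d) (space (nu d))"
    by (rule nn_integral_multc) measurable
  finally have 1: "(\<integral>\<^sup>+t. ennreal (srad t ^ (d - 3)) \<partial>lborel) * emeasure (nu d) (space (nu d)) = 1" by simp
  show "emeasure (nu d) (space (nu d)) \<noteq> \<infinity>"
  proof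
    assume "emeasure (nu d) (space (nu d)) = \<infinity>"
    then show False using 1 by (cases "(\<integral>\<^sup>+t. ennreal (srad t ^ (d - 3)) \<partial>lborel) = 0") (auto simp: ennreal_mult_top)
  qed
qed

text \<open>If a measure disintegrates along a map \<open>R\<close> with weight \<open>w\<close>, so
  does its power: the image of the weighted product measure agrees with the product measure on
  boxes, where everything factorises.\<close>

lemma PiM_fibred:
  fixes \<mu>1 :: "'a measure" and \<mu>2 :: "'b measure" and \<sigma> :: "'c measure" and I :: "'i set"
  assumes I: "finite I" and s1: "sigma_finite_measure \<mu>1" and s2: "sigma_finite_measure \<mu>2"
    and s: "sigma_finite_measure \<sigma>"
    and w[measurable]: "w \<in> borel_measurable \<mu>1"
    and R[measurable]: "(\<lambda>(t, z). R t z) \<in> measurable (\<mu>1 \<Otimes>\<^sub>M \<mu>2) \<sigma>"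
    and eq: "\<And>A. A \<in> sets \<sigma> \<Longrightarrow> emeasure \<sigma> A = (\<integral>\<^sup>+t. w t * (\<integral>\<^sup>+z. indicator A (R t z) \<partial>\<mu>2) \<partial>\<mu>1)"
    and f[measurable]: "f \<in> borel_measurable (Pi\<^sub>M I (\<lambda>_. \<sigma>))"
  shows "(\<integral>\<^sup>+x. f x \<partial>Pi\<^sub>M I (\<lambda>_. \<sigma>)) =
    (\<integral>\<^sup>+t. (\<Prod>i\<in>I. w (t i)) * (\<integral>\<^sup>+z. f (\<lambda>i\<in>I. R (t i) (z i)) \<partial>Pi\<^sub>M I (\<lambda>_. \<mu>2)) \<partial>Pi\<^sub>M I (\<lambda>_. \<mu>1))"
proof -
  interpret S1: product_sigma_finite "\<lambda>_::'i. \<mu>1" using s1 by (simp add: product_sigma_finite_def)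
  interpret S2: product_sigma_finite "\<lambda>_::'i. \<mu>2" using s2 by (simp add: product_sigma_finite_def)
  interpret S: product_sigma_finite "\<lambda>_::'i. \<sigma>" using s by (simp add: product_sigma_finite_def)
  interpret \<mu>2: sigma_finite_measure \<mu>2 by fact
  let ?P1 = "Pi\<^sub>M I (\<lambda>_. \<mu>1)" and ?P2 = "Pi\<^sub>M I (\<lambda>_. \<mu>2)" and ?P = "Pi\<^sub>M I (\<lambda>_. \<sigma>)"
  interpret P2: sigma_finite_measure ?P2 by (rule S2.sigma_finite[OF I])
  let ?w = "\<lambda>t. \<Prod>i\<in>I. w (t i)"
  let ?R = "\<lambda>(t, z). \<lambda>i\<in>I. R (t i) (z i)"
  have w'[measurable]: "?w \<in> borel_measurable ?P1"
  proof (rule borel_measurable_prod_ennreal)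
    fix i assume i: "i \<in> I"
    show "(\<lambda>t. w (t i)) \<in> borel_measurable ?P1"
      by (rule measurable_compose[OF measurable_component_singleton[OF i, of "\<lambda>_. \<mu>1"] w])
  qed
  have Ri: "(\<lambda>p. R (fst p i) (snd p i)) \<in> measurable (?P1 \<Otimes>\<^sub>M ?P2) \<sigma>" if i: "i \<in> I" for i
  proof -
    have "(\<lambda>p. (fst p i, snd p i)) \<in> measurable (?P1 \<Otimes>\<^sub>M ?P2) (\<mu>1 \<Otimes>\<^sub>M \<mu>2)"
      using i by measurable
    from measurable_compose[OF this R] show ?thesis by simp
  qed
  have R'[measurable]: "?R \<in> measurable (?P1 \<Otimes>\<^sub>M ?P2) ?P"
    unfolding case_prod_beta' by (intro measurable_restrict Ri)
  let ?D = "distr (density (?P1 \<Otimes>\<^sub>M ?P2) (\<lambda>p. ?w (fst p))) ?P ?R"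
  have int: "(\<integral>\<^sup>+x. g x \<partial>?D) = (\<integral>\<^sup>+t. ?w t * (\<integral>\<^sup>+z. g (\<lambda>i\<in>I. R (t i) (z i)) \<partial>?P2) \<partial>?P1)"
    if g[measurable]: "g \<in> borel_measurable ?P" for g
  proof -
    have "(\<integral>\<^sup>+x. g x \<partial>?D) = (\<integral>\<^sup>+p. ?w (fst p) * g (?R p) \<partial>(?P1 \<Otimes>\<^sub>M ?P2))"
      by (simp add: nn_integral_distr nn_integral_density)
    also have "\<dots> = (\<integral>\<^sup>+t. \<integral>\<^sup>+z. ?w (fst (t, z)) * g (?R (t, z)) \<partial>?P2 \<partial>?P1)"
      by (rule P2.nn_integral_fst[symmetric]) measurable
    also have "\<dots> = (\<integral>\<^sup>+t. ?w t * (\<integral>\<^sup>+z. g (\<lambda>i\<in>I. R (t i) (z i)) \<partial>?P2) \<partial>?P1)"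
    proof (rule nn_integral_cong)
      fix t assume t: "t \<in> space ?P1"
      have "(\<lambda>z. g (?R (t, z))) \<in> borel_measurable ?P2"
        by (rule measurable_compose[OF measurable_compose[OF measurable_Pair1'[OF t] R'] g])
      then show "(\<integral>\<^sup>+z. ?w (fst (t, z)) * g (?R (t, z)) \<partial>?P2) = ?w t * (\<integral>\<^sup>+z. g (\<lambda>i\<in>I. R (t i) (z i)) \<partial>?P2)"
        by (simp add: nn_integral_cmult)
    qed
    finally show ?thesis .
  qed
  have "?D = ?P"
  proof (rule S.PiM_eqI[OF I])
    fix A assume A: "\<And>i. i \<in> I \<Longrightarrow> A i \<in> sets \<sigma>"
    have [measurable]: "Pi\<^sub>E I A \<in> sets ?P" using A I by (intro sets_PiM_I_finite) auto
    have "emeasure ?D (Pi\<^sub>E I A) = (\<integral>\<^sup>+x. indicator (Pi\<^sub>E I A) x \<partial>?D)" by simp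
    also have "\<dots> = (\<integral>\<^sup>+t. ?w t * (\<integral>\<^sup>+z. indicator (Pi\<^sub>E I A) (\<lambda>i\<in>I. R (t i) (z i)) \<partial>?P2) \<partial>?P1)"
      by (rule int) measurable
    also have "\<dots> = (\<integral>\<^sup>+t. (\<Prod>i\<in>I. w (t i) * (\<integral>\<^sup>+z. indicator (A i) (R (t i) z) \<partial>\<mu>2)) \<partial>?P1)"
    proof (rule nn_integral_cong)
      fix t assume t: "t \<in> space ?P1"
      have ind: "indicator (Pi\<^sub>E I A) (\<lambda>i\<in>I. R (t i) (z i)) = (\<Prod>i\<in>I. indicator (A i) (R (t i) (z i)) :: ennreal)" for z
      proof (cases "\<forall>i\<in>I. R (t i) (z i) \<in> A i")
        case False
        then obtain i where i: "i \<in> I" "R (t i) (z i) \<notin> A i" by auto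
        then have "(\<Prod>i\<in>I. indicator (A i) (R (t i) (z i)) :: ennreal) = 0"
          using I by (intro prod_zero bexI[of _ i]) auto
        moreover have "(\<lambda>i\<in>I. R (t i) (z i)) \<notin> Pi\<^sub>E I A"
        proof
          assume "(\<lambda>i\<in>I. R (t i) (z i)) \<in> Pi\<^sub>E I A"
          from PiE_mem[OF this i(1)] show False using i by simp
        qed
        ultimately show ?thesis by simp
      qed auto
      have m: "(\<lambda>z. indicator (A i) (R (t i) z) :: ennreal) \<in> borel_measurable \<mu>2" if i: "i \<in> I" for i
      proof -
        have "t i \<in> space \<mu>1" using t i by (auto simp: space_PiM)
        from measurable_compose[OF measurable_Pair1'[OF this] R]
        have "(\<lambda>z. R (t i) z) \<in> measurable \<mu>2 \<sigma>" by simp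
        then show ?thesis using A[OF i] by measurable
      qed
      have "(\<integral>\<^sup>+z. (\<Prod>i\<in>I. indicator (A i) (R (t i) (z i))) \<partial>?P2) =
          (\<Prod>i\<in>I. \<integral>\<^sup>+z. indicator (A i) (R (t i) z) \<partial>\<mu>2)"
        by (rule S2.product_nn_integral_prod[OF I m])
      then show "?w t * (\<integral>\<^sup>+z. indicator (Pi\<^sub>E I A) (\<lambda>i\<in>I. R (t i) (z i)) \<partial>?P2) =
        (\<Prod>i\<in>I. w (t i) * (\<integral>\<^sup>+z. indicator (A i) (R (t i) z) \<partial>\<mu>2))"
        by (simp add: ind prod.distrib)
    qed
    also have "\<dots> = (\<Prod>i\<in>I. \<integral>\<^sup>+t. w t * (\<integral>\<^sup>+z. indicator (A i) (R t z) \<partial>\<mu>2) \<partial>\<mu>1)"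
    proof (intro S1.product_nn_integral_prod I)
      fix i assume i: "i \<in> I"
      have "(\<lambda>p. indicator (A i) (case p of (t, z) \<Rightarrow> R t z) :: ennreal) \<in> borel_measurable (\<mu>1 \<Otimes>\<^sub>M \<mu>2)"
        using A[OF i] by measurable
      then have "(\<lambda>(t, z). indicator (A i) (R t z) :: ennreal) \<in> borel_measurable (\<mu>1 \<Otimes>\<^sub>M \<mu>2)"
        by (simp add: case_prod_beta')
      from sigma_finite_measure.borel_measurable_nn_integral[OF s2 this]
      show "(\<lambda>t. w t * (\<integral>\<^sup>+z. indicator (A i) (R t z) \<partial>\<mu>2)) \<in> borel_measurable \<mu>1"
        by measurable
    qed
    also have "\<dots> = (\<Prod>i\<in>I. emeasure \<sigma> (A i))"
      by (rule prod.cong) (use A eq in auto)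
    finally show "emeasure ?D (Pi\<^sub>E I A) = (\<Prod>i\<in>I. emeasure \<sigma> (A i))" .
  qed simp
  then show ?thesis using int[OF f] by simp
qed

lemma PiM_uniform_sphere_slice:
  fixes I :: "nat set"
  assumes d: "d \<ge> 4" and P: "prob_space (uniform_sphere d)" and I: "finite I"
    and f: "f \<in> borel_measurable (Pi\<^sub>M I (\<lambda>_. uniform_sphere d))"
  shows "(\<integral>\<^sup>+x. f x \<partial>Pi\<^sub>M I (\<lambda>_. uniform_sphere d)) =
    (\<integral>\<^sup>+t. (\<Prod>i\<in>I. ennreal (srad (t i) ^ (d - 3))) *
       (\<integral>\<^sup>+z. f (\<lambda>i\<in>I. swap_refl d u (sphere_pt d (t i) (z i))) \<partial>Pi\<^sub>M I (\<lambda>_. nu d)) \<partial>leb I)"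
proof (rule PiM_fibred[OF I _ _ _ _ _ _ f])
  show "sigma_finite_measure (lborel :: real measure)" by standard
  show "sigma_finite_measure (nu d)"
    using finite_measure_nu[OF d P] by (rule finite_measure.axioms(1))
  show "sigma_finite_measure (uniform_sphere d)"
    using P by (intro finite_measure.axioms(1) prob_space.finite_measure)
  show "(\<lambda>(t, z). swap_refl d u (sphere_pt d t z)) \<in> measurable (lborel \<Otimes>\<^sub>M nu d) (uniform_sphere d)"
    by measurable
  fix A assume "A \<in> sets (uniform_sphere d)"
  then show "emeasure (uniform_sphere d) A =
      (\<integral>\<^sup>+t. ennreal (srad t ^ (d - 3)) * (\<integral>\<^sup>+z. indicator A (swap_refl d u (sphere_pt d t z)) \<partial>nu d) \<partial>lborel)"
    by (subst nn_integral_indicator[symmetric], simp, subst uniform_sphere_slice[OF d, where u = u]) auto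
qed measurable

subsection \<open>The Blaschke-Petkantschin formula\<close>

lemma det_fun_measurable:
  assumes "\<And>i j. i < d \<Longrightarrow> j < d \<Longrightarrow> (\<lambda>p. A p i j) \<in> borel_measurable M"
  shows "(\<lambda>p. det_fun d (A p)) \<in> borel_measurable M"
  unfolding det_fun_leibniz
proof (intro borel_measurable_sum borel_measurable_times borel_measurable_prod)
  fix p i assume p: "p \<in> {p. p permutes {0..<d}}" and i: "i \<in> {0..<d}"
  then have "p i < d" using permutes_in_image[of p "{0..<d}" i] by simp
  then show "(\<lambda>x. A x i (p i)) \<in> borel_measurable M" using assms i by simp
qed simp

lemma det_fun_tendsto:
  assumes "\<And>i j. i < d \<Longrightarrow> j < d \<Longrightarrow> ((\<lambda>n. A n i j) \<longlongrightarrow> B i j) F"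
  shows "((\<lambda>n. det_fun d (A n)) \<longlongrightarrow> det_fun d B) F"
  unfolding det_fun_leibniz
proof (intro tendsto_sum tendsto_mult tendsto_prod tendsto_const)
  fix p i assume p: "p \<in> {p. p permutes {0..<d}}" and i: "i \<in> {0..<d}"
  then have "p i < d" using permutes_in_image[of p "{0..<d}" i] by simp
  then show "((\<lambda>n. A n i (p i)) \<longlongrightarrow> B i (p i)) F" using assms i by simp
qed

text \<open>A crude bound from the Leibniz expansion; it serves only to dominate in limits.\<close>

lemma det_fun_bound:
  assumes "\<And>i j. i < d \<Longrightarrow> j < d \<Longrightarrow> \<bar>a i j\<bar> \<le> c" and "0 \<le> c"
  shows "\<bar>det_fun d a\<bar> \<le> fact d * c ^ d"
proof -
  have "\<bar>det_fun d a\<bar> \<le> (\<Sum>p | p permutes {0..<d}. \<bar>signof p * (\<Prod>i = 0..<d. a i (p i))\<bar>)"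
    unfolding det_fun_leibniz by (rule sum_abs)
  also have "\<dots> \<le> (\<Sum>p | p permutes {0..<d}. c ^ d)"
  proof (rule sum_mono)
    fix p assume p: "p \<in> {p. p permutes {0..<d}}"
    have "\<bar>signof p * (\<Prod>i = 0..<d. a i (p i))\<bar> = (\<Prod>i = 0..<d. \<bar>a i (p i)\<bar>)"
      by (simp add: abs_mult abs_prod sign_def)
    also have "\<dots> \<le> (\<Prod>i = 0..<d. c)"
    proof (rule prod_mono)
      fix i assume i: "i \<in> {0..<d}"
      then have "p i < d" using p permutes_in_image[of p "{0..<d}" i] by simp
      then show "0 \<le> \<bar>a i (p i)\<bar> \<and> \<bar>a i (p i)\<bar> \<le> c" using assms i by simp
    qed
    finally show "\<bar>signof p * (\<Prod>i = 0..<d. a i (p i))\<bar> \<le> c ^ d" by simp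
  qed
  also have "\<dots> = fact d * c ^ d"
    by (simp add: card_permutations[OF refl])
  finally show ?thesis .
qed

lemma det_fun_scale_columns: "det_fun d (\<lambda>i j. c j * a i j) = (\<Prod>j<d. c j) * det_fun d a"
proof -
  have "(\<Prod>i = 0..<d. c (p i) * a i (p i)) = (\<Prod>j<d. c j) * (\<Prod>i = 0..<d. a i (p i))"
    if "p permutes {0..<d}" for p
    using prod.permute[OF that, of c] by (simp add: prod.distrib lessThan_atLeast0 comp_def)
  then show ?thesis
    unfolding det_fun_leibniz sum_distrib_left by (intro sum.cong) (auto simp: mult_ac)
qed

section \<open>Null hyperplanes and almost surely nonzero leading minors\<close>

abbreviation sphere_prod :: "nat \<Rightarrow> nat set \<Rightarrow> (nat \<Rightarrow> nat \<Rightarrow> real) measure" where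
  "sphere_prod d I \<equiv> Pi\<^sub>M I (\<lambda>_. uniform_sphere d)"

lemma entry_measurable:
  assumes "i \<in> I" "j < d"
  shows "(\<lambda>a. a i j) \<in> borel_measurable (sphere_prod d I)"
proof -
  have 1: "(\<lambda>a. a i) \<in> measurable (sphere_prod d I) (uniform_sphere d)"
    using measurable_component_singleton[OF assms(1), of "\<lambda>_. uniform_sphere d"] by simp
  have "(\<lambda>x. x j) \<in> borel_measurable (uniform_sphere d)"
    using measurable_coordinate_borel[of j "{..<d}"] assms(2) by simp
  from measurable_compose[OF 1 this] show ?thesis .
qed

text \<open>Replacing coordinate \<open>k\<close> by the linear form carries the hyperplane to {x k
  = 0} and scales volume by |c k|, which is nonzero.\<close>

lemma AE_leb_hyperplane:
  assumes k: "k < d" and c: "c k \<noteq> 0"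
  shows "AE x in leb {..<d}. (\<Sum>j<d. x j * c j) \<noteq> 0"
proof -
  note [measurable] = measurable_coordinate_leb
  have T: "scales_volume {..<d} (\<lambda>x. x(k := (\<Sum>j<d. c j * x j))) \<bar>c k\<bar>"
    by (rule scales_volume_coordinate) (use k c in auto)
  have kk: "k \<in> {..<d}" using k by simp
  define f :: "(nat \<Rightarrow> real) \<Rightarrow> ennreal" where "f x = indicator {0} (x k)" for x
  have [measurable]: "f \<in> borel_measurable (leb {..<d})"
    unfolding f_def using kk by measurable
  have "ennreal \<bar>c k\<bar> * (\<integral>\<^sup>+x. f (x(k := (\<Sum>j<d. c j * x j))) \<partial>leb {..<d}) = (\<integral>\<^sup>+x. f x \<partial>leb {..<d})"
    by (rule scales_volumeD[OF T]) simp
  also have "\<dots> = 0"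
  proof (subst nn_integral_0_iff_AE)
    show "AE x in leb {..<d}. f x = 0"
      using AE_leb_coordinate_nonzero[of "{..<d}" k] k by (auto simp: f_def elim!: eventually_mono)
  qed simp
  finally have "(\<integral>\<^sup>+x. indicator {0} (\<Sum>j<d. c j * x j) \<partial>leb {..<d}) = 0"
    using c by (simp add: f_def)
  then have "AE x in leb {..<d}. indicator {0} (\<Sum>j<d. c j * x j) = (0::ennreal)"
    by (subst (asm) nn_integral_0_iff_AE) auto
  then show ?thesis by eventually_elim (auto simp: mult.commute split: split_indicator_asm)
qed

text \<open>Since the hyperplane passes through the origin, a nonzero point lies on it iff its
  direction does; the Lebesgue null set thus passes to the cone measure.\<close>

lemma AE_uniform_sphere_hyperplane:
  assumes k: "k < d" and c: "c k \<noteq> 0"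
  shows "AE x in uniform_sphere d. (\<Sum>j<d. x j * c j) \<noteq> 0"
proof -
  define f :: "(nat \<Rightarrow> real) \<Rightarrow> ennreal" where "f x = indicator {0} (\<Sum>j<d. x j * c j)" for x
  have "(\<lambda>x. \<Sum>j<d. x j * c j) \<in> borel_measurable (Pi\<^sub>M {..<d} (\<lambda>_. borel))"
    by (intro borel_measurable_sum borel_measurable_times borel_measurable_const measurable_coordinate_borel)
  then have fm: "f \<in> borel_measurable (Pi\<^sub>M {..<d} (\<lambda>_. borel))"
    unfolding f_def by (rule measurable_compose) simp
  have "(\<integral>\<^sup>+x. f x \<partial>uniform_sphere d) =
    (\<integral>\<^sup>+x. f (dirI {..<d} x) * indicator (ball_Rd d) x \<partial>leb {..<d}) / emeasure (leb {..<d}) (ball_Rd d)"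
    by (rule nn_integral_uniform_sphere[OF fm])
  also have "(\<integral>\<^sup>+x. f (dirI {..<d} x) * indicator (ball_Rd d) x \<partial>leb {..<d}) = (\<integral>\<^sup>+x. 0 \<partial>leb {..<d})"
  proof (rule nn_integral_cong_AE)
    have fin: "finite {..<d}" "{..<d} \<noteq> {}" using k by auto
    show "AE x in leb {..<d}. f (dirI {..<d} x) * indicator (ball_Rd d) x = 0"
      using AE_leb_normI_pos[OF fin] AE_leb_hyperplane[OF k, of c, OF c]
    proof eventually_elim
      case (elim x)
      have "(\<Sum>j<d. dirI {..<d} x j * c j) = (\<Sum>j<d. x j * c j) / normI {..<d} x"
        unfolding sum_divide_distrib by (rule sum.cong) (auto simp: dirI_def)
      then show ?case using elim by (simp add: f_def)
    qed
  qed
  finally have "(\<integral>\<^sup>+x. f x \<partial>uniform_sphere d) = 0" by simp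
  moreover have "f \<in> borel_measurable (uniform_sphere d)"
    using fm by (simp add: measurable_cong_sets[OF sets_uniform_sphere refl])
  ultimately have "AE x in uniform_sphere d. f x = 0"
    by (simp add: nn_integral_0_iff_AE)
  then show ?thesis by eventually_elim (auto simp: f_def split: split_indicator_asm)
qed

lemma lead_measurable:
  assumes "k \<le> d" shows "(\<lambda>a. det_fun d (lead k a)) \<in> borel_measurable (sphere_prod d {..<d})"
proof (rule det_fun_measurable)
  fix i j assume ij: "i < d" "j < d"
  show "(\<lambda>a. lead k a i j) \<in> borel_measurable (sphere_prod d {..<d})"
    using entry_measurable[of i "{..<d}" j d] ij by (auto simp: lead_def)
qed

text \<open>Induction on \<open>k\<close>, with all rows but row \<open>k\<close> fixed. The minor
  of order \<open>k + 1\<close> is a linear form in row \<open>k\<close> whose coefficient at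
  position \<open>k\<close> is the minor of order \<open>k\<close>; if the latter is nonzero, the
  former vanishes only on a null hyperplane.\<close>

lemma AE_leading_minors:
  assumes P: "prob_space (uniform_sphere d)"
  shows "AE a in sphere_prod d {..<d}. \<forall>k\<le>d. det_fun d (lead k a) \<noteq> 0"
proof -
  interpret sg: product_sigma_finite "\<lambda>_::nat. uniform_sphere d"
    unfolding product_sigma_finite_def using P by (auto intro: finite_measure.axioms(1) prob_space.finite_measure)
  have "AE a in sphere_prod d {..<d}. det_fun d (lead k a) \<noteq> 0" if "k \<le> d" for k
    using that
  proof (induction k)
    case 0
    have "det_fun d (lead 0 a) = 1" for a
      using det_fun_one[of d] by (simp add: lead_def)
    then show ?case by simp
  next
    case (Suc k)
    then have k: "k < d" "k \<le> d" by auto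
    let ?J = "{..<d} - {k}"
    have ins: "insert k ?J = {..<d}" using k by auto
    define f :: "(nat \<Rightarrow> nat \<Rightarrow> real) \<Rightarrow> ennreal" where
      "f a = (if det_fun d (lead k a) \<noteq> 0 \<and> det_fun d (lead (Suc k) a) = 0 then 1 else 0)" for a
    note [measurable] = lead_measurable[OF k(2)] lead_measurable[OF Suc.prems]
    have fm: "f \<in> borel_measurable (sphere_prod d {..<d})"
      unfolding f_def by measurable
    have "(\<integral>\<^sup>+a. f a \<partial>sphere_prod d {..<d}) = (\<integral>\<^sup>+a. f a \<partial>sphere_prod d (insert k ?J))" by (simp only: ins)
    also have "\<dots> = (\<integral>\<^sup>+x. \<integral>\<^sup>+y. f (x(k := y)) \<partial>uniform_sphere d \<partial>sphere_prod d ?J)"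
      by (rule sg.product_nn_integral_insert) (use fm in \<open>simp_all add: ins del: insert_Diff_single\<close>)
    also have "\<dots> = (\<integral>\<^sup>+x. 0 \<partial>sphere_prod d ?J)"
    proof (rule nn_integral_cong)
      fix x :: "nat \<Rightarrow> nat \<Rightarrow> real"
      define b where "b = lead k x"
      obtain c where c: "\<And>v. det_fun d (b(k := v)) = (\<Sum>j<d. v j * c j)"
        using det_fun_laplace_row[OF k(1), of b] by metis
      have 1: "det_fun d (lead k (x(k := y))) = det_fun d b" for y
        by (rule det_fun_cong) (auto simp: lead_def b_def)
      have 2: "det_fun d (lead (Suc k) (x(k := y))) = (\<Sum>j<d. y j * c j)" for y
        unfolding c[symmetric] by (rule det_fun_cong) (auto simp: lead_def b_def)
      \<comment> \<open>Row \<open>k\<close> of \<open>lead k x\<close> is a unit vector, so the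
        linear form evaluated there is both \<open>c k\<close> and the determinant.\<close>
      have "b(k := (\<lambda>j. if k = j then 1 else 0)) = b" by (auto simp: b_def lead_def fun_eq_iff)
      then have "det_fun d b = (\<Sum>j<d. (if k = j then 1 else 0) * c j)" using c by metis
      then have 3: "det_fun d b = c k" using k by (simp add: if_distrib[of "\<lambda>t. t * _"] cong: if_cong)
      show "(\<integral>\<^sup>+y. f (x(k := y)) \<partial>uniform_sphere d) = 0"
      proof (cases "c k = 0")
        case True
        then show ?thesis by (simp add: f_def 1 3)
      next
        case False
        have "AE y in uniform_sphere d. (\<Sum>j<d. y j * c j) \<noteq> 0"
          by (rule AE_uniform_sphere_hyperplane[OF k(1)]) (rule False)
        then have "AE y in uniform_sphere d. f (x(k := y)) = 0"
          by eventually_elim (simp add: f_def 2)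
        then have "(\<integral>\<^sup>+y. f (x(k := y)) \<partial>uniform_sphere d) = (\<integral>\<^sup>+y. 0 \<partial>uniform_sphere d)"
          by (rule nn_integral_cong_AE)
        then show ?thesis by simp
      qed
    qed
    finally have "AE a in sphere_prod d {..<d}. f a = 0"
      using fm by (subst nn_integral_0_iff_AE[symmetric]) auto
    with Suc.IH[OF k(2)] show ?case
      by eventually_elim (auto simp: f_def split: if_splits)
  qed
  then have "AE a in sphere_prod d {..<d}. \<forall>k\<in>{..d}. det_fun d (lead k a) \<noteq> 0"
    by (intro AE_finite_allI) auto
  then show ?thesis by (auto elim!: eventually_mono)
qed

lemma lead_full: "det_fun d (lead d a) = det_fun d a"
  by (rule det_fun_cong) (simp add: lead_def)

section \<open>The substitution y = A w\<close>

lemma cramer_sol_measurable_y: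
  "(\<lambda>y. cramer_sol d a y) \<in> measurable (leb {..<d}) (leb {..<d})"
  unfolding cramer_sol_def
proof (rule measurable_restrict)
  fix j assume j: "j \<in> {..<d}"
  have "(\<lambda>y. det_fun d (\<lambda>i k. if k = j then y i else a i k)) \<in> borel_measurable (leb {..<d})"
  proof (rule det_fun_measurable)
    fix i k assume "i < d" "k < d"
    then show "(\<lambda>y. if k = j then y i else a i k) \<in> borel_measurable (leb {..<d})"
      using measurable_coordinate_leb[of i "{..<d}"] by (cases "k = j") auto
  qed
  then show "(\<lambda>y. det_fun d (\<lambda>i k. if k = j then y i else a i k) / det_fun d a) \<in> measurable (leb {..<d}) lborel"
    by measurable
qed

lemma cramer_sol_measurable[measurable]:
  "(\<lambda>(a, y). cramer_sol d a y) \<in> measurable (sphere_prod d {..<d} \<Otimes>\<^sub>M leb {..<d}) (leb {..<d})"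
proof -
  have e1: "(\<lambda>p. fst p i k) \<in> borel_measurable (sphere_prod d {..<d} \<Otimes>\<^sub>M leb {..<d})" if "i < d" "k < d" for i k
    by (rule measurable_compose[OF measurable_fst entry_measurable]) (use that in auto)
  have e2: "(\<lambda>p. snd p i) \<in> borel_measurable (sphere_prod d {..<d} \<Otimes>\<^sub>M leb {..<d})" if "i < d" for i
    by (rule measurable_compose[OF measurable_snd measurable_coordinate_leb]) (use that in auto)
  show ?thesis
    unfolding cramer_sol_def case_prod_beta'
  proof (rule measurable_restrict)
    fix j assume j: "j \<in> {..<d}"
    have "(\<lambda>p. det_fun d (\<lambda>i k. if k = j then snd p i else fst p i k)) \<in> borel_measurable (sphere_prod d {..<d} \<Otimes>\<^sub>M leb {..<d})"
    proof (rule det_fun_measurable)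
      fix i k assume "i < d" "k < d"
      then show "(\<lambda>p. if k = j then snd p i else fst p i k) \<in> borel_measurable (sphere_prod d {..<d} \<Otimes>\<^sub>M leb {..<d})"
        using e1 e2 by (cases "k = j") auto
    qed
    moreover have "(\<lambda>p. det_fun d (fst p)) \<in> borel_measurable (sphere_prod d {..<d} \<Otimes>\<^sub>M leb {..<d})"
      by (rule det_fun_measurable) (use e1 in auto)
    ultimately show "(\<lambda>p. det_fun d (\<lambda>i k. if k = j then snd p i else fst p i k) / det_fun d (fst p)) \<in> measurable (sphere_prod d {..<d} \<Otimes>\<^sub>M leb {..<d}) lborel"
      by simp
  qed
qed

definition plane_height :: "nat \<Rightarrow> (nat \<Rightarrow> nat \<Rightarrow> real) \<Rightarrow> (nat \<Rightarrow> real) \<Rightarrow> real" where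
  "plane_height d a y = 1 / normI {..<d} (cramer_sol d a y)"

definition mat_app :: "nat \<Rightarrow> (nat \<Rightarrow> nat \<Rightarrow> real) \<Rightarrow> (nat \<Rightarrow> real) \<Rightarrow> nat \<Rightarrow> real" where
  "mat_app d a w = (\<lambda>i\<in>{..<d}. \<Sum>j<d. a i j * w j)"

lemma plane_height_measurable[measurable]:
  "(\<lambda>(a, y). plane_height d a y) \<in> borel_measurable (sphere_prod d {..<d} \<Otimes>\<^sub>M leb {..<d})"
proof -
  have "(\<lambda>p. normI {..<d} (case p of (a, y) \<Rightarrow> cramer_sol d a y)) \<in> borel_measurable (sphere_prod d {..<d} \<Otimes>\<^sub>M leb {..<d})"
    by measurable
  then show ?thesis unfolding plane_height_def by (simp add: case_prod_beta')
qed

lemma mat_app_measurable[measurable]: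
  "(\<lambda>(a, w). mat_app d a w) \<in> measurable (sphere_prod d {..<d} \<Otimes>\<^sub>M leb {..<d}) (leb {..<d})"
proof -
  have e1: "(\<lambda>p. fst p i k) \<in> borel_measurable (sphere_prod d {..<d} \<Otimes>\<^sub>M leb {..<d})" if "i < d" "k < d" for i k
    by (rule measurable_compose[OF measurable_fst entry_measurable]) (use that in auto)
  have e2: "(\<lambda>p. snd p i) \<in> borel_measurable (sphere_prod d {..<d} \<Otimes>\<^sub>M leb {..<d})" if "i < d" for i
    by (rule measurable_compose[OF measurable_snd measurable_coordinate_leb]) (use that in auto)
  show ?thesis
    unfolding mat_app_def case_prod_beta'
  proof (rule measurable_restrict)
    fix i assume "i \<in> {..<d}"
    then have "(\<lambda>p. \<Sum>j<d. fst p i j * snd p j) \<in> borel_measurable (sphere_prod d {..<d} \<Otimes>\<^sub>M leb {..<d})"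
      by (intro borel_measurable_sum borel_measurable_times e1 e2) auto
    then show "(\<lambda>p. \<Sum>j<d. fst p i j * snd p j) \<in> measurable (sphere_prod d {..<d} \<Otimes>\<^sub>M leb {..<d}) lborel"
      by simp
  qed
qed

text \<open>\<open>cramer_sol d a\<close> inverts \<open>mat_app d a\<close>; after the substitution
  the height depends on \<open>w\<close> alone, while \<open>a\<close> survives only in the Jacobian
  and in the argument of \<open>k\<close>. This separation lets \<open>a\<close> be integrated
  first.\<close>

lemma volume_formula:
  assumes nz: "\<And>k. k \<le> d \<Longrightarrow> det_fun d (lead k a) \<noteq> 0"
    and f[measurable]: "f \<in> borel_measurable borel" and k[measurable]: "k \<in> borel_measurable (leb {..<d})"
  shows "(\<integral>\<^sup>+y. f (plane_height d a y) * k y \<partial>leb {..<d}) =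
    ennreal \<bar>det_fun d a\<bar> * (\<integral>\<^sup>+w. f (1 / normI {..<d} w) * k (mat_app d a w) \<partial>leb {..<d})"
proof -
  have det: "det_fun d a \<noteq> 0" using nz[of d] by (simp add: lead_full)
  have T: "scales_volume {..<d} (mat_app d a) \<bar>det_fun d a\<bar>"
    unfolding mat_app_def by (rule scales_volume_linear) (rule nz)
  note [measurable] = cramer_sol_measurable_y
  have "(\<integral>\<^sup>+y. f (plane_height d a y) * k y \<partial>leb {..<d}) =
      ennreal \<bar>det_fun d a\<bar> * (\<integral>\<^sup>+w. f (plane_height d a (mat_app d a w)) * k (mat_app d a w) \<partial>leb {..<d})"
    by (rule scales_volumeD[OF T, symmetric]) (unfold plane_height_def, measurable)
  also have "(\<integral>\<^sup>+w. f (plane_height d a (mat_app d a w)) * k (mat_app d a w) \<partial>leb {..<d}) =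
    (\<integral>\<^sup>+w. f (1 / normI {..<d} w) * k (mat_app d a w) \<partial>leb {..<d})"
  proof (rule nn_integral_cong)
    fix w assume "w \<in> space (leb {..<d})"
    then have "cramer_sol d a (mat_app d a w) = w"
      by (intro cramer_sol_unique[OF det]) (auto simp: space_PiM PiE_def mat_app_def)
    then show "f (plane_height d a (mat_app d a w)) * k (mat_app d a w) = f (1 / normI {..<d} w) * k (mat_app d a w)"
      by (simp add: plane_height_def)
  qed
  finally show ?thesis .
qed

text \<open>
  The matrix below arises from the points \<open>sphere_pt d (v * y i) (z i)\<close> by dividing column 0 by \<open>v\<close>.
\<close>

definition mean_abs_det :: "nat \<Rightarrow> real \<Rightarrow> (nat \<Rightarrow> real) \<Rightarrow> ennreal" where
  "mean_abs_det d v y = (\<integral>\<^sup>+z. ennreal \<bar>det_fun d (\<lambda>i k. if k = 0 then y i else srad (v * y i) * z i k)\<bar> \<partial>Pi\<^sub>M {..<d} (\<lambda>_. nu d))"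

text \<open>Explicit candidate for the mean of \<open>f (plane_height d a y)\<close> over random
  \<open>a\<close>. The integration variable \<open>v\<close> is the height, and the mass of
  \<open>cone (- 1)\<close> collects the directions of \<open>w\<close>.\<close>

definition height_mean :: "nat \<Rightarrow> (real \<Rightarrow> ennreal) \<Rightarrow> (nat \<Rightarrow> real) \<Rightarrow> ennreal" where
  "height_mean d f y = emeasure (cone (- 1) {..<d}) (space (cone (- 1) {..<d})) *
     (\<integral>\<^sup>+v. f v * (\<Prod>i<d. ennreal (srad (v * y i) ^ (d - 3))) * mean_abs_det d v y * indicator {0<..} v \<partial>lborel)"

lemma nu_entry_measurable:
  assumes "i < d" "k < d" "k \<noteq> 0"
  shows "(\<lambda>z. z i k) \<in> borel_measurable (Pi\<^sub>M {..<d} (\<lambda>_. nu d))"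
proof -
  have 1: "(\<lambda>z. z i) \<in> measurable (Pi\<^sub>M {..<d} (\<lambda>_. nu d)) (nu d)"
    using measurable_component_singleton[of i "{..<d}" "\<lambda>_. nu d"] assms by simp
  have "(\<lambda>x. x k) \<in> borel_measurable (nu d)"
    using measurable_coordinate_borel[of k "{1..<d}"] assms by simp
  from measurable_compose[OF 1 this] show ?thesis .
qed

lemma sigma_finite_PiM_nu:
  assumes "d \<ge> 4" "prob_space (uniform_sphere d)" "finite I"
  shows "sigma_finite_measure (Pi\<^sub>M I (\<lambda>_::nat. nu d))"
proof -
  interpret product_sigma_finite "\<lambda>_::nat. nu d"
    unfolding product_sigma_finite_def using finite_measure_nu[OF assms(1,2)]
    by (auto intro: finite_measure.axioms(1))
  show ?thesis by (rule sigma_finite[OF assms(3)])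
qed

lemma mean_abs_det_measurable:
  assumes d: "d \<ge> 4" "prob_space (uniform_sphere d)"
    and v[measurable]: "v \<in> borel_measurable M" and y: "y \<in> measurable M (leb {..<d})"
  shows "(\<lambda>p. mean_abs_det d (v p) (y p)) \<in> borel_measurable M"
  unfolding mean_abs_det_def
proof (rule sigma_finite_measure.borel_measurable_nn_integral[OF sigma_finite_PiM_nu[OF d]])
  let ?N = "Pi\<^sub>M {..<d} (\<lambda>_. nu d)"
  have "(\<lambda>q. det_fun d (\<lambda>i k. if k = 0 then y (fst q) i else srad (v (fst q) * y (fst q) i) * snd q i k)) \<in> borel_measurable (M \<Otimes>\<^sub>M ?N)"
  proof (rule det_fun_measurable)
    fix i k assume ik: "i < d" "k < d"
    have "(\<lambda>p. y p i) \<in> borel_measurable M"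
      by (rule measurable_compose[OF y measurable_coordinate_leb]) (use ik in simp)
    then have [measurable]: "(\<lambda>q. y (fst q) i) \<in> borel_measurable (M \<Otimes>\<^sub>M ?N)"
      by measurable
    show "(\<lambda>q. if k = 0 then y (fst q) i else srad (v (fst q) * y (fst q) i) * snd q i k) \<in> borel_measurable (M \<Otimes>\<^sub>M ?N)"
    proof (cases "k = 0")
      case False
      have [measurable]: "(\<lambda>q. snd q i k) \<in> borel_measurable (M \<Otimes>\<^sub>M ?N)"
        by (rule measurable_compose[OF measurable_snd nu_entry_measurable]) (use ik False in auto)
      show ?thesis using False by simp
    qed simp
  qed
  then show "(\<lambda>(p, z). ennreal \<bar>det_fun d (\<lambda>i k. if k = 0 then y p i else srad (v p * y p i) * z i k)\<bar>) \<in> borel_measurable (M \<Otimes>\<^sub>M ?N)"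
    by (simp add: case_prod_beta')
qed simp

text \<open>For fixed \<open>w\<close> all rows are sliced orthogonally to its direction
  \<open>u\<close>: then A w is R times the vector of slice heights, and the reflection leaves the
  absolute determinant unchanged. Passing from the heights t to y = R t costs R^(-d), and the column
  of heights y / R costs another 1 / R.\<close>

lemma Theta:
  assumes d: "d \<ge> 4" "prob_space (uniform_sphere d)"
    and k[measurable]: "k \<in> borel_measurable (leb {..<d})"
    and w: "w \<in> space (leb {..<d})" and pos: "normI {..<d} w > 0"
  shows "(\<integral>\<^sup>+a. ennreal \<bar>det_fun d a\<bar> * k (mat_app d a w) \<partial>sphere_prod d {..<d}) =
    (\<integral>\<^sup>+y. (\<Prod>i<d. ennreal (srad (y i / normI {..<d} w) ^ (d - 3))) * k y *
       (ennreal (1 / normI {..<d} w) * mean_abs_det d (1 / normI {..<d} w) y) \<partial>leb {..<d}) * ennreal (normI {..<d} w powr (- real d))"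
proof -
  define R where "R = normI {..<d} w"
  define u where "u = dirI {..<d} w"
  have R: "R > 0" using pos by (simp add: R_def)
  have u: "u \<in> sphere_Rd d"
    using normI_dirI[of "{..<d}" w] pos by (simp add: sphere_Rd_def norm_Rd_eq u_def Rd_def dirI_def)
  have wu: "w j = R * u j" if "j < d" for j
    using that R by (simp add: u_def dirI_def R_def)
  have ker: "mat_app d (\<lambda>i\<in>{..<d}. swap_refl d u (sphere_pt d (t i) (z i))) w = (\<lambda>i\<in>{..<d}. R * t i)" for t and z :: "nat \<Rightarrow> nat \<Rightarrow> real"
  proof -
    have "(\<Sum>j<d. swap_refl d u (sphere_pt d (t i) (z i)) j * w j) = R * t i" for i
    proof -
      have "(\<Sum>j<d. swap_refl d u (sphere_pt d (t i) (z i)) j * w j) = R * inner_Rd d (swap_refl d u (sphere_pt d (t i) (z i))) u"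
        unfolding inner_Rd_def sum_distrib_left by (rule sum.cong) (auto simp: wu)
      also have "\<dots> = R * t i"
        using d by (subst inner_swap_refl_u[OF u]) (auto simp: sphere_pt_def)
      finally show ?thesis .
    qed
    then show ?thesis by (auto simp: mat_app_def fun_eq_iff)
  qed
  define D where "D t = (\<integral>\<^sup>+z. ennreal \<bar>det_fun d (\<lambda>i. sphere_pt d (t i) (z i))\<bar> \<partial>Pi\<^sub>M {..<d} (\<lambda>_. nu d))" for t :: "nat \<Rightarrow> real"
  have det: "\<bar>det_fun d (\<lambda>i\<in>{..<d}. swap_refl d u (sphere_pt d (t i) (z i)))\<bar> = \<bar>det_fun d (\<lambda>i. sphere_pt d (t i) (z i))\<bar>" for t and z :: "nat \<Rightarrow> nat \<Rightarrow> real"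
  proof -
    have "det_fun d (\<lambda>i\<in>{..<d}. swap_refl d u (sphere_pt d (t i) (z i))) = det_fun d (\<lambda>i. swap_refl d u (sphere_pt d (t i) (z i)))"
      by (rule det_fun_cong) simp
    then show ?thesis by (simp only: det_fun_swap_refl)
  qed
  have w': "(\<lambda>a. (a, w)) \<in> measurable (sphere_prod d {..<d}) (sphere_prod d {..<d} \<Otimes>\<^sub>M leb {..<d})"
    using w by (rule measurable_Pair2')
  have m1: "(\<lambda>a. mat_app d a w) \<in> measurable (sphere_prod d {..<d}) (leb {..<d})"
    using measurable_compose[OF w' mat_app_measurable] by simp
  have m2: "(\<lambda>a. det_fun d a) \<in> borel_measurable (sphere_prod d {..<d})"
    by (rule det_fun_measurable, rule entry_measurable) auto
  have m3: "(\<lambda>z. det_fun d (\<lambda>i. sphere_pt d (t i) (z i))) \<in> borel_measurable (Pi\<^sub>M {..<d} (\<lambda>_. nu d))" for t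
  proof (rule det_fun_measurable)
    fix i j assume ij: "i < d" "j < d"
    show "(\<lambda>z. sphere_pt d (t i) (z i) j) \<in> borel_measurable (Pi\<^sub>M {..<d} (\<lambda>_. nu d))"
    proof (cases "j = 0")
      case False
      note [measurable] = nu_entry_measurable[OF ij False]
      show ?thesis using False ij by (simp add: sphere_pt_def)
    qed (use ij in \<open>simp add: sphere_pt_def\<close>)
  qed
  have DE: "D (\<lambda>i\<in>{..<d}. (1 / R) * y i) = ennreal (1 / R) * mean_abs_det d (1 / R) y" for y
  proof -
    have eq: "det_fun d (\<lambda>i. sphere_pt d ((\<lambda>i\<in>{..<d}. (1 / R) * y i) i) (z i)) =
        (1 / R) * det_fun d (\<lambda>i k. if k = 0 then y i else srad ((1 / R) * y i) * z i k)" for z :: "nat \<Rightarrow> nat \<Rightarrow> real"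
    proof -
      have "det_fun d (\<lambda>i. sphere_pt d ((\<lambda>i\<in>{..<d}. (1 / R) * y i) i) (z i)) =
        det_fun d (\<lambda>i j. (if j = 0 then 1 / R else 1) * (if j = 0 then y i else srad ((1 / R) * y i) * z i j))"
        by (rule det_fun_cong) (auto simp: sphere_pt_def)
      also have "\<dots> = (\<Prod>j<d. if j = 0 then 1 / R else 1) * det_fun d (\<lambda>i k. if k = 0 then y i else srad ((1 / R) * y i) * z i k)"
        by (rule det_fun_scale_columns)
      also have "(\<Prod>j<d. if j = 0 then 1 / R else 1) = 1 / R"
        using d by (subst prod.delta) auto
      finally show ?thesis .
    qed
    have "(\<lambda>z. det_fun d (\<lambda>i k. if k = 0 then y i else srad ((1 / R) * y i) * z i k)) \<in> borel_measurable (Pi\<^sub>M {..<d} (\<lambda>_. nu d))"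
    proof (rule det_fun_measurable)
      fix i j assume ij: "i < d" "j < d"
      show "(\<lambda>z. if j = 0 then y i else srad ((1 / R) * y i) * z i j) \<in> borel_measurable (Pi\<^sub>M {..<d} (\<lambda>_. nu d))"
      proof (cases "j = 0")
        case False
        note [measurable] = nu_entry_measurable[OF ij False]
        show ?thesis using False ij by simp
      qed simp
    qed
    moreover have "ennreal \<bar>(1 / R) * x\<bar> = ennreal (1 / R) * ennreal \<bar>x\<bar>" for x
      using R by (simp add: abs_mult flip: ennreal_mult)
    ultimately show ?thesis
      unfolding D_def mean_abs_det_def eq by (subst nn_integral_cmult[symmetric]) simp_all
  qed
  have Dm: "D \<in> borel_measurable (leb {..<d})"
    unfolding D_def
  proof (rule sigma_finite_measure.borel_measurable_nn_integral[OF sigma_finite_PiM_nu[OF d]])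
    let ?N = "Pi\<^sub>M {..<d} (\<lambda>_. nu d)"
    have "(\<lambda>q. det_fun d (\<lambda>i. sphere_pt d (fst q i) (snd q i))) \<in> borel_measurable (leb {..<d} \<Otimes>\<^sub>M ?N)"
    proof (rule det_fun_measurable)
      fix i k assume ik: "i < d" "k < d"
      have [measurable]: "(\<lambda>q. fst q i) \<in> borel_measurable (leb {..<d} \<Otimes>\<^sub>M ?N)"
        by (rule measurable_compose[OF measurable_fst measurable_coordinate_leb]) (use ik in simp)
      show "(\<lambda>q. sphere_pt d (fst q i) (snd q i) k) \<in> borel_measurable (leb {..<d} \<Otimes>\<^sub>M ?N)"
      proof (cases "k = 0")
        case False
        have [measurable]: "(\<lambda>q. snd q i k) \<in> borel_measurable (leb {..<d} \<Otimes>\<^sub>M ?N)"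
          by (rule measurable_compose[OF measurable_snd nu_entry_measurable]) (use ik False in auto)
        show ?thesis using False ik by (simp add: sphere_pt_def)
      qed (use ik in \<open>simp add: sphere_pt_def\<close>)
    qed
    then show "(\<lambda>(t, z). ennreal \<bar>det_fun d (\<lambda>i. sphere_pt d (t i) (z i))\<bar>) \<in> borel_measurable (leb {..<d} \<Otimes>\<^sub>M ?N)"
      by (simp add: case_prod_beta')
  qed simp
  have "(\<integral>\<^sup>+a. ennreal \<bar>det_fun d a\<bar> * k (mat_app d a w) \<partial>sphere_prod d {..<d}) =
    (\<integral>\<^sup>+t. (\<Prod>i<d. ennreal (srad (t i) ^ (d - 3))) *
      (\<integral>\<^sup>+z. ennreal \<bar>det_fun d (\<lambda>i. sphere_pt d (t i) (z i))\<bar> * k (\<lambda>i\<in>{..<d}. R * t i) \<partial>Pi\<^sub>M {..<d} (\<lambda>_. nu d)) \<partial>leb {..<d})"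
    by (subst PiM_uniform_sphere_slice[OF d, where u = u])
      (use m1 m2 k in \<open>auto simp: ker det\<close>)
  also have "\<dots> = (\<integral>\<^sup>+t. (\<Prod>i<d. ennreal (srad (t i) ^ (d - 3))) * (k (\<lambda>i\<in>{..<d}. R * t i) * D t) \<partial>leb {..<d})"
    unfolding D_def by (intro nn_integral_cong) (subst nn_integral_multc, use m3 in \<open>auto simp: mult_ac\<close>)
  also have "\<dots> = ennreal (\<bar>1 / R\<bar> ^ card {..<d}) * (\<integral>\<^sup>+y. (\<lambda>t. (\<Prod>i<d. ennreal (srad (t i) ^ (d - 3))) * (k (\<lambda>i\<in>{..<d}. R * t i) * D t)) (\<lambda>i\<in>{..<d}. (1 / R) * y i) \<partial>leb {..<d})"
  proof (rule scales_volumeD[symmetric])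
    show "scales_volume {..<d} (\<lambda>x. \<lambda>i\<in>{..<d}. (1 / R) * x i) (\<bar>1 / R\<bar> ^ card {..<d})"
      by (rule scales_volume_scaling) (use R in auto)
    have [measurable]: "(\<lambda>t. k (\<lambda>i\<in>{..<d}. R * t i)) \<in> borel_measurable (leb {..<d})"
    proof (rule measurable_compose[OF _ k])
      have "scales_volume {..<d} (\<lambda>x. \<lambda>i\<in>{..<d}. R * x i) (\<bar>R\<bar> ^ card {..<d})"
        by (rule scales_volume_scaling) (use R in auto)
      then show "(\<lambda>t. \<lambda>i\<in>{..<d}. R * t i) \<in> measurable (leb {..<d}) (leb {..<d})"
        by (simp add: scales_volume_def)
    qed
    have [measurable]: "(\<lambda>t. \<Prod>i<d. ennreal (srad (t i) ^ (d - 3))) \<in> borel_measurable (leb {..<d})"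
    proof (rule borel_measurable_prod_ennreal)
      fix i assume "i \<in> {..<d}"
      then have [measurable]: "(\<lambda>t. t i) \<in> borel_measurable (leb {..<d})" by (rule measurable_coordinate_leb)
      show "(\<lambda>t. ennreal (srad (t i) ^ (d - 3))) \<in> borel_measurable (leb {..<d})" by measurable
    qed
    note [measurable] = Dm
    show "(\<lambda>t. (\<Prod>i<d. ennreal (srad (t i) ^ (d - 3))) * (k (\<lambda>i\<in>{..<d}. R * t i) * D t)) \<in> borel_measurable (leb {..<d})"
      by measurable
  qed
  also have "(\<integral>\<^sup>+y. (\<lambda>t. (\<Prod>i<d. ennreal (srad (t i) ^ (d - 3))) * (k (\<lambda>i\<in>{..<d}. R * t i) * D t)) (\<lambda>i\<in>{..<d}. (1 / R) * y i) \<partial>leb {..<d}) =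
    (\<integral>\<^sup>+y. (\<Prod>i<d. ennreal (srad (y i / R) ^ (d - 3))) * k y * (ennreal (1 / R) * mean_abs_det d (1 / R) y) \<partial>leb {..<d})"
  proof (rule nn_integral_cong)
    fix y assume y: "y \<in> space (leb {..<d})"
    have 1: "(\<lambda>i\<in>{..<d}. R * (\<lambda>i\<in>{..<d}. (1 / R) * y i) i) = y"
      using R y by (auto simp: fun_eq_iff space_PiM PiE_def extensional_def)
    have 2: "(\<Prod>i<d. ennreal (srad ((\<lambda>i\<in>{..<d}. (1 / R) * y i) i) ^ (d - 3))) = (\<Prod>i<d. ennreal (srad (y i / R) ^ (d - 3)))"
      by (rule prod.cong) auto
    show "(\<lambda>t. (\<Prod>i<d. ennreal (srad (t i) ^ (d - 3))) * (k (\<lambda>i\<in>{..<d}. R * t i) * D t)) (\<lambda>i\<in>{..<d}. (1 / R) * y i) =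
      (\<Prod>i<d. ennreal (srad (y i / R) ^ (d - 3))) * k y * (ennreal (1 / R) * mean_abs_det d (1 / R) y)"
      unfolding 1 2 DE by (simp only: mult.assoc)
  qed
  also have "\<bar>1 / R\<bar> ^ card {..<d} = R powr (- real d)"
    using R by (simp add: powr_minus powr_realpow power_one_over divide_inverse power_inverse)
  finally show ?thesis unfolding R_def by (simp only: mult.commute)
qed

lemma prob_space_sphere_prod: "prob_space (uniform_sphere d) \<Longrightarrow> prob_space (sphere_prod d I)"
  by (rule prob_space_PiM)

lemma srad_prod_measurable:
  assumes v[measurable]: "v \<in> borel_measurable M" and y: "y \<in> measurable M (leb {..<d})"
  shows "(\<lambda>p. \<Prod>i<d. ennreal (srad (v p * y p i) ^ m)) \<in> borel_measurable M"
proof (rule borel_measurable_prod_ennreal)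
  fix i assume "i \<in> {..<d}"
  then have [measurable]: "(\<lambda>p. y p i) \<in> borel_measurable M"
    by (intro measurable_compose[OF y measurable_coordinate_leb])
  show "(\<lambda>p. ennreal (srad (v p * y p i) ^ m)) \<in> borel_measurable M" by measurable
qed

lemma height_mean_measurable:
  assumes d: "d \<ge> 4" "prob_space (uniform_sphere d)"
    and f[measurable]: "f \<in> borel_measurable borel"
  shows "height_mean d f \<in> borel_measurable (leb {..<d})"
proof -
  have [measurable]: "(\<lambda>p. mean_abs_det d (snd p) (fst p)) \<in> borel_measurable (leb {..<d} \<Otimes>\<^sub>M borel)"
    by (rule mean_abs_det_measurable[OF d]) measurable
  have [measurable]: "(\<lambda>p. \<Prod>i<d. ennreal (srad (snd p * fst p i) ^ (d - 3))) \<in> borel_measurable (leb {..<d} \<Otimes>\<^sub>M borel)"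
    by (rule srad_prod_measurable) measurable
  have "(\<lambda>(y, v). f v * (\<Prod>i<d. ennreal (srad (v * y i) ^ (d - 3))) * mean_abs_det d v y * indicator {0<..} v) \<in> borel_measurable (leb {..<d} \<Otimes>\<^sub>M borel)"
    unfolding case_prod_beta' by measurable
  then have [measurable]: "(\<lambda>y. \<integral>\<^sup>+v. f v * (\<Prod>i<d. ennreal (srad (v * y i) ^ (d - 3))) * mean_abs_det d v y * indicator {0<..} v \<partial>lborel) \<in> borel_measurable (leb {..<d})"
    by (intro lborel.borel_measurable_nn_integral) simp
  show ?thesis unfolding height_mean_def[abs_def] by measurable
qed

text \<open>Fubini mediates between the substitution in \<open>y\<close> for fixed \<open>a\<close>
  and the slicing for fixed \<open>w\<close>. The test function \<open>k\<close> is arbitrary, so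
  the identity can be localised in \<open>y\<close> afterwards.\<close>

lemma disintegration:
  assumes d: "d \<ge> 4" "prob_space (uniform_sphere d)"
    and f[measurable]: "f \<in> borel_measurable borel" and k[measurable]: "k \<in> borel_measurable (leb {..<d})"
  shows "(\<integral>\<^sup>+y. (\<integral>\<^sup>+a. f (plane_height d a y) \<partial>sphere_prod d {..<d}) * k y \<partial>leb {..<d}) = (\<integral>\<^sup>+y. height_mean d f y * k y \<partial>leb {..<d})"
proof -
  interpret S: prob_space "sphere_prod d {..<d}" by (rule prob_space_sphere_prod[OF d(2)])
  interpret L: sigma_finite_measure "leb {..<d}" by (rule leb.sigma_finite) simp
  interpret SL: pair_sigma_finite "sphere_prod d {..<d}" "leb {..<d}" ..
  interpret LB: pair_sigma_finite "leb {..<d}" "lborel :: real measure" ..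
  have fin: "finite {..<d}" "{..<d} \<noteq> {}" using d by (auto simp: lessThan_empty_iff)
  have hm[measurable]: "(\<lambda>p. plane_height d (fst p) (snd p)) \<in> borel_measurable (sphere_prod d {..<d} \<Otimes>\<^sub>M leb {..<d})"
    using plane_height_measurable[of d] by (simp add: case_prod_beta')
  have mm[measurable]: "(\<lambda>p. mat_app d (fst p) (snd p)) \<in> measurable (sphere_prod d {..<d} \<Otimes>\<^sub>M leb {..<d}) (leb {..<d})"
    using mat_app_measurable[of d] by (simp add: case_prod_beta')
  have dm[measurable]: "(\<lambda>a. det_fun d a) \<in> borel_measurable (sphere_prod d {..<d})"
    by (rule det_fun_measurable, rule entry_measurable) auto
  have j1: "(\<lambda>p. f (plane_height d (fst p) (snd p)) * k (snd p)) \<in> borel_measurable (sphere_prod d {..<d} \<Otimes>\<^sub>M leb {..<d})"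
    by measurable
  have j2: "(\<lambda>p. f (1 / normI {..<d} (snd p)) * (ennreal \<bar>det_fun d (fst p)\<bar> * k (mat_app d (fst p) (snd p)))) \<in> borel_measurable (sphere_prod d {..<d} \<Otimes>\<^sub>M leb {..<d})"
    by measurable
  have "(\<integral>\<^sup>+y. (\<integral>\<^sup>+a. f (plane_height d a y) \<partial>sphere_prod d {..<d}) * k y \<partial>leb {..<d}) =
    (\<integral>\<^sup>+y. \<integral>\<^sup>+a. f (plane_height d a y) * k y \<partial>sphere_prod d {..<d} \<partial>leb {..<d})"
  proof (rule nn_integral_cong)
    fix y assume y: "y \<in> space (leb {..<d})"
    have "(\<lambda>a. (a, y)) \<in> measurable (sphere_prod d {..<d}) (sphere_prod d {..<d} \<Otimes>\<^sub>M leb {..<d})"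
      using y by (rule measurable_Pair2')
    from measurable_compose[OF this hm] have [measurable]: "(\<lambda>a. plane_height d a y) \<in> borel_measurable (sphere_prod d {..<d})" by simp
    show "(\<integral>\<^sup>+a. f (plane_height d a y) \<partial>sphere_prod d {..<d}) * k y = (\<integral>\<^sup>+a. f (plane_height d a y) * k y \<partial>sphere_prod d {..<d})"
      by (rule nn_integral_multc[symmetric]) measurable
  qed
  also have "\<dots> = (\<integral>\<^sup>+a. \<integral>\<^sup>+y. f (plane_height d a y) * k y \<partial>leb {..<d} \<partial>sphere_prod d {..<d})"
    by (rule SL.Fubini') (use j1 in \<open>simp add: case_prod_beta'\<close>)
  also have "\<dots> = (\<integral>\<^sup>+a. \<integral>\<^sup>+w. f (1 / normI {..<d} w) * (ennreal \<bar>det_fun d a\<bar> * k (mat_app d a w)) \<partial>leb {..<d} \<partial>sphere_prod d {..<d})"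
  proof (rule nn_integral_cong_AE)
    have sp: "AE a in sphere_prod d {..<d}. a \<in> space (sphere_prod d {..<d})" by (rule AE_space)
    show "AE a in sphere_prod d {..<d}. (\<integral>\<^sup>+y. f (plane_height d a y) * k y \<partial>leb {..<d}) =
        (\<integral>\<^sup>+w. f (1 / normI {..<d} w) * (ennreal \<bar>det_fun d a\<bar> * k (mat_app d a w)) \<partial>leb {..<d})"
      using AE_leading_minors[OF d(2)] sp
    proof eventually_elim
      case (elim a)
      have "(\<integral>\<^sup>+y. f (plane_height d a y) * k y \<partial>leb {..<d}) =
        ennreal \<bar>det_fun d a\<bar> * (\<integral>\<^sup>+w. f (1 / normI {..<d} w) * k (mat_app d a w) \<partial>leb {..<d})"
        by (rule volume_formula) (use elim in auto)
      also have "\<dots> = (\<integral>\<^sup>+w. ennreal \<bar>det_fun d a\<bar> * (f (1 / normI {..<d} w) * k (mat_app d a w)) \<partial>leb {..<d})"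
      proof (rule nn_integral_cmult[symmetric])
        have "(\<lambda>w. (a, w)) \<in> measurable (leb {..<d}) (sphere_prod d {..<d} \<Otimes>\<^sub>M leb {..<d})"
          using elim(2) by (rule measurable_Pair1')
        from measurable_compose[OF this mm]
        have [measurable]: "(\<lambda>w. mat_app d a w) \<in> measurable (leb {..<d}) (leb {..<d})" by simp
        show "(\<lambda>w. f (1 / normI {..<d} w) * k (mat_app d a w)) \<in> borel_measurable (leb {..<d})" by measurable
      qed
      finally show ?case by (simp only: mult.left_commute)
    qed
  qed
  also have "\<dots> = (\<integral>\<^sup>+w. \<integral>\<^sup>+a. f (1 / normI {..<d} w) * (ennreal \<bar>det_fun d a\<bar> * k (mat_app d a w)) \<partial>sphere_prod d {..<d} \<partial>leb {..<d})"
    by (rule SL.Fubini'[symmetric]) (use j2 in \<open>simp add: case_prod_beta'\<close>)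
  \<comment> \<open>The integrand depends on \<open>w\<close> through its length only. Taking 1 /
    |w| as radial variable, that is \<alpha> = - 1, makes the height itself the variable of
    integration.\<close>
  also have "\<dots> = (\<integral>\<^sup>+w. (\<lambda>(z, v). f v * ((\<integral>\<^sup>+y. (\<Prod>i<d. ennreal (srad (v * y i) ^ (d - 3))) * k y *
       (ennreal v * mean_abs_det d v y) \<partial>leb {..<d}) * ennreal (v powr d))) (dirI {..<d} w, normI {..<d} w powr (- 1)) \<partial>leb {..<d})"
  proof (rule nn_integral_cong_AE)
    have sp: "AE w in leb {..<d}. w \<in> space (leb {..<d})" by (rule AE_space)
    show "AE w in leb {..<d}. (\<integral>\<^sup>+a. f (1 / normI {..<d} w) * (ennreal \<bar>det_fun d a\<bar> * k (mat_app d a w)) \<partial>sphere_prod d {..<d}) =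
      (\<lambda>(z, v). f v * ((\<integral>\<^sup>+y. (\<Prod>i<d. ennreal (srad (v * y i) ^ (d - 3))) * k y *
       (ennreal v * mean_abs_det d v y) \<partial>leb {..<d}) * ennreal (v powr d))) (dirI {..<d} w, normI {..<d} w powr (- 1))"
      using AE_leb_normI_pos[OF fin] sp
    proof eventually_elim
      case (elim w)
      define R where "R = normI {..<d} w"
      have R: "R > 0" using elim by (simp add: R_def)
      have [measurable]: "(\<lambda>a. mat_app d a w) \<in> measurable (sphere_prod d {..<d}) (leb {..<d})"
        using measurable_compose[OF measurable_Pair2'[OF elim(2)] mm] by simp
      have p1: "R powr (- 1) = 1 / R" using R by (simp add: powr_minus_divide)
      have p2: "R powr (- real d) = (1 / R) powr d" using R by (simp add: powr_minus_divide powr_divide)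
      have "(\<integral>\<^sup>+a. f (1 / R) * (ennreal \<bar>det_fun d a\<bar> * k (mat_app d a w)) \<partial>sphere_prod d {..<d}) =
          f (1 / R) * (\<integral>\<^sup>+a. ennreal \<bar>det_fun d a\<bar> * k (mat_app d a w) \<partial>sphere_prod d {..<d})"
        by (rule nn_integral_cmult) measurable
      also have "(\<integral>\<^sup>+a. ennreal \<bar>det_fun d a\<bar> * k (mat_app d a w) \<partial>sphere_prod d {..<d}) =
        (\<integral>\<^sup>+y. (\<Prod>i<d. ennreal (srad (y i / R) ^ (d - 3))) * k y *
           (ennreal (1 / R) * mean_abs_det d (1 / R) y) \<partial>leb {..<d}) * ennreal (R powr (- real d))"
        unfolding R_def by (rule Theta[OF d k elim(2,1)])
      finally show ?case unfolding R_def[symmetric] prod.case p1 p2 by simp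
    qed
  qed
  also have "\<dots> = (\<integral>\<^sup>+z. \<integral>\<^sup>+v. (\<lambda>(z, v). f v * ((\<integral>\<^sup>+y. (\<Prod>i<d. ennreal (srad (v * y i) ^ (d - 3))) * k y *
       (ennreal v * mean_abs_det d v y) \<partial>leb {..<d}) * ennreal (v powr d))) (z, v) * ennreal (v powr (card {..<d} / (- 1) - 1)) * indicator {0<..} v
       \<partial>lborel \<partial>cone (- 1) {..<d})"
  proof (rule polar[OF fin])
    have [measurable]: "(\<lambda>p. mean_abs_det d (fst p) (snd p)) \<in> borel_measurable (borel \<Otimes>\<^sub>M leb {..<d})"
      by (rule mean_abs_det_measurable[OF d]) measurable
    have [measurable]: "(\<lambda>p. \<Prod>i<d. ennreal (srad (fst p * snd p i) ^ (d - 3))) \<in> borel_measurable (borel \<Otimes>\<^sub>M leb {..<d})"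
      by (rule srad_prod_measurable) measurable
    have "(\<lambda>(v, y). (\<Prod>i<d. ennreal (srad (v * y i) ^ (d - 3))) * k y * (ennreal v * mean_abs_det d v y)) \<in> borel_measurable (borel \<Otimes>\<^sub>M leb {..<d})"
      unfolding case_prod_beta' by measurable
    then have [measurable]: "(\<lambda>v. \<integral>\<^sup>+y. (\<Prod>i<d. ennreal (srad (v * y i) ^ (d - 3))) * k y * (ennreal v * mean_abs_det d v y) \<partial>leb {..<d}) \<in> borel_measurable borel"
      by (intro L.borel_measurable_nn_integral) simp
    have h: "(\<lambda>v. f v * ((\<integral>\<^sup>+y. (\<Prod>i<d. ennreal (srad (v * y i) ^ (d - 3))) * k y * (ennreal v * mean_abs_det d v y) \<partial>leb {..<d}) * ennreal (v powr d))) \<in> borel_measurable borel"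
      by measurable
    show "(\<lambda>(z, v). f v * ((\<integral>\<^sup>+y. (\<Prod>i<d. ennreal (srad (v * y i) ^ (d - 3))) * k y * (ennreal v * mean_abs_det d v y) \<partial>leb {..<d}) * ennreal (v powr d)))
      \<in> borel_measurable (Pi\<^sub>M {..<d} (\<lambda>_. borel) \<Otimes>\<^sub>M borel)"
      unfolding case_prod_beta' by (rule measurable_compose[OF measurable_snd h])
  qed simp
  also have "\<dots> = emeasure (cone (- 1) {..<d}) (space (cone (- 1) {..<d})) *
      (\<integral>\<^sup>+v. \<integral>\<^sup>+y. (f v * (\<Prod>i<d. ennreal (srad (v * y i) ^ (d - 3))) * mean_abs_det d v y * indicator {0<..} v) * k y \<partial>leb {..<d} \<partial>lborel)"
  proof -
    have "(\<lambda>(z, v). f v * ((\<integral>\<^sup>+y. (\<Prod>i<d. ennreal (srad (v * y i) ^ (d - 3))) * k y *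
       (ennreal v * mean_abs_det d v y) \<partial>leb {..<d}) * ennreal (v powr d))) (z, v) * ennreal (v powr (card {..<d} / (- 1) - 1)) * indicator {0<..} v =
      (\<integral>\<^sup>+y. (f v * (\<Prod>i<d. ennreal (srad (v * y i) ^ (d - 3))) * mean_abs_det d v y * indicator {0<..} v) * k y \<partial>leb {..<d})"
      for z :: "nat \<Rightarrow> real" and v
    proof (cases "v > 0")
      case v: True
      note [measurable] = mean_abs_det_measurable[OF d, of "\<lambda>_. v" "leb {..<d}" "\<lambda>y. y"] srad_prod_measurable[of "\<lambda>_. v" "leb {..<d}" "\<lambda>y. y" d "d - 3"]
      \<comment> \<open>The power v^(d + 1) from slicing meets v^(- d - 1) from polar coordinates;
        they cancel exactly, which is why \<open>height_mean\<close> contains no power of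
        \<open>v\<close>.\<close>
      have e: "v * (v powr d * v powr (real d / (- 1) - 1)) = 1"
      proof -
        have "v * (v powr d * v powr (real d / (- 1) - 1)) = v powr 1 * (v powr d * v powr (real d / (- 1) - 1))" using v by simp
        also have "\<dots> = 1" unfolding powr_add[symmetric] using v by simp
        finally show ?thesis .
      qed
      let ?P = "\<lambda>y. (\<Prod>i<d. ennreal (srad (v * y i) ^ (d - 3))) * k y * mean_abs_det d v y"
      have P: "?P \<in> borel_measurable (leb {..<d})" by measurable
      have "(\<integral>\<^sup>+y. (\<Prod>i<d. ennreal (srad (v * y i) ^ (d - 3))) * k y * (ennreal v * mean_abs_det d v y) \<partial>leb {..<d}) = ennreal v * (\<integral>\<^sup>+y. ?P y \<partial>leb {..<d})"
        using P by (subst nn_integral_cmult[symmetric]) (auto simp: mult_ac)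
      then have "(\<lambda>(z, v). f v * ((\<integral>\<^sup>+y. (\<Prod>i<d. ennreal (srad (v * y i) ^ (d - 3))) * k y *
         (ennreal v * mean_abs_det d v y) \<partial>leb {..<d}) * ennreal (v powr d))) (z, v) * ennreal (v powr (card {..<d} / (- 1) - 1)) * indicator {0<..} v =
        (ennreal v * (ennreal (v powr d) * ennreal (v powr (real d / (- 1) - 1)))) * (f v * (\<integral>\<^sup>+y. ?P y \<partial>leb {..<d}))"
        using v by (simp add: mult_ac)
      also have "ennreal v * (ennreal (v powr d) * ennreal (v powr (real d / (- 1) - 1))) = ennreal (v * (v powr d * v powr (real d / (- 1) - 1)))"
        using v by (simp add: ennreal_mult)
      also have "\<dots> * (f v * (\<integral>\<^sup>+y. ?P y \<partial>leb {..<d})) = (\<integral>\<^sup>+y. f v * ?P y \<partial>leb {..<d})"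
        unfolding e using P by (simp add: nn_integral_cmult)
      also have "\<dots> = (\<integral>\<^sup>+y. (f v * (\<Prod>i<d. ennreal (srad (v * y i) ^ (d - 3))) * mean_abs_det d v y * indicator {0<..} v) * k y \<partial>leb {..<d})"
        using v by (intro nn_integral_cong) (simp add: mult_ac)
      finally show ?thesis .
    qed simp
    then show ?thesis by (simp add: mult.commute)
  qed
  also have "(\<integral>\<^sup>+v. \<integral>\<^sup>+y. (f v * (\<Prod>i<d. ennreal (srad (v * y i) ^ (d - 3))) * mean_abs_det d v y * indicator {0<..} v) * k y \<partial>leb {..<d} \<partial>lborel) =
     (\<integral>\<^sup>+y. \<integral>\<^sup>+v. (f v * (\<Prod>i<d. ennreal (srad (v * y i) ^ (d - 3))) * mean_abs_det d v y * indicator {0<..} v) * k y \<partial>lborel \<partial>leb {..<d})"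
  proof (rule LB.Fubini')
    have [measurable]: "(\<lambda>p. mean_abs_det d (snd p) (fst p)) \<in> borel_measurable (leb {..<d} \<Otimes>\<^sub>M lborel)"
      by (rule mean_abs_det_measurable[OF d]) measurable
    have [measurable]: "(\<lambda>p. \<Prod>i<d. ennreal (srad (snd p * fst p i) ^ (d - 3))) \<in> borel_measurable (leb {..<d} \<Otimes>\<^sub>M lborel)"
      by (rule srad_prod_measurable) measurable
    show "(\<lambda>(y, v). (f v * (\<Prod>i<d. ennreal (srad (v * y i) ^ (d - 3))) * mean_abs_det d v y * indicator {0<..} v) * k y) \<in> borel_measurable (leb {..<d} \<Otimes>\<^sub>M lborel)"
      unfolding case_prod_beta' by measurable
  qed
  also have "emeasure (cone (- 1) {..<d}) (space (cone (- 1) {..<d})) * \<dots> = (\<integral>\<^sup>+y. height_mean d f y * k y \<partial>leb {..<d})"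
  proof (subst nn_integral_cmult[symmetric])
    have [measurable]: "(\<lambda>p. mean_abs_det d (snd p) (fst p)) \<in> borel_measurable (leb {..<d} \<Otimes>\<^sub>M lborel)"
      by (rule mean_abs_det_measurable[OF d]) measurable
    have [measurable]: "(\<lambda>p. \<Prod>i<d. ennreal (srad (snd p * fst p i) ^ (d - 3))) \<in> borel_measurable (leb {..<d} \<Otimes>\<^sub>M lborel)"
      by (rule srad_prod_measurable) measurable
    have "(\<lambda>(y, v). (f v * (\<Prod>i<d. ennreal (srad (v * y i) ^ (d - 3))) * mean_abs_det d v y * indicator {0<..} v) * k y) \<in> borel_measurable (leb {..<d} \<Otimes>\<^sub>M lborel)"
      unfolding case_prod_beta' by measurable
    then show "(\<lambda>y. \<integral>\<^sup>+v. (f v * (\<Prod>i<d. ennreal (srad (v * y i) ^ (d - 3))) * mean_abs_det d v y * indicator {0<..} v) * k y \<partial>lborel) \<in> borel_measurable (leb {..<d})"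
      by (rule lborel.borel_measurable_nn_integral)
    show "(\<integral>\<^sup>+y. emeasure (cone (- 1) {..<d}) (space (cone (- 1) {..<d})) *
       (\<integral>\<^sup>+v. (f v * (\<Prod>i<d. ennreal (srad (v * y i) ^ (d - 3))) * mean_abs_det d v y * indicator {0<..} v) * k y \<partial>lborel) \<partial>leb {..<d}) =
       (\<integral>\<^sup>+y. height_mean d f y * k y \<partial>leb {..<d})"
    proof (rule nn_integral_cong)
      fix y assume y: "y \<in> space (leb {..<d})"
      have [measurable]: "(\<lambda>v. mean_abs_det d v y) \<in> borel_measurable borel"
        by (rule mean_abs_det_measurable[OF d]) (use y in auto)
      have [measurable]: "(\<lambda>v. \<Prod>i<d. ennreal (srad (v * y i) ^ (d - 3))) \<in> borel_measurable borel"
        by (rule srad_prod_measurable) (use y in auto)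
      have "(\<integral>\<^sup>+v. (f v * (\<Prod>i<d. ennreal (srad (v * y i) ^ (d - 3))) * mean_abs_det d v y * indicator {0<..} v) * k y \<partial>lborel) =
        (\<integral>\<^sup>+v. f v * (\<Prod>i<d. ennreal (srad (v * y i) ^ (d - 3))) * mean_abs_det d v y * indicator {0<..} v \<partial>lborel) * k y"
        by (rule nn_integral_multc) measurable
      then show "emeasure (cone (- 1) {..<d}) (space (cone (- 1) {..<d})) *
       (\<integral>\<^sup>+v. (f v * (\<Prod>i<d. ennreal (srad (v * y i) ^ (d - 3))) * mean_abs_det d v y * indicator {0<..} v) * k y \<partial>lborel) = height_mean d f y * k y"
        by (simp only: height_mean_def mult.assoc)
    qed
  qed
  finally show ?thesis .
qed

text \<open>Indicators of sets as test functions show that the two sides are Lebesgue densities of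
  the same measure; sigma-finiteness then gives equality almost everywhere.\<close>

lemma AE_disintegration:
  assumes d: "d \<ge> 4" "prob_space (uniform_sphere d)" and f[measurable]: "f \<in> borel_measurable borel"
  shows "AE y in leb {..<d}. (\<integral>\<^sup>+a. f (plane_height d a y) \<partial>sphere_prod d {..<d}) = height_mean d f y"
proof -
  interpret L: sigma_finite_measure "leb {..<d}" by (rule leb.sigma_finite) simp
  interpret S: prob_space "sphere_prod d {..<d}" by (rule prob_space_sphere_prod[OF d(2)])
  have "(\<lambda>p. f (plane_height d (snd p) (fst p))) \<in> borel_measurable (leb {..<d} \<Otimes>\<^sub>M sphere_prod d {..<d})"
  proof (rule measurable_compose[OF _ f])
    have "(\<lambda>p. (snd p, fst p)) \<in> measurable (leb {..<d} \<Otimes>\<^sub>M sphere_prod d {..<d}) (sphere_prod d {..<d} \<Otimes>\<^sub>M leb {..<d})"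
      by measurable
    from measurable_compose[OF this plane_height_measurable]
    show "(\<lambda>p. plane_height d (snd p) (fst p)) \<in> borel_measurable (leb {..<d} \<Otimes>\<^sub>M sphere_prod d {..<d})" by simp
  qed
  then have 1[measurable]: "(\<lambda>y. \<integral>\<^sup>+a. f (plane_height d a y) \<partial>sphere_prod d {..<d}) \<in> borel_measurable (leb {..<d})"
    by (intro S.borel_measurable_nn_integral) (simp add: case_prod_beta')
  note 2[measurable] = height_mean_measurable[OF d f]
  show ?thesis
  proof (rule L.density_unique[OF 1 2], rule measure_eqI)
    fix A assume "A \<in> sets (density (leb {..<d}) (\<lambda>y. \<integral>\<^sup>+a. f (plane_height d a y) \<partial>sphere_prod d {..<d}))"
    then have A[measurable]: "A \<in> sets (leb {..<d})" by simp
    show "emeasure (density (leb {..<d}) (\<lambda>y. \<integral>\<^sup>+a. f (plane_height d a y) \<partial>sphere_prod d {..<d})) A = emeasure (density (leb {..<d}) (height_mean d f)) A"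
      using disintegration[OF d f, of "indicator A"] by (simp add: emeasure_density 1 2)
  qed simp
qed

section \<open>From almost every right-hand side to the vector of ones\<close>

lemma srad_continuous: "continuous_on UNIV srad"
  unfolding srad_def[abs_def] by (intro continuous_intros)

lemma srad_tendsto: "(x \<longlongrightarrow> l) F \<Longrightarrow> ((\<lambda>n. srad (x n)) \<longlongrightarrow> srad l) F"
  using continuous_on_tendsto_compose[OF srad_continuous, of x l F] by simp

text \<open>Stated for sigma-finite factors because \<open>nu d\<close> is finite but not
  normalised.\<close>

lemma AE_PiM_component_sigma_finite:
  assumes "product_sigma_finite M" and I: "finite I" "i \<in> I" and P: "AE x in M i. P x"
  shows "AE z in Pi\<^sub>M I M. P (z i)"
proof -
  interpret product_sigma_finite M by fact
  obtain N where N: "{x \<in> space (M i). \<not> P x} \<subseteq> N" "N \<in> null_sets (M i)"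
    using P by (auto simp: eventually_ae_filter)
  have m: "(\<Pi>\<^sub>E j\<in>I. if j = i then N else space (M j)) \<in> sets (Pi\<^sub>M I M)"
    using I N by (intro sets_PiM_I_finite) auto
  have "emeasure (Pi\<^sub>M I M) (\<Pi>\<^sub>E j\<in>I. if j = i then N else space (M j)) =
    (\<Prod>j\<in>I. emeasure (M j) (if j = i then N else space (M j)))"
    by (rule emeasure_PiM) (use I N in auto)
  also have "\<dots> = 0" using I N by (intro prod_zero bexI[of _ i]) auto
  finally have "(\<Pi>\<^sub>E j\<in>I. if j = i then N else space (M j)) \<in> null_sets (Pi\<^sub>M I M)"
    using m by auto
  then show ?thesis
    by (rule AE_I') (use N I in \<open>auto simp: space_PiM PiE_def Pi_def\<close>)
qed

lemma normI_1_entry: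
  assumes "normI I z = 1" "finite I" "k \<in> I" shows "\<bar>z k\<bar> \<le> 1"
proof -
  have "z k * z k \<le> (\<Sum>k\<in>I. z k * z k)" using assms by (intro member_le_sum) auto
  also have "\<dots> = 1" using assms by (simp add: normI_def)
  finally have "(z k)\<^sup>2 \<le> 1" by (simp add: power2_eq_square)
  then show ?thesis by (simp add: abs_square_le_1)
qed

lemma AE_nu_entries:
  assumes d: "d \<ge> 4" "prob_space (uniform_sphere d)"
  shows "AE z in Pi\<^sub>M {..<d} (\<lambda>_. nu d). \<forall>i\<in>{..<d}. \<forall>k\<in>{1..<d}. \<bar>z i k\<bar> \<le> 1"
proof (rule AE_finite_allI)
  fix i assume i: "i \<in> {..<d}"
  have "product_sigma_finite (\<lambda>_::nat. nu d)"
    unfolding product_sigma_finite_def using finite_measure_nu[OF d] by (auto intro: finite_measure.axioms(1))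
  then have "AE z in Pi\<^sub>M {..<d} (\<lambda>_. nu d). normI {1..<d} (z i) = 1"
    by (rule AE_PiM_component_sigma_finite) (use i AE_nu[OF d(1)] in auto)
  then show "AE z in Pi\<^sub>M {..<d} (\<lambda>_. nu d). \<forall>k\<in>{1..<d}. \<bar>z i k\<bar> \<le> 1"
    by eventually_elim (auto intro: normI_1_entry)
qed simp

text \<open>Integrand of \<open>height_mean\<close> before the average over \<open>z\<close>, as a
  real function so that limits and bounds in \<open>y\<close> can be taken pointwise.\<close>

definition dker :: "nat \<Rightarrow> (real \<Rightarrow> real) \<Rightarrow> real \<Rightarrow> (nat \<Rightarrow> real) \<Rightarrow> (nat \<Rightarrow> nat \<Rightarrow> real) \<Rightarrow> real" where
  "dker d g v y z = g v * (\<Prod>i<d. srad (v * y i) ^ (d - 3)) *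
     \<bar>det_fun d (\<lambda>i k. if k = 0 then y i else srad (v * y i) * z i k)\<bar>"

lemma dker_measurable: "(\<lambda>z. dker d g v y z) \<in> borel_measurable (Pi\<^sub>M {..<d} (\<lambda>_. nu d))"
proof -
  have [measurable]: "(\<lambda>z. det_fun d (\<lambda>i k. if k = 0 then y i else srad (v * y i) * z i k)) \<in> borel_measurable (Pi\<^sub>M {..<d} (\<lambda>_. nu d))"
  proof (rule det_fun_measurable)
    fix i j assume ij: "i < d" "j < d"
    show "(\<lambda>z. if j = 0 then y i else srad (v * y i) * z i j) \<in> borel_measurable (Pi\<^sub>M {..<d} (\<lambda>_. nu d))"
    proof (cases "j = 0")
      case False
      note [measurable] = nu_entry_measurable[OF ij False]
      show ?thesis using False by simp
    qed simp
  qed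
  show ?thesis unfolding dker_def by measurable
qed

lemma dker_integral:
  assumes g: "g v \<ge> 0"
  shows "ennreal (g v) * (\<Prod>i<d. ennreal (srad (v * y i) ^ (d - 3))) * mean_abs_det d v y =
    (\<integral>\<^sup>+z. ennreal (dker d g v y z) \<partial>Pi\<^sub>M {..<d} (\<lambda>_. nu d))"
proof -
  have m: "(\<lambda>z. det_fun d (\<lambda>i k. if k = 0 then y i else srad (v * y i) * z i k)) \<in> borel_measurable (Pi\<^sub>M {..<d} (\<lambda>_. nu d))"
  proof (rule det_fun_measurable)
    fix i j assume ij: "i < d" "j < d"
    show "(\<lambda>z. if j = 0 then y i else srad (v * y i) * z i j) \<in> borel_measurable (Pi\<^sub>M {..<d} (\<lambda>_. nu d))"
    proof (cases "j = 0")
      case False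
      note [measurable] = nu_entry_measurable[OF ij False]
      show ?thesis using False by simp
    qed simp
  qed
  have p: "0 \<le> (\<Prod>i<d. srad (v * y i) ^ (d - 3))" by (intro prod_nonneg) (simp add: srad_nonneg)
  have "ennreal (g v) * (\<Prod>i<d. ennreal (srad (v * y i) ^ (d - 3))) = ennreal (g v * (\<Prod>i<d. srad (v * y i) ^ (d - 3)))"
    using g p by (subst prod_ennreal) (auto simp: srad_nonneg ennreal_mult)
  then show ?thesis
    unfolding mean_abs_det_def dker_def using g p m
    by (subst nn_integral_cmult[symmetric]) (auto simp: ennreal_mult)
qed

text \<open>The range [1/2, 2] for the entries of \<open>y\<close> makes the bound uniform: for v >
  2 already |v * y 0| >= 1, so the factor \<open>srad (v * y 0)\<close> vanishes; for smaller
  \<open>v\<close> all matrix entries are at most 2 in absolute value.\<close>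

lemma dker_bound:
  assumes g: "0 \<le> g v" "g v \<le> B" and d: "d \<ge> 4" and v: "v > 0"
    and y: "\<And>i. i < d \<Longrightarrow> 1 / 2 \<le> y i \<and> y i \<le> 2"
    and z: "\<forall>i\<in>{..<d}. \<forall>k\<in>{1..<d}. \<bar>z i k\<bar> \<le> 1"
  shows "dker d g v y z \<le> B * (fact d * 2 ^ d) * indicator {0..2} v"
proof (cases "v > 2")
  case True
  have "\<bar>v * y 0\<bar> \<ge> 1" using True y[of 0] d mult_mono[of 2 v "1/2" "y 0"] by auto
  then have "srad (v * y 0) = 0" by (rule srad_zero)
  then have 0: "(\<Prod>i<d. srad (v * y i) ^ (d - 3)) = 0"
    using d by (intro prod_zero bexI[of _ 0]) auto
  show ?thesis using True unfolding dker_def 0 by simp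
next
  case False
  have "(\<Prod>i<d. srad (v * y i) ^ (d - 3)) \<le> (\<Prod>i<d. 1)"
    by (intro prod_mono) (simp add: srad_nonneg srad_le_1 power_le_one)
  then have p: "0 \<le> (\<Prod>i<d. srad (v * y i) ^ (d - 3))" "(\<Prod>i<d. srad (v * y i) ^ (d - 3)) \<le> 1"
    by (auto intro!: prod_nonneg simp: srad_nonneg)
  have "\<bar>det_fun d (\<lambda>i k. if k = 0 then y i else srad (v * y i) * z i k)\<bar> \<le> fact d * 2 ^ d"
  proof (rule det_fun_bound)
    fix i k assume ik: "i < d" "k < d"
    show "\<bar>if k = 0 then y i else srad (v * y i) * z i k\<bar> \<le> 2"
    proof (cases "k = 0")
      case True
      then show ?thesis using y[OF ik(1)] by auto
    next
      case False
      then have "\<bar>z i k\<bar> \<le> 1" using z ik by auto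
      then have "\<bar>srad (v * y i)\<bar> * \<bar>z i k\<bar> \<le> 1 * 1"
        by (intro mult_mono) (auto simp: srad_nonneg srad_le_1)
      then show ?thesis using False by (simp add: abs_mult)
    qed
  qed simp
  then have "dker d g v y z \<le> B * 1 * (fact d * 2 ^ d)"
    unfolding dker_def using g p by (intro mult_mono) auto
  then show ?thesis using False v by simp
qed

lemma dker_tendsto:
  assumes "\<And>i. i < d \<Longrightarrow> (\<lambda>n. Y n i) \<longlonglongrightarrow> y i"
  shows "(\<lambda>n. dker d g v (Y n) z) \<longlonglongrightarrow> dker d g v y z"
  unfolding dker_def
proof (intro tendsto_mult tendsto_prod tendsto_rabs tendsto_const tendsto_power)
  fix i assume "i \<in> {..<d}"
  then show "(\<lambda>n. srad (v * Y n i)) \<longlonglongrightarrow> srad (v * y i)"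
    by (intro srad_tendsto tendsto_mult tendsto_const assms) simp
next
  show "(\<lambda>n. det_fun d (\<lambda>i k. if k = 0 then Y n i else srad (v * Y n i) * z i k)) \<longlonglongrightarrow>
    det_fun d (\<lambda>i k. if k = 0 then y i else srad (v * y i) * z i k)"
  proof (rule det_fun_tendsto)
    fix i j assume i: "i < d" "j < d"
    have "(\<lambda>n. srad (v * Y n i)) \<longlonglongrightarrow> srad (v * y i)"
      by (intro srad_tendsto tendsto_mult tendsto_const assms i)
    then show "(\<lambda>n. if j = 0 then Y n i else srad (v * Y n i) * z i j) \<longlonglongrightarrow> (if j = 0 then y i else srad (v * y i) * z i j)"
      using assms[OF i(1)] by (cases "j = 0") (auto intro!: tendsto_intros)
  qed
qed

text \<open>Every cube around the vector of ones has positive volume and so meets a set of full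
  measure. The radius 1 / (n + 2) is at most 1 / 2, which keeps the entries in the range required by
  \<open>dker_bound\<close>.\<close>

lemma exists_sequence_in_full_set:
  assumes P: "AE y in leb {..<d}. P y"
  shows "\<exists>Y. \<forall>n. Y n \<in> space (leb {..<d}) \<and> P (Y n) \<and> (\<forall>i<d. \<bar>Y n i - 1\<bar> \<le> 1 / (real n + 2))"
proof (rule choice, rule allI)
  fix n :: nat
  let ?A = "Pi\<^sub>E {..<d} (\<lambda>_. {1 - 1 / (real n + 2) .. 1 + 1 / (real n + 2)})"
  have "emeasure (leb {..<d}) ?A = (\<Prod>i<d. emeasure lborel {1 - 1 / (real n + 2) .. 1 + 1 / (real n + 2)})"
    by (rule leb.emeasure_PiM) auto
  also have "\<dots> = (\<Prod>i<d. ennreal (2 / (real n + 2)))"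
  proof (rule prod.cong)
    have e: "(1 + 1 / (real n + 2)) - (1 - 1 / (real n + 2)) = 2 / (real n + 2)" by simp
    show "emeasure lborel {1 - 1 / (real n + 2) .. 1 + 1 / (real n + 2)} = ennreal (2 / (real n + 2))"
      by (subst emeasure_lborel_Icc) (simp_all only: e, simp)
  qed simp
  also have "\<dots> = ennreal ((2 / (real n + 2)) ^ d)" by (subst prod_ennreal) auto
  also have "\<dots> > 0" by simp
  finally have pos: "emeasure (leb {..<d}) ?A > 0" .
  have A: "?A \<in> sets (leb {..<d})" by (intro sets_PiM_I_finite) auto
  have "\<exists>y\<in>?A. P y"
  proof (rule ccontr)
    assume "\<not> (\<exists>y\<in>?A. P y)"
    then have "AE y in leb {..<d}. y \<notin> ?A" using P by (auto elim!: eventually_mono)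
    then have "emeasure (leb {..<d}) ?A = 0"
      using AE_iff_measurable[OF A, of "\<lambda>y. y \<notin> ?A"] sets.sets_into_space[OF A] by auto
    then show False using pos by simp
  qed
  then obtain y where y: "y \<in> ?A" "P y" by auto
  then have "y \<in> space (leb {..<d})" by (auto simp: space_PiM PiE_def)
  moreover have "\<bar>y i - 1\<bar> \<le> 1 / (real n + 2)" if "i < d" for i
    using PiE_mem[OF y(1), of i] that by (auto simp: abs_le_iff)
  ultimately show "\<exists>y. y \<in> space (leb {..<d}) \<and> P y \<and> (\<forall>i<d. \<bar>y i - 1\<bar> \<le> 1 / (real n + 2))"
    using y by blast
qed

definition ones :: "nat \<Rightarrow> nat \<Rightarrow> real" where "ones d = (\<lambda>i\<in>{..<d}. 1)"

lemma ones_space: "ones d \<in> space (leb {..<d})"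
  by (simp add: ones_def space_PiM)

lemma plane_height_measurable_fixed:
  assumes "y \<in> space (leb {..<d})"
  shows "(\<lambda>a. plane_height d a y) \<in> borel_measurable (sphere_prod d {..<d})"
  using measurable_compose[OF measurable_Pair2'[OF assms] plane_height_measurable] by simp

lemma cramer_sol_ones_normI_pos:
  assumes "det_fun d a \<noteq> 0" "0 < d"
  shows "normI {..<d} (cramer_sol d a (ones d)) > 0"
proof (rule ccontr)
  assume "\<not> ?thesis"
  then have "normI {..<d} (cramer_sol d a (ones d)) = 0"
    using normI_nonneg[of "{..<d}" "cramer_sol d a (ones d)"] by simp
  then have "(\<Sum>k<d. cramer_sol d a (ones d) k * cramer_sol d a (ones d) k) = 0" by (simp add: normI_def)
  then have z: "\<forall>k<d. cramer_sol d a (ones d) k = 0" by (subst (asm) sum_nonneg_eq_0_iff) auto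
  have "(\<Sum>j<d. a 0 j * cramer_sol d a (ones d) j) = ones d 0" by (rule cramer_sol_solves[OF assms])
  moreover have "(\<Sum>j<d. a 0 j * cramer_sol d a (ones d) j) = 0" using z by (intro sum.neutral) auto
  ultimately show False using assms(2) by (simp add: ones_def)
qed

lemma plane_height_tendsto:
  assumes det: "det_fun d a \<noteq> 0" and d: "0 < d" and Y: "\<And>i. i < d \<Longrightarrow> (\<lambda>n. Y n i) \<longlonglongrightarrow> 1"
  shows "(\<lambda>n. plane_height d a (Y n)) \<longlonglongrightarrow> plane_height d a (ones d)"
proof -
  have s: "(\<lambda>n. cramer_sol d a (Y n) j) \<longlonglongrightarrow> cramer_sol d a (ones d) j" if j: "j < d" for j
  proof -
    have "(\<lambda>n. det_fun d (\<lambda>i k. if k = j then Y n i else a i k)) \<longlonglongrightarrow> det_fun d (\<lambda>i k. if k = j then ones d i else a i k)"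
    proof (rule det_fun_tendsto)
      fix i k assume "i < d" "k < d"
      then show "(\<lambda>n. if k = j then Y n i else a i k) \<longlonglongrightarrow> (if k = j then ones d i else a i k)"
        using Y[of i] by (cases "k = j") (auto simp: ones_def)
    qed
    then show ?thesis using det j by (simp add: cramer_sol_def tendsto_divide)
  qed
  have "(\<lambda>n. normI {..<d} (cramer_sol d a (Y n))) \<longlonglongrightarrow> normI {..<d} (cramer_sol d a (ones d))"
    unfolding normI_def by (intro tendsto_real_sqrt tendsto_sum tendsto_mult s) auto
  then show ?thesis
    unfolding plane_height_def using cramer_sol_ones_normI_pos[OF det d] by (intro tendsto_divide tendsto_const) auto
qed

lemma finite_PiM_nu:
  assumes d: "d \<ge> 4" "prob_space (uniform_sphere d)"
  shows "emeasure (Pi\<^sub>M {..<d} (\<lambda>_. nu d)) (space (Pi\<^sub>M {..<d} (\<lambda>_. nu d))) < \<infinity>"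
proof -
  interpret N: finite_measure "nu d" by (rule finite_measure_nu[OF d])
  interpret product_sigma_finite "\<lambda>_::nat. nu d"
    unfolding product_sigma_finite_def by (simp add: N.sigma_finite_measure_axioms)
  have "emeasure (Pi\<^sub>M {..<d} (\<lambda>_. nu d)) (space (Pi\<^sub>M {..<d} (\<lambda>_. nu d))) = (\<Prod>i<d. emeasure (nu d) (space (nu d)))"
    unfolding space_PiM by (rule emeasure_PiM) (simp, rule sets.top)
  also have "\<dots> < \<infinity>"
  proof -
    have "emeasure (nu d) (space (nu d)) < \<top>" using N.emeasure_finite[of "space (nu d)"]
      unfolding infinity_ennreal_def less_top .
    then show ?thesis by (simp add: power_less_top_ennreal)
  qed
  finally show ?thesis .
qed

text \<open>Both sides converge along a sequence \<open>Y\<close> of good right-hand sides that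
  tends to \<open>ones d\<close>. On the left the bounded continuous \<open>g\<close> and the
  convergence of \<open>plane_height\<close> give dominated convergence over \<open>a\<close>; on
  the right dominated convergence is applied first in \<open>z\<close>, then in
  \<open>v\<close>.\<close>

lemma disintegration_at_ones:
  fixes g :: "real \<Rightarrow> real"
  assumes d: "d \<ge> 4" "prob_space (uniform_sphere d)"
    and g: "continuous_on UNIV g" "\<And>x. 0 \<le> g x" "\<And>x. g x \<le> B"
  shows "(\<integral>\<^sup>+a. ennreal (g (plane_height d a (ones d))) \<partial>sphere_prod d {..<d}) = height_mean d (\<lambda>x. ennreal (g x)) (ones d)"
proof -
  interpret S: prob_space "sphere_prod d {..<d}" by (rule prob_space_sphere_prod[OF d(2)])
  have gm[measurable]: "g \<in> borel_measurable borel" by (rule borel_measurable_continuous_onI[OF g(1)])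
  have B: "B \<ge> 0" using g(2,3)[of 0] by linarith
  let ?f = "\<lambda>x. ennreal (g x)"
  let ?N = "Pi\<^sub>M {..<d} (\<lambda>_. nu d)"
  obtain Y where Y: "\<And>n. Y n \<in> space (leb {..<d})"
      "\<And>n. (\<integral>\<^sup>+a. ?f (plane_height d a (Y n)) \<partial>sphere_prod d {..<d}) = height_mean d ?f (Y n)"
      "\<And>n i. i < d \<Longrightarrow> \<bar>Y n i - 1\<bar> \<le> 1 / (real n + 2)"
    using exists_sequence_in_full_set[OF AE_disintegration[OF d, of ?f]] by auto
  have lim: "(\<lambda>n. Y n i) \<longlonglongrightarrow> 1" if i: "i < d" for i
  proof -
    have "(\<lambda>n. 1 / (real n + 2)) \<longlonglongrightarrow> 0" by real_asymp
    then have "(\<lambda>n. Y n i - 1) \<longlonglongrightarrow> 0"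
      by (rule Lim_null_comparison[rotated]) (use Y(3)[OF i] in auto)
    then show ?thesis by (simp add: LIM_zero_iff)
  qed
  have range: "1 / 2 \<le> Y n i \<and> Y n i \<le> 2" if "i < d" for n i
  proof -
    have "1 / (real n + 2) \<le> 1 / 2" by (simp add: field_simps)
    then have "\<bar>Y n i - 1\<bar> \<le> 1 / 2" using Y(3)[OF that, of n] by linarith
    then show ?thesis by linarith
  qed
  have "(\<lambda>n. \<integral>\<^sup>+a. ?f (plane_height d a (Y n)) \<partial>sphere_prod d {..<d}) \<longlonglongrightarrow> (\<integral>\<^sup>+a. ?f (plane_height d a (ones d)) \<partial>sphere_prod d {..<d})"
  proof (rule nn_integral_dominated_convergence[where w = "\<lambda>_. ennreal B"])
    show "(\<lambda>a. ?f (plane_height d a (Y n))) \<in> borel_measurable (sphere_prod d {..<d})" for n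
      using plane_height_measurable_fixed[OF Y(1)] by measurable
    show "(\<lambda>a. ?f (plane_height d a (ones d))) \<in> borel_measurable (sphere_prod d {..<d})"
      using plane_height_measurable_fixed[OF ones_space] by measurable
    show "AE a in sphere_prod d {..<d}. ?f (plane_height d a (Y n)) \<le> ennreal B" for n
      using g by (auto intro!: ennreal_leI)
    show "AE a in sphere_prod d {..<d}. (\<lambda>n. ?f (plane_height d a (Y n))) \<longlonglongrightarrow> ?f (plane_height d a (ones d))"
      using AE_leading_minors[OF d(2)]
    proof eventually_elim
      case (elim a)
      then have det: "det_fun d a \<noteq> 0" using lead_full[of d a] by auto
      have "(\<lambda>n. plane_height d a (Y n)) \<longlonglongrightarrow> plane_height d a (ones d)"
        by (rule plane_height_tendsto[OF det _ lim]) (use d in auto)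
      then have "(\<lambda>n. g (plane_height d a (Y n))) \<longlonglongrightarrow> g (plane_height d a (ones d))"
        by (rule continuous_on_tendsto_compose[OF g(1)]) auto
      then show ?case by (rule tendsto_ennrealI)
    qed
  qed (auto simp: S.emeasure_space_1)
  moreover have "(\<lambda>n. height_mean d ?f (Y n)) \<longlonglongrightarrow> height_mean d ?f (ones d)"
  proof -
    have mass: "emeasure (cone (- 1) {..<d}) (space (cone (- 1) {..<d})) < \<top>"
    proof -
      interpret C: finite_measure "cone (- 1) {..<d}"
        by (rule finite_measure_cone) (use d in \<open>auto simp: lessThan_empty_iff\<close>)
      show ?thesis using C.emeasure_finite by (simp only: less_top[symmetric] not_False_eq_True)
    qed
    have eq: "?f v * (\<Prod>i<d. ennreal (srad (v * y i) ^ (d - 3))) * mean_abs_det d v y = (\<integral>\<^sup>+z. ennreal (dker d g v y z) \<partial>?N)" for v y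
      by (rule dker_integral) (rule g(2))
    \<comment> \<open>Pointwise bound of \<open>dker\<close> times the finite mass of the product of
      the \<open>nu d\<close>; with the indicator of \<open>{0..2}\<close> it dominates the
      integrand in \<open>v\<close>.\<close>
    define E where "E = ennreal (B * (fact d * 2 ^ d)) * emeasure ?N (space ?N)"
    have E: "E < \<infinity>" unfolding E_def using finite_PiM_nu[OF d] by (simp add: ennreal_mult_less_top)
    have ae: "AE z in ?N. ennreal (dker d g v (Y n) z) \<le> ennreal (B * (fact d * 2 ^ d) * indicator {0..2} v)" if "v > 0" for v n
      using AE_nu_entries[OF d]
      by eventually_elim (intro ennreal_leI dker_bound, use g d that range in auto)
    have inner: "(\<lambda>n. \<integral>\<^sup>+z. ennreal (dker d g v (Y n) z) \<partial>?N) \<longlonglongrightarrow> (\<integral>\<^sup>+z. ennreal (dker d g v (ones d) z) \<partial>?N)" if v: "v > 0" for v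
    proof (rule nn_integral_dominated_convergence[where w = "\<lambda>_. ennreal (B * (fact d * 2 ^ d) * indicator {0..2} v)"])
      show "(\<lambda>z. ennreal (dker d g v (Y n) z)) \<in> borel_measurable ?N" for n
        using dker_measurable[of d g v "Y n"] by measurable
      show "(\<lambda>z. ennreal (dker d g v (ones d) z)) \<in> borel_measurable ?N"
        using dker_measurable[of d g v "ones d"] by measurable
      show "(\<integral>\<^sup>+z. ennreal (B * (fact d * 2 ^ d) * indicator {0..2} v) \<partial>?N) < \<infinity>"
        using finite_PiM_nu[OF d] by (simp add: ennreal_mult_less_top)
      show "AE z in ?N. (\<lambda>n. ennreal (dker d g v (Y n) z)) \<longlonglongrightarrow> ennreal (dker d g v (ones d) z)"
        by (intro always_eventually allI tendsto_ennrealI dker_tendsto) (use lim in \<open>simp add: ones_def\<close>)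
    qed (use ae[OF v] in auto)
    have meas: "(\<lambda>v. (\<integral>\<^sup>+z. ennreal (dker d g v y z) \<partial>?N) * indicator {0<..} v) \<in> borel_measurable lborel"
      if y: "y \<in> space (leb {..<d})" for y
    proof -
      have [measurable]: "(\<lambda>v. mean_abs_det d v y) \<in> borel_measurable borel"
        by (rule mean_abs_det_measurable[OF d]) (use y in auto)
      have [measurable]: "(\<lambda>v. \<Prod>i<d. ennreal (srad (v * y i) ^ (d - 3))) \<in> borel_measurable borel"
        by (rule srad_prod_measurable) (use y in auto)
      show ?thesis unfolding eq[symmetric] by measurable
    qed
    have "(\<lambda>n. \<integral>\<^sup>+v. (\<integral>\<^sup>+z. ennreal (dker d g v (Y n) z) \<partial>?N) * indicator {0<..} v \<partial>lborel) \<longlonglongrightarrow>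
        (\<integral>\<^sup>+v. (\<integral>\<^sup>+z. ennreal (dker d g v (ones d) z) \<partial>?N) * indicator {0<..} v \<partial>lborel)"
    proof (rule nn_integral_dominated_convergence[where w = "\<lambda>v. E * indicator {0..2} v"])
      show "(\<lambda>v. (\<integral>\<^sup>+z. ennreal (dker d g v (Y n) z) \<partial>?N) * indicator {0<..} v) \<in> borel_measurable lborel" for n
        by (rule meas[OF Y(1)])
      show "(\<lambda>v. (\<integral>\<^sup>+z. ennreal (dker d g v (ones d) z) \<partial>?N) * indicator {0<..} v) \<in> borel_measurable lborel"
        by (rule meas[OF ones_space])
      show "(\<lambda>v. E * indicator {0..2::real} v) \<in> borel_measurable lborel" by measurable
      show "(\<integral>\<^sup>+v. E * indicator {0..2::real} v \<partial>lborel) < \<infinity>"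
        using E by (subst nn_integral_cmult_indicator) (auto simp: ennreal_mult_less_top)
      have "(\<integral>\<^sup>+z. ennreal (dker d g v (Y n) z) \<partial>?N) * indicator {0<..} v \<le> E * indicator {0..2} v" for n v
      proof (cases "v > 0")
        case v: True
        have "(\<integral>\<^sup>+z. ennreal (dker d g v (Y n) z) \<partial>?N) \<le> (\<integral>\<^sup>+z. ennreal (B * (fact d * 2 ^ d) * indicator {0..2} v) \<partial>?N)"
          by (rule nn_integral_mono_AE[OF ae[OF v]])
        also have "\<dots> = E * indicator {0..2} v" by (simp add: E_def indicator_def)
        finally show ?thesis using v by simp
      qed simp
      then show "AE v in lborel. (\<integral>\<^sup>+z. ennreal (dker d g v (Y n) z) \<partial>?N) * indicator {0<..} v \<le> E * indicator {0..2} v" for n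
        by simp
      have "(\<lambda>n. (\<integral>\<^sup>+z. ennreal (dker d g v (Y n) z) \<partial>?N) * indicator {0<..} v) \<longlonglongrightarrow>
          (\<integral>\<^sup>+z. ennreal (dker d g v (ones d) z) \<partial>?N) * indicator {0<..} v" for v
        using inner[of v] by (cases "v > 0") auto
      then show "AE v in lborel. (\<lambda>n. (\<integral>\<^sup>+z. ennreal (dker d g v (Y n) z) \<partial>?N) * indicator {0<..} v) \<longlonglongrightarrow>
          (\<integral>\<^sup>+z. ennreal (dker d g v (ones d) z) \<partial>?N) * indicator {0<..} v" by simp
    qed
    then show ?thesis
      unfolding height_mean_def eq by (rule ennreal_tendsto_cmult[OF mass])
  qed
  ultimately show ?thesis unfolding Y(2) by (rule LIMSEQ_unique)
qed

text \<open>The exponent is the \<open>d\<^sup>2 - 2 d - 1\<close> of the spherical Blaschke-Petkantschin formula.\<close>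

definition hexp :: "nat \<Rightarrow> nat" where "hexp d = d * (d - 3) + (d - 1)"

text \<open>At the vector of ones all \<open>d\<close> slice heights equal \<open>v\<close>. The
  weights give the exponent \<open>d * (d - 3)\<close>, and each of the \<open>d - 1\<close> columns
  after the first releases one factor \<open>srad v\<close> from the determinant; what remains of
  the determinant has a mean that does not depend on \<open>v\<close> and goes into
  \<open>C\<close>.\<close>

lemma height_law:
  assumes d: "d \<ge> 4" "prob_space (uniform_sphere d)"
  obtains C where "\<And>g B. continuous_on UNIV g \<Longrightarrow> (\<And>x. 0 \<le> g x) \<Longrightarrow> (\<And>x. g x \<le> (B::real)) \<Longrightarrow>
    (\<integral>\<^sup>+a. ennreal (g (plane_height d a (ones d))) \<partial>sphere_prod d {..<d}) =
      C * (\<integral>\<^sup>+v. ennreal (g v * srad v ^ hexp d) * indicator {0<..} v \<partial>lborel)"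
proof
  let ?N = "Pi\<^sub>M {..<d} (\<lambda>_. nu d)"
  let ?E = "\<integral>\<^sup>+z. ennreal \<bar>det_fun d (\<lambda>i k. if k = 0 then 1 else z i k)\<bar> \<partial>?N"
  let ?m = "emeasure (cone (- 1) {..<d}) (space (cone (- 1) {..<d}))"
  fix g :: "real \<Rightarrow> real" and B
  assume g: "continuous_on UNIV g" "\<And>x. 0 \<le> g x" "\<And>x. g x \<le> B"
  have gm[measurable]: "g \<in> borel_measurable borel" by (rule borel_measurable_continuous_onI[OF g(1)])
  have EE1: "mean_abs_det d v (ones d) = ennreal (srad v ^ (d - 1)) * ?E" for v
  proof -
    have det: "det_fun d (\<lambda>i k. if k = 0 then ones d i else srad (v * ones d i) * z i k) =
      srad v ^ (d - 1) * det_fun d (\<lambda>i k. if k = 0 then 1 else z i k)" for z :: "nat \<Rightarrow> nat \<Rightarrow> real"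
    proof -
      have "det_fun d (\<lambda>i k. if k = 0 then ones d i else srad (v * ones d i) * z i k) =
        det_fun d (\<lambda>i j. (if j = 0 then 1 else srad v) * (if j = 0 then 1 else z i j))"
        by (rule det_fun_cong) (auto simp: ones_def)
      also have "\<dots> = (\<Prod>j<d. if j = 0 then 1 else srad v) * det_fun d (\<lambda>i j. if j = 0 then 1 else z i j)"
        by (rule det_fun_scale_columns)
      also have "(\<Prod>j<d. if j = 0 then 1 else srad v) = (\<Prod>j\<in>{..<d} - {0}. srad v)"
        using d by (subst prod.remove[of _ 0]) auto
      also have "\<dots> = srad v ^ (d - 1)" using d by (simp add: card_Diff_singleton)
      finally show ?thesis .
    qed
    have m: "(\<lambda>z. det_fun d (\<lambda>i k. if k = 0 then 1 else z i k)) \<in> borel_measurable ?N"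
    proof (rule det_fun_measurable)
      fix i j assume ij: "i < d" "j < d"
      show "(\<lambda>z. if j = 0 then 1 else z i j) \<in> borel_measurable ?N"
        using nu_entry_measurable[OF ij] by (cases "j = 0") auto
    qed
    show ?thesis
      unfolding mean_abs_det_def det using m
      by (subst nn_integral_cmult[symmetric]) (auto simp: abs_mult ennreal_mult srad_nonneg)
  qed
  have "(\<integral>\<^sup>+a. ennreal (g (plane_height d a (ones d))) \<partial>sphere_prod d {..<d}) = height_mean d (\<lambda>x. ennreal (g x)) (ones d)"
    by (rule disintegration_at_ones[OF d g])
  also have "\<dots> = ?m * (\<integral>\<^sup>+v. ?E * (ennreal (g v * srad v ^ hexp d) * indicator {0<..} v) \<partial>lborel)"
    unfolding height_mean_def EE1
  proof (rule arg_cong[where f = "\<lambda>t. ?m * t"], rule nn_integral_cong)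
    fix v :: real
    have "(\<Prod>i<d. ennreal (srad (v * ones d i) ^ (d - 3))) = (\<Prod>i<d. ennreal (srad v ^ (d - 3)))"
      by (rule prod.cong) (auto simp: ones_def)
    also have "\<dots> = ennreal (srad v ^ (d * (d - 3)))"
      by (subst prod_ennreal) (simp_all add: srad_nonneg power_mult[symmetric] mult.commute)
    finally have p: "(\<Prod>i<d. ennreal (srad (v * ones d i) ^ (d - 3))) = ennreal (srad v ^ (d * (d - 3)))" .
    have "ennreal (g v * srad v ^ hexp d) = ennreal (g v) * (ennreal (srad v ^ (d * (d - 3))) * ennreal (srad v ^ (d - 1)))"
      using g(2) by (simp add: hexp_def power_add ennreal_mult srad_nonneg)
    then show "ennreal (g v) * (\<Prod>i<d. ennreal (srad (v * ones d i) ^ (d - 3))) * (ennreal (srad v ^ (d - 1)) * ?E) * indicator {0<..} v =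
      ?E * (ennreal (g v * srad v ^ hexp d) * indicator {0<..} v)"
      unfolding p by (simp only: mult_ac)
  qed
  also have "\<dots> = ?m * (?E * (\<integral>\<^sup>+v. ennreal (g v * srad v ^ hexp d) * indicator {0<..} v \<partial>lborel))"
    by (subst nn_integral_cmult) measurable
  finally show "(\<integral>\<^sup>+a. ennreal (g (plane_height d a (ones d))) \<partial>sphere_prod d {..<d}) =
      (?m * ?E) * (\<integral>\<^sup>+v. ennreal (g v * srad v ^ hexp d) * indicator {0<..} v \<partial>lborel)"
    by (simp only: mult.assoc)
qed

subsection \<open>Half-spaces and the joint law\<close>

text \<open>Normalising constant of the density \<open>srad t ^ (d - 3)\<close> of one coordinate of
  a uniform point of the sphere.\<close>

definition coord_mass :: "nat \<Rightarrow> real" where "coord_mass d = (LBINT t. srad t ^ (d - 3))"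

definition coord_cdf :: "nat \<Rightarrow> real \<Rightarrow> real" where
  "coord_cdf d h = (LBINT t. indicator {..h} t * srad t ^ (d - 3)) / coord_mass d"

lemma srad_power_le: "srad t ^ m \<le> 1"
  by (simp add: srad_nonneg srad_le_1 power_le_one)

lemma srad_power_le_indicator: "0 < m \<Longrightarrow> srad t ^ m \<le> indicator {-1..1} t"
  using srad_power_le[of t m] srad_zero[of t] by (cases "\<bar>t\<bar> \<le> 1") (auto simp: indicator_def abs_le_iff zero_power)

lemma integrable_srad_bounded:
  assumes m: "0 < m" and f[measurable]: "f \<in> borel_measurable borel" and b: "\<And>t. \<bar>f t\<bar> \<le> (B::real)"
  shows "integrable lborel (\<lambda>t. f t * srad t ^ m)"
proof (rule Bochner_Integration.integrable_bound)
  show "integrable lborel (\<lambda>t. B * indicator {-1..1::real} t)" by simp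
  show "AE t in lborel. norm (f t * srad t ^ m) \<le> norm (B * indicator {-1..1} t)"
  proof (rule AE_I2)
    fix t
    have B: "0 \<le> B" using b[of 0] by linarith
    have "\<bar>f t\<bar> * srad t ^ m \<le> B * indicator {-1..1} t"
      using b[of t] B srad_power_le_indicator[OF m, of t] by (intro mult_mono) (auto simp: srad_nonneg)
    then show "norm (f t * srad t ^ m) \<le> norm (B * indicator {-1..1} t)"
      using B by (simp add: abs_mult srad_nonneg)
  qed
qed measurable

lemma integrable_srad: "0 < m \<Longrightarrow> integrable lborel (\<lambda>t. srad t ^ m)"
  using integrable_srad_bounded[of m "\<lambda>_. 1" 1] by simp

lemma integral_srad_pos: assumes m: "0 < m" shows "0 < (LBINT t. indicator {0<..} t * srad t ^ m)"
proof -
  have "srad (1/2) ^ m * (1/2) = (LBINT t. srad (1/2) ^ m * indicator {0<..1/2::real} t)" by simp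
  also have "\<dots> \<le> (LBINT t. indicator {0<..} t * srad t ^ m)"
  proof (rule integral_mono)
    show "integrable lborel (\<lambda>t. indicator {0<..} t * srad t ^ m)"
      by (rule integrable_srad_bounded[OF m, of _ 1]) auto
    fix t :: real
    show "srad (1 / 2) ^ m * indicator {0<..1 / 2} t \<le> indicator {0<..} t * srad t ^ m"
    proof (cases "t \<in> {0<..1/2}")
      case True
      then have "t\<^sup>2 \<le> (1/2)\<^sup>2" by (intro power_mono) auto
      then have "srad (1/2) \<le> srad t" by (simp add: srad_def)
      then show ?thesis using True by (simp add: power_mono srad_nonneg)
    qed (auto simp: srad_nonneg indicator_def)
  next
    have "emeasure lborel {0<..1/2::real} < \<infinity>"
      using ennreal_less_top[of "1/2"] by (subst emeasure_lborel_Ioc) auto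
    then show "integrable lborel (\<lambda>t. srad (1/2) ^ m * indicator {0<..1/2::real} t)"
      by (intro integrable_mult_right integrable_real_indicator) auto
  qed
  finally have "srad (1/2) ^ m * (1/2) \<le> (LBINT t. indicator {0<..} t * srad t ^ m)" .
  moreover have "srad (1/2) > 0" by (simp add: srad_def power2_eq_square)
  then have "srad (1/2) ^ m * (1/2) > 0" by simp
  ultimately show ?thesis by linarith
qed

lemma coord_mass_pos: assumes "d \<ge> 4" shows "coord_mass d > 0"
proof -
  have "0 < (LBINT t. indicator {0<..} t * srad t ^ (d - 3))" by (rule integral_srad_pos) (use assms in simp)
  also have "\<dots> \<le> coord_mass d"
    unfolding coord_mass_def
    by (rule integral_mono[OF integrable_srad_bounded[of _ _ 1] integrable_srad])
      (use assms in \<open>auto simp: indicator_def srad_nonneg\<close>)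
  finally show ?thesis .
qed

text \<open>The density is at most 1 before normalisation, so the distribution function is
  Lipschitz; the two bounds supply its monotonicity and its continuity.\<close>

lemma coord_cdf_diff:
  assumes d: "d \<ge> 4" and ab: "a \<le> b"
  shows "0 \<le> coord_cdf d b - coord_cdf d a" "coord_cdf d b - coord_cdf d a \<le> (b - a) / coord_mass d"
proof -
  have int: "integrable lborel (\<lambda>t. indicator A t * srad t ^ (d - 3))" if "A \<in> sets borel" for A :: "real set"
    by (rule integrable_srad_bounded[of _ _ 1]) (use d that in auto)
  have "coord_cdf d b - coord_cdf d a = (LBINT t. indicator {..b} t * srad t ^ (d - 3) - indicator {..a} t * srad t ^ (d - 3)) / coord_mass d"
    unfolding coord_cdf_def by (subst Bochner_Integration.integral_diff) (auto intro!: int simp: diff_divide_distrib)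
  also have "(\<lambda>t. indicator {..b} t * srad t ^ (d - 3) - indicator {..a} t * srad t ^ (d - 3)) = (\<lambda>t. indicator {a<..b} t * srad t ^ (d - 3))"
    using ab by (auto simp: fun_eq_iff indicator_def)
  finally have eq: "coord_cdf d b - coord_cdf d a = (LBINT t. indicator {a<..b} t * srad t ^ (d - 3)) / coord_mass d" .
  have "(LBINT t. indicator {a<..b} t * srad t ^ (d - 3)) \<le> (LBINT t. indicator {a<..b} t)"
  proof (rule integral_mono[OF int])
    show "integrable lborel (indicator {a<..b} :: real \<Rightarrow> real)"
      by (rule integrable_real_indicator) (use ab in auto)
    show "indicator {a<..b} t * srad t ^ (d - 3) \<le> indicator {a<..b} t" for t
      by (auto simp: indicator_def srad_power_le)
  qed simp
  also have "\<dots> = b - a" using ab by simp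
  finally show "coord_cdf d b - coord_cdf d a \<le> (b - a) / coord_mass d"
    unfolding eq using coord_mass_pos[OF d] by (simp add: divide_right_mono)
  have "0 \<le> (LBINT t. indicator {a<..b} t * srad t ^ (d - 3))"
    by (rule integral_nonneg_AE) (auto simp: srad_nonneg)
  then show "0 \<le> coord_cdf d b - coord_cdf d a"
    unfolding eq using coord_mass_pos[OF d] by simp
qed

lemma coord_cdf_continuous: assumes d: "d \<ge> 4" shows "continuous_on UNIV (coord_cdf d)"
proof -
  have le: "\<bar>coord_cdf d x - coord_cdf d y\<bar> \<le> (1 / coord_mass d) * \<bar>x - y\<bar>" for x y
    using coord_cdf_diff[OF d, of x y] coord_cdf_diff[OF d, of y x] by (cases "x \<le> y") auto
  have "(1 / coord_mass d)-lipschitz_on UNIV (coord_cdf d)"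
    using le coord_mass_pos[OF d] by (intro lipschitz_onI) (auto simp: dist_real_def)
  then show ?thesis by (rule lipschitz_on_continuous_on)
qed

lemma coord_cdf_nonneg: "d \<ge> 4 \<Longrightarrow> 0 \<le> coord_cdf d h"
  unfolding coord_cdf_def using coord_mass_pos[of d]
  by (intro divide_nonneg_pos integral_nonneg_AE) (auto simp: srad_nonneg)

lemma coord_cdf_le_1: assumes d: "d \<ge> 4" shows "coord_cdf d h \<le> 1"
proof -
  have "(LBINT t. indicator {..h} t * srad t ^ (d - 3)) \<le> coord_mass d"
    unfolding coord_mass_def
    by (rule integral_mono[OF integrable_srad_bounded[of _ _ 1] integrable_srad])
      (use d in \<open>auto simp: indicator_def srad_nonneg\<close>)
  then show ?thesis unfolding coord_cdf_def using coord_mass_pos[OF d] by simp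
qed

lemma srad_minus: "srad (- t) = srad t" by (simp add: srad_def)

lemma coord_cdf_minus: assumes d: "d \<ge> 4"
  shows "coord_cdf d (- h) = (LBINT t. indicator {h..} t * srad t ^ (d - 3)) / coord_mass d"
proof -
  have "(LBINT t. indicator {..- h} t * srad t ^ (d - 3)) = (LBINT t. indicator {..- h} (- t) * srad (- t) ^ (d - 3))"
    using lborel_integral_real_affine[of "-1" "\<lambda>t. indicator {..- h} t * srad t ^ (d - 3)" 0] by simp
  also have "\<dots> = (LBINT t. indicator {h..} t * srad t ^ (d - 3))"
    by (rule Bochner_Integration.integral_cong) (auto simp: srad_minus indicator_def)
  finally show ?thesis by (simp add: coord_cdf_def)
qed

text \<open>Single points are null, so open and closed half-spaces have the same mass. Facet events
  are bounded from outside with closed and from inside with open half-spaces.\<close>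

lemma coord_cdf_strict:
  "(LBINT t. indicator {..<h} t * srad t ^ (d - 3)) / coord_mass d = coord_cdf d h"
proof -
  have "AE t in lborel. t \<noteq> h" by (rule AE_lborel_singleton)
  then have "(LBINT t. indicator {..<h} t * srad t ^ (d - 3)) = (LBINT t. indicator {..h} t * srad t ^ (d - 3))"
    by (intro integral_cong_AE) (auto elim!: eventually_mono simp: indicator_def)
  then show ?thesis by (simp add: coord_cdf_def)
qed

text \<open>The slice formula for the constant 1 determines the mass, which turns unnormalised slice
  integrals into values of \<open>coord_cdf\<close>.\<close>

lemma nu_mass:
  assumes d: "d \<ge> 4" "prob_space (uniform_sphere d)"
  shows "emeasure (nu d) (space (nu d)) = ennreal (1 / coord_mass d)"
proof -
  interpret P: prob_space "uniform_sphere d" by fact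
  have "1 = (\<integral>\<^sup>+x. 1 \<partial>uniform_sphere d)" by (simp add: P.emeasure_space_1)
  also have "\<dots> = (\<integral>\<^sup>+t. ennreal (srad t ^ (d - 3)) * emeasure (nu d) (space (nu d)) \<partial>lborel)"
    by (subst uniform_sphere_slice[OF d(1), where u = undefined]) auto
  also have "\<dots> = (\<integral>\<^sup>+t. ennreal (srad t ^ (d - 3)) \<partial>lborel) * emeasure (nu d) (space (nu d))"
    by (rule nn_integral_multc) measurable
  also have "(\<integral>\<^sup>+t. ennreal (srad t ^ (d - 3)) \<partial>lborel) = ennreal (coord_mass d)"
    unfolding coord_mass_def by (rule nn_integral_eq_integral) (use d in \<open>auto intro: integrable_srad simp: srad_nonneg\<close>)
  finally have 1: "1 = ennreal (coord_mass d) * emeasure (nu d) (space (nu d))" .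
  have "ennreal (1 / coord_mass d) = ennreal (1 / coord_mass d) * (ennreal (coord_mass d) * emeasure (nu d) (space (nu d)))"
    using 1 by simp
  also have "\<dots> = (ennreal (1 / coord_mass d) * ennreal (coord_mass d)) * emeasure (nu d) (space (nu d))"
    by (simp only: mult.assoc)
  also have "ennreal (1 / coord_mass d) * ennreal (coord_mass d) = 1"
    using coord_mass_pos[OF d(1)] by (simp flip: ennreal_mult)
  finally show ?thesis by simp
qed

text \<open>Slicing orthogonally to \<open>w\<close> turns <x, w> into |w| * t, so the event is read
  off one coordinate. A general \<open>Q\<close> covers the three half-spaces used below.\<close>

lemma halfspace_measure:
  assumes d: "d \<ge> 4" "prob_space (uniform_sphere d)"
    and w: "w \<in> space (leb {..<d})" "normI {..<d} w > 0" and Q[measurable]: "Q \<in> sets borel"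
  shows "(\<integral>\<^sup>+x. indicator Q (\<Sum>j<d. x j * w j) \<partial>uniform_sphere d) =
    ennreal ((LBINT t. indicator {t. normI {..<d} w * t \<in> Q} t * srad t ^ (d - 3)) / coord_mass d)"
proof -
  define R where "R = normI {..<d} w"
  define u where "u = dirI {..<d} w"
  have R: "R > 0" using w by (simp add: R_def)
  have u: "u \<in> sphere_Rd d"
    using normI_dirI[of "{..<d}" w] w by (simp add: sphere_Rd_def norm_Rd_eq u_def Rd_def dirI_def)
  have wu: "w j = R * u j" if "j < d" for j
    using that R by (simp add: u_def dirI_def R_def)
  have ker: "(\<Sum>j<d. swap_refl d u (sphere_pt d t z) j * w j) = R * t" for t z
  proof -
    have "(\<Sum>j<d. swap_refl d u (sphere_pt d t z) j * w j) = R * inner_Rd d (swap_refl d u (sphere_pt d t z)) u"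
      unfolding inner_Rd_def sum_distrib_left by (rule sum.cong) (auto simp: wu)
    also have "\<dots> = R * t"
      using d by (subst inner_swap_refl_u[OF u]) (auto simp: sphere_pt_def)
    finally show ?thesis .
  qed
  have m: "(\<lambda>x. \<Sum>j<d. x j * w j) \<in> borel_measurable (Pi\<^sub>M {..<d} (\<lambda>_. borel))"
    by (intro borel_measurable_sum borel_measurable_times borel_measurable_const measurable_coordinate_borel)
  have mQ: "(\<lambda>x. indicator Q (\<Sum>j<d. x j * w j) :: ennreal) \<in> borel_measurable (Pi\<^sub>M {..<d} (\<lambda>_. borel))"
    by (rule measurable_compose[OF m]) measurable
  have Q': "{t. R * t \<in> Q} \<in> sets borel"
  proof -
    have "(\<lambda>t. R * t) \<in> borel_measurable borel" by simp
    from measurable_sets[OF this Q] show ?thesis by (simp add: vimage_def)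
  qed
  have "(\<integral>\<^sup>+x. indicator Q (\<Sum>j<d. x j * w j) \<partial>uniform_sphere d) =
    (\<integral>\<^sup>+t. ennreal (srad t ^ (d - 3)) * (\<integral>\<^sup>+z. indicator Q (R * t) \<partial>nu d) \<partial>lborel)"
    by (subst uniform_sphere_slice[OF d(1) mQ, where u = u]) (simp only: ker)
  also have "\<dots> = (\<integral>\<^sup>+t. ennreal (indicator {t. R * t \<in> Q} t * srad t ^ (d - 3)) * ennreal (1 / coord_mass d) \<partial>lborel)"
    using nu_mass[OF d] by (intro nn_integral_cong) (auto simp: indicator_def)
  also have "\<dots> = (\<integral>\<^sup>+t. ennreal (indicator {t. R * t \<in> Q} t * srad t ^ (d - 3)) \<partial>lborel) * ennreal (1 / coord_mass d)"
    using Q' by (intro nn_integral_multc) measurable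
  also have "(\<integral>\<^sup>+t. ennreal (indicator {t. R * t \<in> Q} t * srad t ^ (d - 3)) \<partial>lborel) =
      ennreal (LBINT t. indicator {t. R * t \<in> Q} t * srad t ^ (d - 3))"
    by (rule nn_integral_eq_integral) (use d Q' in \<open>auto intro!: integrable_srad_bounded[of _ _ 1] simp: srad_nonneg\<close>)
  also have "\<dots> * ennreal (1 / coord_mass d) = ennreal ((LBINT t. indicator {t. R * t \<in> Q} t * srad t ^ (d - 3)) / coord_mass d)"
    using coord_mass_pos[OF d(1)] by (simp flip: ennreal_mult'')
  finally show ?thesis by (simp add: R_def)
qed

lemma halfspace_le:
  assumes d: "d \<ge> 4" "prob_space (uniform_sphere d)" and w: "w \<in> space (leb {..<d})" "normI {..<d} w > 0"
  shows "(\<integral>\<^sup>+x. indicator {..1} (\<Sum>j<d. x j * w j) \<partial>uniform_sphere d) = ennreal (coord_cdf d (1 / normI {..<d} w))"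
proof -
  have "{t. normI {..<d} w * t \<in> {..1}} = {..1 / normI {..<d} w}" using w by (auto simp: field_simps)
  then show ?thesis by (subst halfspace_measure[OF d w]) (auto simp: coord_cdf_def)
qed

lemma halfspace_less:
  assumes d: "d \<ge> 4" "prob_space (uniform_sphere d)" and w: "w \<in> space (leb {..<d})" "normI {..<d} w > 0"
  shows "(\<integral>\<^sup>+x. indicator {..<1} (\<Sum>j<d. x j * w j) \<partial>uniform_sphere d) = ennreal (coord_cdf d (1 / normI {..<d} w))"
proof -
  have "{t. normI {..<d} w * t \<in> {..<1}} = {..<1 / normI {..<d} w}" using w by (auto simp: field_simps)
  then show ?thesis by (subst halfspace_measure[OF d w]) (auto simp: coord_cdf_strict)
qed

lemma halfspace_ge:
  assumes d: "d \<ge> 4" "prob_space (uniform_sphere d)" and w: "w \<in> space (leb {..<d})" "normI {..<d} w > 0"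
  shows "(\<integral>\<^sup>+x. indicator {1..} (\<Sum>j<d. x j * w j) \<partial>uniform_sphere d) = ennreal (coord_cdf d (- (1 / normI {..<d} w)))"
proof -
  have "{t. normI {..<d} w * t \<in> {1..}} = {1 / normI {..<d} w..}" using w by (auto simp: field_simps)
  then show ?thesis by (subst halfspace_measure[OF d w]) (auto simp: coord_cdf_minus[OF d(1)])
qed

section \<open>The hyperplane together with the remaining points\<close>

lemma cramer_sol_sphere_prod_measurable:
  assumes n: "d \<le> n"
  shows "(\<lambda>x. cramer_sol d x (ones d)) \<in> measurable (sphere_prod d {..<n}) (leb {..<d})"
    and "(\<lambda>x. det_fun d x) \<in> borel_measurable (sphere_prod d {..<n})"
proof -
  have e: "(\<lambda>x. x i k) \<in> borel_measurable (sphere_prod d {..<n})" if "i < d" "k < d" for i k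
    by (rule entry_measurable) (use that n in auto)
  show det: "(\<lambda>x. det_fun d x) \<in> borel_measurable (sphere_prod d {..<n})"
    by (rule det_fun_measurable) (rule e)
  show "(\<lambda>x. cramer_sol d x (ones d)) \<in> measurable (sphere_prod d {..<n}) (leb {..<d})"
    unfolding cramer_sol_def
  proof (rule measurable_restrict)
    fix j assume "j \<in> {..<d}"
    have "(\<lambda>x. det_fun d (\<lambda>i k. if k = j then ones d i else x i k)) \<in> borel_measurable (sphere_prod d {..<n})"
    proof (rule det_fun_measurable)
      fix i k assume "i < d" "k < d"
      then show "(\<lambda>x. if k = j then ones d i else x i k) \<in> borel_measurable (sphere_prod d {..<n})"
        using e by (cases "k = j") auto
    qed
    then show "(\<lambda>x. det_fun d (\<lambda>i k. if k = j then ones d i else x i k) / det_fun d x) \<in> measurable (sphere_prod d {..<n}) lborel"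
      using det by simp
  qed
qed

lemma inner_cramer_sol_measurable:
  assumes n: "d \<le> n" and l: "l < n"
  shows "(\<lambda>x. \<Sum>j<d. x l j * cramer_sol d x (ones d) j) \<in> borel_measurable (sphere_prod d {..<n})"
  by (intro borel_measurable_sum borel_measurable_times entry_measurable
      measurable_compose[OF cramer_sol_sphere_prod_measurable(1)[OF n] measurable_coordinate_leb]) (use l in auto)

lemma joint_integrand_measurable:
  assumes n: "d \<le> n" and \<psi>[measurable]: "\<psi> \<in> borel_measurable borel" and Q[measurable]: "Q \<in> sets borel"
  shows "(\<lambda>x. ennreal (\<psi> (plane_height d x (ones d))) * (\<Prod>l\<in>{d..<n}. indicator Q (\<Sum>j<d. x l j * cramer_sol d x (ones d) j)))
    \<in> borel_measurable (sphere_prod d {..<n})"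
proof -
  have nm: "(\<lambda>x. normI {..<d} (cramer_sol d x (ones d))) \<in> borel_measurable (sphere_prod d {..<n})"
    by (rule measurable_compose[OF cramer_sol_sphere_prod_measurable(1)[OF n] normI_measurable_leb])
  have [measurable]: "(\<lambda>x. ennreal (\<psi> (plane_height d x (ones d)))) \<in> borel_measurable (sphere_prod d {..<n})"
    unfolding plane_height_def using nm by measurable
  have [measurable]: "(\<lambda>x. \<Prod>l\<in>{d..<n}. indicator Q (\<Sum>j<d. x l j * cramer_sol d x (ones d) j) :: ennreal) \<in> borel_measurable (sphere_prod d {..<n})"
  proof (rule borel_measurable_prod_ennreal)
    fix l assume "l \<in> {d..<n}"
    then have "(\<lambda>x. \<Sum>j<d. x l j * cramer_sol d x (ones d) j) \<in> borel_measurable (sphere_prod d {..<n})"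
      by (intro inner_cramer_sol_measurable n) auto
    then show "(\<lambda>x. indicator Q (\<Sum>j<d. x l j * cramer_sol d x (ones d) j) :: ennreal) \<in> borel_measurable (sphere_prod d {..<n})"
      by (rule measurable_compose) measurable
  qed
  show ?thesis by measurable
qed

text \<open>Given the first \<open>d\<close> points the hyperplane is fixed, and the other n - d
  points are independent of it and of each other; each contributes the factor \<open>q\<close> of
  the height.\<close>

lemma joint_integral:
  assumes d: "d \<ge> 4" "prob_space (uniform_sphere d)" and n: "d \<le> n"
    and \<psi>[measurable]: "\<psi> \<in> borel_measurable borel" and \<psi>0: "\<And>x. 0 \<le> \<psi> x"
    and Q[measurable]: "Q \<in> sets borel" and q0: "\<And>h. 0 \<le> q h"
    and q: "\<And>w. w \<in> space (leb {..<d}) \<Longrightarrow> normI {..<d} w > 0 \<Longrightarrow>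
      (\<integral>\<^sup>+x. indicator Q (\<Sum>j<d. x j * w j) \<partial>uniform_sphere d) = ennreal (q (1 / normI {..<d} w))"
  shows "(\<integral>\<^sup>+x. ennreal (\<psi> (plane_height d x (ones d))) * (\<Prod>l\<in>{d..<n}. indicator Q (\<Sum>j<d. x l j * cramer_sol d x (ones d) j)) \<partial>sphere_prod d {..<n}) =
    (\<integral>\<^sup>+a. ennreal (\<psi> (plane_height d a (ones d)) * q (plane_height d a (ones d)) ^ (n - d)) \<partial>sphere_prod d {..<d})"
proof -
  interpret sg: product_sigma_finite "\<lambda>_::nat. uniform_sphere d"
    unfolding product_sigma_finite_def using d(2) by (auto intro: finite_measure.axioms(1) prob_space.finite_measure)
  let ?f = "\<lambda>x. ennreal (\<psi> (plane_height d x (ones d))) * (\<Prod>l\<in>{d..<n}. indicator Q (\<Sum>j<d. x l j * cramer_sol d x (ones d) j))"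
  let ?m = "\<lambda>a b. merge {..<d} {d..<n} (a, b)"
  have un: "{..<n} = {..<d} \<union> {d..<n}" using n by auto
  have fm: "?f \<in> borel_measurable (sphere_prod d {..<n})"
    by (rule joint_integrand_measurable[OF n \<psi> Q])
  have fm': "?f \<in> borel_measurable (sphere_prod d ({..<d} \<union> {d..<n}))" using fm un by simp
  have "(\<integral>\<^sup>+x. ?f x \<partial>sphere_prod d {..<n}) = (\<integral>\<^sup>+a. \<integral>\<^sup>+b. ?f (?m a b) \<partial>sphere_prod d {d..<n} \<partial>sphere_prod d {..<d})"
    unfolding un by (rule sg.product_nn_integral_fold) (use fm' in auto)
  also have "\<dots> = (\<integral>\<^sup>+a. ennreal (\<psi> (plane_height d a (ones d)) * q (plane_height d a (ones d)) ^ (n - d)) \<partial>sphere_prod d {..<d})"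
  proof (rule nn_integral_cong_AE)
    have sp: "AE a in sphere_prod d {..<d}. a \<in> space (sphere_prod d {..<d})" by (rule AE_space)
    show "AE a in sphere_prod d {..<d}. (\<integral>\<^sup>+b. ?f (?m a b) \<partial>sphere_prod d {d..<n}) = ennreal (\<psi> (plane_height d a (ones d)) * q (plane_height d a (ones d)) ^ (n - d))"
      using AE_leading_minors[OF d(2)] sp
    proof eventually_elim
      case (elim a)
      then have det: "det_fun d a \<noteq> 0" using lead_full[of d a] by auto
      define w where "w = cramer_sol d a (ones d)"
      have w: "w \<in> space (leb {..<d})" "normI {..<d} w > 0"
        using cramer_sol_ones_normI_pos[OF det] d by (auto simp: w_def cramer_sol_def space_PiM)
      have h: "plane_height d a (ones d) = 1 / normI {..<d} w" by (simp add: plane_height_def w_def)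
      have s: "cramer_sol d (?m a b) (ones d) = w" for b
      proof -
        have "det_fun d (\<lambda>i k. if k = j then ones d i else ?m a b i k) = det_fun d (\<lambda>i k. if k = j then ones d i else a i k)" for j
          by (rule det_fun_cong) (auto simp: merge_def)
        moreover have "det_fun d (?m a b) = det_fun d a"
          by (rule det_fun_cong) (auto simp: merge_def)
        ultimately show ?thesis by (simp add: w_def cramer_sol_def)
      qed
      have h': "plane_height d (?m a b) (ones d) = plane_height d a (ones d)" for b
        by (simp add: plane_height_def s w_def)
      have "(\<integral>\<^sup>+b. ?f (?m a b) \<partial>sphere_prod d {d..<n}) =
        (\<integral>\<^sup>+b. ennreal (\<psi> (plane_height d a (ones d))) * (\<Prod>l\<in>{d..<n}. indicator Q (\<Sum>j<d. b l j * w j)) \<partial>sphere_prod d {d..<n})"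
      proof (rule nn_integral_cong)
        fix b
        have "(\<Prod>l\<in>{d..<n}. indicator Q (\<Sum>j<d. ?m a b l j * cramer_sol d (?m a b) (ones d) j)) =
            (\<Prod>l\<in>{d..<n}. indicator Q (\<Sum>j<d. b l j * w j) :: ennreal)"
          unfolding s by (rule prod.cong[OF refl]) (simp add: merge_def)
        then show "?f (?m a b) = ennreal (\<psi> (plane_height d a (ones d))) * (\<Prod>l\<in>{d..<n}. indicator Q (\<Sum>j<d. b l j * w j))"
          by (simp only: h')
      qed
      also have "\<dots> = ennreal (\<psi> (plane_height d a (ones d))) * (\<integral>\<^sup>+b. (\<Prod>l\<in>{d..<n}. indicator Q (\<Sum>j<d. b l j * w j)) \<partial>sphere_prod d {d..<n})"
      proof (rule nn_integral_cmult, rule borel_measurable_prod_ennreal)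
        fix l assume l: "l \<in> {d..<n}"
        have "(\<lambda>b. \<Sum>j<d. b l j * w j) \<in> borel_measurable (sphere_prod d {d..<n})"
          by (intro borel_measurable_sum borel_measurable_times borel_measurable_const entry_measurable) (use l in auto)
        then show "(\<lambda>b. indicator Q (\<Sum>j<d. b l j * w j) :: ennreal) \<in> borel_measurable (sphere_prod d {d..<n})"
          by (rule measurable_compose) measurable
      qed
      also have "(\<integral>\<^sup>+b. (\<Prod>l\<in>{d..<n}. indicator Q (\<Sum>j<d. b l j * w j)) \<partial>sphere_prod d {d..<n}) =
          (\<Prod>l\<in>{d..<n}. \<integral>\<^sup>+x. indicator Q (\<Sum>j<d. x j * w j) \<partial>uniform_sphere d)"
      proof (rule sg.product_nn_integral_prod)
        fix l :: nat
        have "(\<lambda>x. \<Sum>j<d. x j * w j) \<in> borel_measurable (Pi\<^sub>M {..<d} (\<lambda>_. borel))"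
          by (intro borel_measurable_sum borel_measurable_times borel_measurable_const measurable_coordinate_borel)
        then have "(\<lambda>x. \<Sum>j<d. x j * w j) \<in> borel_measurable (uniform_sphere d)"
          by (simp add: measurable_cong_sets[OF sets_uniform_sphere refl])
        then show "(\<lambda>x. indicator Q (\<Sum>j<d. x j * w j) :: ennreal) \<in> borel_measurable (uniform_sphere d)"
          by (rule measurable_compose) measurable
      qed simp
      also have "\<dots> = ennreal (q (plane_height d a (ones d)) ^ (n - d))"
        unfolding q[OF w] h[symmetric] by (simp add: ennreal_power q0)
      also have "ennreal (\<psi> (plane_height d a (ones d))) * \<dots> = ennreal (\<psi> (plane_height d a (ones d)) * q (plane_height d a (ones d)) ^ (n - d))"
        by (simp add: ennreal_mult \<psi>0 q0)
      finally show ?case .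
    qed
  qed
  finally show ?thesis .
qed

subsection \<open>Facets of simplices\<close>

lemma det_fun_zero_kernel:
  assumes "det_fun d a = 0"
  obtains c where "\<exists>i<d. c i \<noteq> 0" "\<And>k. k < d \<Longrightarrow> (\<Sum>j<d. a k j * c j) = 0"
proof -
  let ?A = "Matrix.mat d d (\<lambda>(i, j). a i j)"
  have A: "?A \<in> carrier_mat d d" by simp
  from assms have "\<exists>v. v \<in> carrier_vec d \<and> v \<noteq> 0\<^sub>v d \<and> ?A *\<^sub>v v = 0\<^sub>v d"
    using det_0_iff_vec_prod_zero_field[OF A] by (simp add: det_fun_def)
  then obtain v where v: "v \<in> carrier_vec d" "v \<noteq> 0\<^sub>v d" "?A *\<^sub>v v = 0\<^sub>v d" by blast
  show thesis
  proof (rule that[of "vec_index v"])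
    show "\<exists>i<d. vec_index v i \<noteq> 0"
    proof (rule ccontr)
      assume "\<not> ?thesis"
      then have "v = 0\<^sub>v d" using v(1) by (intro eq_vecI) auto
      then show False using v(2) by simp
    qed
    fix k assume k: "k < d"
    have "vec_index (?A *\<^sub>v v) k = (\<Sum>j<d. a k j * vec_index v j)"
      using k v(1) by (auto simp: scalar_prod_def lessThan_atLeast0)
    then show "(\<Sum>j<d. a k j * vec_index v j) = 0" using v(3) k by simp
  qed
qed

text \<open>Replacing row \<open>i\<close> by the combination multiplies the determinant by
  \<open>c i\<close>, yet a zero row makes it vanish.\<close>

lemma det_fun_rows_independent:
  assumes det: "det_fun d a \<noteq> 0" and c: "\<And>k. k < d \<Longrightarrow> (\<Sum>i<d. c i * a i k) = 0" and i: "i < d"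
  shows "c i = 0"
proof -
  have "c i * det_fun d a = det_fun d (\<lambda>l j. if l = i then (\<Sum>m<d. c m * a m j) else a l j)"
    by (rule det_fun_cramer_row[OF i, symmetric])
  also have "\<dots> = det_fun d (a(i := (\<lambda>_. 0)))" by (rule det_fun_cong) (auto simp: c)
  also have "\<dots> = 0"
  proof -
    obtain e where "\<And>v. det_fun d (a(i := v)) = (\<Sum>j<d. v j * e j)" using det_fun_laplace_row[OF i, of a] by metis
    then show ?thesis by simp
  qed
  finally show ?thesis using det by simp
qed

lemma conv_hull_member:
  assumes "finite I" "i \<in> I" "x i \<in> Rd d"
  shows "x i \<in> conv_hull_Rd d I x"
proof -
  have "x i = (\<lambda>k\<in>{..<d}. \<Sum>j\<in>I. (if j = i then 1 else 0) * x j k)"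
    using assms by (auto simp: fun_eq_iff Rd_def PiE_def extensional_def if_distrib[of "\<lambda>t. t * _"] sum.delta cong: if_cong)
  then show ?thesis
    unfolding conv_hull_Rd_def using assms
    by (intro CollectI exI[of _ "\<lambda>j. if j = i then 1 else 0"]) (auto simp: sum.delta)
qed

lemma inner_conv_comb:
  "inner_Rd d (\<lambda>k\<in>{..<d}. \<Sum>i\<in>I. c i * x i k) u = (\<Sum>i\<in>I. c i * inner_Rd d (x i) u)"
proof -
  have "inner_Rd d (\<lambda>k\<in>{..<d}. \<Sum>i\<in>I. c i * x i k) u = (\<Sum>k<d. \<Sum>i\<in>I. c i * (x i k * u k))"
    unfolding inner_Rd_def by (rule sum.cong) (auto simp: sum_distrib_right mult.assoc)
  then show ?thesis unfolding inner_Rd_def by (subst (asm) sum.swap) (simp add: sum_distrib_left)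
qed

text \<open>The deterministic part, for linearly independent first \<open>d\<close> points. Points
  are numbered from 1 and matrix rows from 0, hence \<open>Suc\<close>.\<close>

locale simplex_points =
  fixes d n :: nat and p :: "nat \<Rightarrow> nat \<Rightarrow> real"
  assumes d: "0 < d" and dn: "d \<le> n"
    and p: "\<And>i. i \<in> {1..n} \<Longrightarrow> p i \<in> Rd d"
    and det: "det_fun d (\<lambda>i. p (Suc i)) \<noteq> 0"
begin

abbreviation "A \<equiv> \<lambda>i. p (Suc i)"
definition "w = cramer_sol d A (ones d)"
definition "h = plane_height d A (ones d)"

lemma w_normI: "normI {..<d} w > 0"
  unfolding w_def by (rule cramer_sol_ones_normI_pos[OF det d])

lemma h_eq: "h = 1 / normI {..<d} w" by (simp add: h_def plane_height_def w_def)

lemma h_pos: "h > 0" using w_normI by (simp add: h_eq)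

lemma A_w: "i \<in> {1..d} \<Longrightarrow> inner_Rd d (p i) w = 1"
  using cramer_sol_solves[OF det, of "i - 1" "ones d"]
  by (cases i) (auto simp: w_def inner_Rd_def ones_def)

text \<open>A hyperplane containing the first \<open>d\<close> points has its normal determined by A
  u = \<eta> 1, so u = \<eta> w, and the unit length of \<open>u\<close> forces |\<eta>| =
  \<open>h\<close>. Dividing the support inequalities by \<eta> yields the side, reversed when
  \<eta> is negative.\<close>

lemma supports_at_cases:
  assumes s: "supports_at d (conv_hull_Rd d {1..n} p) (conv_hull_Rd d {1..d} p) u \<eta>"
  shows "(\<eta> = h \<and> (\<forall>j\<in>{1..n}. inner_Rd d (p j) w \<le> 1)) \<or> (\<eta> = - h \<and> (\<forall>j\<in>{1..n}. inner_Rd d (p j) w \<ge> 1))"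
proof -
  have u: "u \<in> Rd d" "normI {..<d} u = 1"
    using s by (auto simp: supports_at_def sphere_Rd_def norm_Rd_eq)
  have P: "inner_Rd d (p j) u \<le> \<eta>" if j: "j \<in> {1..n}" for j
    using conv_hull_member[of "{1..n}" j p d] p[OF j] j s by (auto simp: supports_at_def)
  have F: "inner_Rd d (p j) u = \<eta>" if j: "j \<in> {1..d}" for j
    using conv_hull_member[of "{1..d}" j p d] p[of j] j s dn by (auto simp: supports_at_def)
  have uw: "u = (\<lambda>j\<in>{..<d}. \<eta> * w j)"
  proof -
    have "cramer_sol d A (\<lambda>_. \<eta>) = u"
      by (rule cramer_sol_unique[OF det]) (use u F in \<open>auto simp: Rd_def PiE_def inner_Rd_def\<close>)
    moreover have "cramer_sol d A (\<lambda>_. \<eta>) = (\<lambda>j\<in>{..<d}. \<eta> * w j)"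
    proof (rule cramer_sol_unique[OF det])
      fix i assume i: "i < d"
      have "(\<Sum>j<d. A i j * (\<lambda>j\<in>{..<d}. \<eta> * w j) j) = \<eta> * inner_Rd d (A i) w"
        unfolding inner_Rd_def sum_distrib_left by (rule sum.cong) auto
      then show "(\<Sum>j<d. A i j * (\<lambda>j\<in>{..<d}. \<eta> * w j) j) = \<eta>"
        using A_w[of "Suc i"] i by simp
    qed simp
    ultimately show ?thesis by simp
  qed
  have "1 = \<bar>\<eta>\<bar> * normI {..<d} w" using u(2) unfolding uw normI_scale by simp
  then have \<eta>: "\<bar>\<eta>\<bar> = h" using w_normI by (simp add: h_eq field_simps)
  have pu: "inner_Rd d (p j) u = \<eta> * inner_Rd d (p j) w" for j
    unfolding uw inner_Rd_def sum_distrib_left by (rule sum.cong) auto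
  show ?thesis
  proof (cases "\<eta> > 0")
    case True
    then have "inner_Rd d (p j) w \<le> 1" if "j \<in> {1..n}" for j using P[OF that] unfolding pu by simp
    then show ?thesis using True \<eta> by auto
  next
    case False
    then have neg: "\<eta> < 0" using \<eta> h_pos by auto
    then have "inner_Rd d (p j) w \<ge> 1" if "j \<in> {1..n}" for j using P[OF that] unfolding pu by simp
    then show ?thesis using neg \<eta> by auto
  qed
qed

text \<open>The normal is u = h w. Strictness keeps all further points off the hyperplane, so the
  face it cuts out is exactly the hull of the first \<open>d\<close> points.\<close>

lemma facet_if_strict:
  assumes strict: "\<And>j. j \<in> {d<..n} \<Longrightarrow> inner_Rd d (p j) w < 1"
  shows "is_facet d (conv_hull_Rd d {1..n} p) (conv_hull_Rd d {1..d} p)"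
proof -
  let ?P = "conv_hull_Rd d {1..n} p" and ?F = "conv_hull_Rd d {1..d} p"
  define u where "u = (\<lambda>j\<in>{..<d}. h * w j)"
  have u: "u \<in> sphere_Rd d"
  proof -
    have "normI {..<d} u = 1" unfolding u_def normI_scale using w_normI by (simp add: h_eq)
    then show ?thesis by (simp add: sphere_Rd_def norm_Rd_eq u_def Rd_def)
  qed
  have pu: "inner_Rd d (p j) u = h * inner_Rd d (p j) w" for j
    unfolding u_def inner_Rd_def sum_distrib_left by (rule sum.cong) auto
  have pF: "inner_Rd d (p j) u = h" if "j \<in> {1..d}" for j using A_w[OF that] by (simp add: pu)
  have pS: "inner_Rd d (p j) u < h" if "j \<in> {d<..n}" for j
    using strict[OF that] h_pos by (simp add: pu)
  have pP: "inner_Rd d (p j) u \<le> h" if "j \<in> {1..n}" for j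
    using pF[of j] pS[of j] that by (cases "j \<le> d") auto
  have "supports_at d ?P ?F u h"
    unfolding supports_at_def
  proof (intro conjI u subset_antisym subsetI)
    fix x assume "x \<in> ?P"
    then obtain c where c: "x = (\<lambda>k\<in>{..<d}. \<Sum>i\<in>{1..n}. c i * p i k)" "\<forall>i\<in>{1..n}. 0 \<le> c i" "(\<Sum>i\<in>{1..n}. c i) = 1"
      unfolding conv_hull_Rd_def by blast
    have "inner_Rd d x u = (\<Sum>i\<in>{1..n}. c i * inner_Rd d (p i) u)" unfolding c(1) by (rule inner_conv_comb)
    also have "\<dots> \<le> (\<Sum>i\<in>{1..n}. c i * h)" using c(2) pP by (intro sum_mono mult_left_mono) auto
    also have "\<dots> = h" using c(3) by (simp add: sum_distrib_right[symmetric])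
    finally show "x \<in> {x \<in> Rd d. inner_Rd d x u \<le> h}" by (simp add: c(1) Rd_def)
  next
    fix x assume "x \<in> ?F"
    then obtain c where c: "x = (\<lambda>k\<in>{..<d}. \<Sum>i\<in>{1..d}. c i * p i k)" "\<forall>i\<in>{1..d}. 0 \<le> c i" "(\<Sum>i\<in>{1..d}. c i) = 1"
      unfolding conv_hull_Rd_def by blast
    let ?c = "\<lambda>i. if i \<in> {1..d} then c i else 0"
    have sub: "(\<Sum>i\<in>{1..n}. ?c i * f i) = (\<Sum>i\<in>{1..d}. c i * f i)" for f
      by (rule sum.mono_neutral_cong_right) (use dn in auto)
    have "x = (\<lambda>k\<in>{..<d}. \<Sum>i\<in>{1..n}. ?c i * p i k)" unfolding c(1) sub ..
    moreover have "(\<Sum>i\<in>{1..n}. ?c i) = 1" using sub[of "\<lambda>_. 1"] c(3) by simp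
    ultimately have "x \<in> ?P" unfolding conv_hull_Rd_def using c(2) by (intro CollectI exI[of _ ?c]) auto
    moreover have "inner_Rd d x u = (\<Sum>i\<in>{1..d}. c i * inner_Rd d (p i) u)" unfolding c(1) by (rule inner_conv_comb)
    then have "inner_Rd d x u = (\<Sum>i\<in>{1..d}. c i * h)" using pF by simp
    then have "inner_Rd d x u = h" using c(3) by (simp add: sum_distrib_right[symmetric])
    ultimately show "x \<in> ?P \<inter> {x \<in> Rd d. inner_Rd d x u = h}" by (simp add: c(1) Rd_def)
  next
    fix x assume x: "x \<in> ?P \<inter> {x \<in> Rd d. inner_Rd d x u = h}"
    then obtain c where c: "x = (\<lambda>k\<in>{..<d}. \<Sum>i\<in>{1..n}. c i * p i k)" "\<forall>i\<in>{1..n}. 0 \<le> c i" "(\<Sum>i\<in>{1..n}. c i) = 1"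
      unfolding conv_hull_Rd_def by blast
    have "(\<Sum>i\<in>{1..n}. c i * inner_Rd d (p i) u) = h"
    proof -
      have "inner_Rd d x u = h" using x by simp
      then show ?thesis unfolding c(1) inner_conv_comb .
    qed
    moreover have "(\<Sum>i\<in>{1..n}. c i * h) = h" using c(3) by (simp add: sum_distrib_right[symmetric])
    \<comment> \<open>A convex combination attains the maximum \<open>h\<close> only if its weights
      sit on points attaining it: this is a vanishing sum of nonnegative terms.\<close>
    ultimately have "(\<Sum>i\<in>{1..n}. c i * (h - inner_Rd d (p i) u)) = 0"
      by (simp add: right_diff_distrib sum_subtractf)
    then have z: "\<forall>i\<in>{1..n}. c i * (h - inner_Rd d (p i) u) = 0"
      using c(2) pP by (subst (asm) sum_nonneg_eq_0_iff) (auto intro: mult_nonneg_nonneg)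
    have c0: "c i = 0" if "i \<in> {d<..n}" for i
    proof -
      have "i \<in> {1..n}" using that d by auto
      then have "c i * (h - inner_Rd d (p i) u) = 0" using z by blast
      then show ?thesis using pS[OF that] by simp
    qed
    have sub: "(\<Sum>i\<in>{1..n}. c i * f i) = (\<Sum>i\<in>{1..d}. c i * f i)" for f
      by (rule sum.mono_neutral_right) (use dn c0 in auto)
    show "x \<in> ?F"
      unfolding conv_hull_Rd_def using c(2,3) sub[of "\<lambda>_. 1"] dn
      by (intro CollectI exI[of _ c]) (auto simp: c(1) sub)
  qed
  moreover have "has_dim_Rd d ?F (d - 1)"
    unfolding has_dim_Rd_def
  proof
    have "aff_indep_Rd d d A"
      unfolding aff_indep_Rd_def using det_fun_rows_independent[OF det] by blast
    moreover have "\<forall>i<d. A i \<in> ?F"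
      using conv_hull_member[of "{1..d}" _ p d] p dn by auto
    ultimately show "\<exists>p. (\<forall>i<d - 1 + 1. p i \<in> ?F) \<and> aff_indep_Rd d (d - 1 + 1) p"
      using d by (intro exI[of _ A]) simp
    show "\<not> (\<exists>p. (\<forall>i<d - 1 + 2. p i \<in> ?F) \<and> aff_indep_Rd d (d - 1 + 2) p)"
    proof
      assume "\<exists>p. (\<forall>i<d - 1 + 2. p i \<in> ?F) \<and> aff_indep_Rd d (d - 1 + 2) p"
      then obtain q where q: "\<And>i. i < Suc d \<Longrightarrow> q i \<in> ?F" and ind: "aff_indep_Rd d (Suc d) q"
        using d by auto
      have "\<forall>i. \<exists>c. i < Suc d \<longrightarrow> q i = (\<lambda>k\<in>{..<d}. \<Sum>l\<in>{1..d}. c l * p l k) \<and> (\<Sum>l\<in>{1..d}. c l) = 1"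
        using q unfolding conv_hull_Rd_def by blast
      from choice[OF this] obtain W where
        "\<forall>i. i < Suc d \<longrightarrow> q i = (\<lambda>k\<in>{..<d}. \<Sum>l\<in>{1..d}. W i l * p l k) \<and> (\<Sum>l\<in>{1..d}. W i l) = 1" ..
      then have W: "\<And>i. i < Suc d \<Longrightarrow> q i = (\<lambda>k\<in>{..<d}. \<Sum>l\<in>{1..d}. W i l * p l k)"
          "\<And>i. i < Suc d \<Longrightarrow> (\<Sum>l\<in>{1..d}. W i l) = 1"
        by simp_all
      \<comment> \<open>The barycentric coordinates of d + 1 points form a d by (d + 1) system. Row
        0 is padded with zeros, which fits the numbering of the vertices from 1 and forces a
        vanishing determinant, hence a linear dependence of the columns; as each column sums to 1,
        it is an affine dependence of the points.\<close>
      define a where "a = (\<lambda>k j. if k = 0 then 0 else W j k)"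
      obtain e where "\<And>v. det_fun (Suc d) (a(0 := v)) = (\<Sum>j<Suc d. v j * e j)"
        using det_fun_laplace_row[of 0 "Suc d" a] by (metis zero_less_Suc)
      then have "det_fun (Suc d) (a(0 := (\<lambda>_. 0))) = 0" by simp
      moreover have "a(0 := (\<lambda>_. 0)) = a" by (auto simp: a_def fun_eq_iff)
      ultimately have "det_fun (Suc d) a = 0" by simp
      then obtain c where c: "\<exists>i<Suc d. c i \<noteq> 0" "\<And>k. k < Suc d \<Longrightarrow> (\<Sum>j<Suc d. a k j * c j) = 0"
        by (rule det_fun_zero_kernel) blast
      have cW: "(\<Sum>j<Suc d. W j l * c j) = 0" if "l \<in> {1..d}" for l
        using c(2)[of l] that by (simp add: a_def)
      have "(\<Sum>j<Suc d. c j) = (\<Sum>j<Suc d. \<Sum>l\<in>{1..d}. W j l * c j)"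
        by (rule sum.cong) (auto simp: sum_distrib_right[symmetric] W(2))
      also have "\<dots> = (\<Sum>l\<in>{1..d}. \<Sum>j<Suc d. W j l * c j)" by (rule sum.swap)
      also have "\<dots> = 0" using cW by simp
      finally have c1: "(\<Sum>j<Suc d. c j) = 0" .
      have c2: "(\<Sum>j<Suc d. c j * q j k) = 0" if k: "k < d" for k
      proof -
        have "(\<Sum>j<Suc d. c j * q j k) = (\<Sum>j<Suc d. \<Sum>l\<in>{1..d}. W j l * c j * p l k)"
          by (rule sum.cong) (use k in \<open>auto simp: W(1) sum_distrib_left mult_ac\<close>)
        also have "\<dots> = (\<Sum>l\<in>{1..d}. (\<Sum>j<Suc d. W j l * c j) * p l k)"
          by (subst sum.swap) (simp only: sum_distrib_right)
        also have "\<dots> = 0" using cW by simp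
        finally show ?thesis .
      qed
      show False using ind c(1) c1 c2 unfolding aff_indep_Rd_def by blast
    qed
  qed
  ultimately show ?thesis unfolding is_facet_def by blast
qed

end

subsection \<open>Laplace asymptotics\<close>

abbreviation Phi :: "real \<Rightarrow> real" where "Phi \<equiv> cdf std_normal_distribution"

lemma Phi_eq: "Phi x = (LBINT t. indicator {..x} t * std_normal_density t)"
proof -
  have "Phi x = measure (density lborel (\<lambda>t. ennreal (std_normal_density t))) {..x}" by (simp add: cdf_def)
  also have "\<dots> = (LBINT t. indicator {..x} t * std_normal_density t)"
  proof -
    have "emeasure (density lborel (\<lambda>t. ennreal (std_normal_density t))) {..x} =
        (\<integral>\<^sup>+t. ennreal (indicator {..x} t * std_normal_density t) \<partial>lborel)"
      by (subst emeasure_density) (auto intro!: nn_integral_cong simp: indicator_def)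
    also have "\<dots> = ennreal (LBINT t. indicator {..x} t * std_normal_density t)"
      by (rule nn_integral_eq_integral)
        (use integrable_real_mult_indicator[of "{..x}" lborel std_normal_density] in \<open>auto simp: mult.commute\<close>)
    finally show ?thesis
      by (simp add: measure_def integral_nonneg_AE)
  qed
  finally show ?thesis .
qed

lemma integrable_indicator_normal: "A \<in> sets borel \<Longrightarrow> integrable lborel (\<lambda>t. indicator A t * std_normal_density t)"
  using integrable_real_mult_indicator[of A lborel std_normal_density] by (simp add: mult.commute)

lemma std_normal_density_continuous: "continuous_on A std_normal_density"
  unfolding std_normal_density_def by (intro continuous_intros) auto

lemma Phi_diff:
  assumes "a \<le> b" shows "Phi b - Phi a = integral {a..b} std_normal_density"
proof -
  have "Phi b - Phi a = (LBINT t. indicator {..b} t * std_normal_density t - indicator {..a} t * std_normal_density t)"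
    unfolding Phi_eq by (rule Bochner_Integration.integral_diff[symmetric]) (auto intro: integrable_indicator_normal)
  also have "\<dots> = (LBINT t. indicator {a<..b} t * std_normal_density t)"
    by (rule Bochner_Integration.integral_cong) (use assms in \<open>auto simp: indicator_def\<close>)
  also have "\<dots> = (LBINT t. indicator {a..b} t * std_normal_density t)"
  proof (rule integral_cong_AE)
    have "AE t in lborel. t \<noteq> a" by (rule AE_lborel_singleton)
    then show "AE t in lborel. indicator {a<..b} t * std_normal_density t = indicator {a..b} t * std_normal_density t"
      by eventually_elim (auto simp: indicator_def)
  qed auto
  also have "\<dots> = (LINT t:{a..b}|lborel. std_normal_density t)"
    by (simp add: set_lebesgue_integral_def)
  also have "\<dots> = integral {a..b} std_normal_density"
    by (rule set_borel_integral_eq_integral(2))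
      (use integrable_indicator_normal[of "{a..b}"] in \<open>simp add: set_integrable_def\<close>)
  finally show ?thesis .
qed

lemma Phi_deriv: "(Phi has_real_derivative std_normal_density x) (at x)"
proof -
  have "((\<lambda>y. integral {x - 1..y} std_normal_density) has_real_derivative std_normal_density x) (at x within {x - 1..x + 1})"
    by (rule integral_has_real_derivative) (auto intro: std_normal_density_continuous)
  from DERIV_add[OF DERIV_const[of "Phi (x - 1)"] this]
  have "((\<lambda>y. Phi (x - 1) + integral {x - 1..y} std_normal_density) has_real_derivative std_normal_density x) (at x within {x - 1..x + 1})"
    by simp
  then have "(Phi has_real_derivative std_normal_density x) (at x within {x - 1..x + 1})"
  proof (rule has_field_derivative_transform_within[where d = 1])
    fix y assume "y \<in> {x - 1..x + 1}"
    then show "Phi (x - 1) + integral {x - 1..y} std_normal_density = Phi y"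
      using Phi_diff[of "x - 1" y] by simp
  qed auto
  then show ?thesis by (subst (asm) at_within_interior) auto
qed

lemma Phi_mono: "x \<le> y \<Longrightarrow> Phi x \<le> Phi y"
proof -
  assume "x \<le> y"
  then have "0 \<le> integral {x..y} std_normal_density"
    by (intro integral_nonneg integrable_continuous_interval std_normal_density_continuous) auto
  then show ?thesis using Phi_diff[OF \<open>x \<le> y\<close>] by simp
qed

lemma Phi_nonneg: "0 \<le> Phi x"
  unfolding Phi_eq by (rule integral_nonneg_AE) auto

lemma Phi_pos: "0 < Phi x"
proof -
  have "Phi (x - 1) < Phi x"
    by (rule DERIV_pos_imp_increasing[of "x - 1" x]) (auto intro!: exI[of _ "std_normal_density _"] Phi_deriv normal_density_pos)
  then show ?thesis using Phi_nonneg[of "x - 1"] by simp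
qed

lemma Phi_le_1: "Phi x \<le> 1"
  unfolding cdf_def using prob_space.prob_le_1[OF prob_space_normal_density[of 1 0]] by simp

lemma std_normal_density_antimono:
  assumes "0 \<le> r" "r \<le> s" shows "std_normal_density s \<le> std_normal_density r"
proof -
  have "r\<^sup>2 \<le> s\<^sup>2" using assms by (intro power_mono) auto
  then show ?thesis unfolding std_normal_density_def by (intro mult_left_mono) auto
qed

text \<open>The derivative is rho times the quotient of the normal density by \<open>Phi\<close>,
  minus r. It is positive for r <= 0, and on the nonnegative axis it decreases strictly because the
  density decreases and \<open>Phi\<close> increases; so it changes sign exactly once.\<close>

lemma f_rho_unimodal:
  assumes \<rho>: "\<rho> > 0"
  obtains r where "r > 0" "\<And>x y. x < y \<Longrightarrow> y \<le> r \<Longrightarrow> f_rho \<rho> x < f_rho \<rho> y"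
    "\<And>x y. r \<le> x \<Longrightarrow> x < y \<Longrightarrow> f_rho \<rho> y < f_rho \<rho> x"
proof -
  define D where "D r = \<rho> * (std_normal_density r / Phi r) - r" for r
  have deriv: "(f_rho \<rho> has_real_derivative D r) (at r)" for r
  proof -
    have "((\<lambda>r. \<rho> * ln (Phi r) - r\<^sup>2 / 2) has_real_derivative (\<rho> * (1 / Phi r * std_normal_density r) - 2 * r / 2)) (at r)"
      using Phi_pos[of r] Phi_deriv[of r] by (auto intro!: derivative_eq_intros)
    then show ?thesis unfolding f_rho_def[abs_def] D_def by simp
  qed
  have quot: "std_normal_density s / Phi s \<le> std_normal_density r / Phi r" if "0 \<le> r" "r \<le> s" for r s
    using that Phi_pos[of r] Phi_mono[of r s] std_normal_density_antimono[of r s]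
    by (intro frac_le) auto
  have dec: "D s < D r" if "0 \<le> r" "r < s" for r s
    using mult_left_mono[OF quot[of r s], of \<rho>] that \<rho> unfolding D_def by simp
  have neg: "D r > 0" if "r \<le> 0" for r
  proof -
    have "\<rho> * (std_normal_density r / Phi r) > 0"
      using \<rho> Phi_pos[of r] normal_density_pos[of 1 0 r] by simp
    then show ?thesis using that by (simp add: D_def)
  qed
  \<comment> \<open>On the nonnegative axis the quotient in \<open>D\<close> is largest at 0, so
    \<open>D\<close> is at most 0 at \<open>K\<close>; this brackets the zero.\<close>
  define K where "K = \<rho> * (std_normal_density 0 / Phi 0)"
  have K: "K > 0" unfolding K_def using \<rho> Phi_pos[of 0] normal_density_pos[of 1 0 0] by simp
  have "D K \<le> 0"
    using mult_left_mono[OF quot[of 0 K], of \<rho>] K \<rho> unfolding D_def K_def by simp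
  moreover have "D 0 > 0" by (rule neg) simp
  moreover have "continuous_on {0..K} D"
  proof -
    have "continuous_on {0..K} Phi"
      by (intro DERIV_atLeastAtMost_imp_continuous_on) (use Phi_deriv in blast)
    moreover have "\<forall>x\<in>{0..K}. Phi x \<noteq> 0" using Phi_pos by (metis less_irrefl)
    ultimately show ?thesis unfolding D_def
      by (intro continuous_intros std_normal_density_continuous)
  qed
  ultimately obtain r where r: "0 \<le> r" "r \<le> K" "D r = 0"
    using IVT2'[of D K 0 0] K by auto
  have r0: "r > 0" using r \<open>D 0 > 0\<close> by (cases "r = 0") auto
  have pos: "D x > 0" if "x < r" for x
    using neg[of x] dec[of x r] that r by (cases "x \<le> 0") auto
  have neg': "D x < 0" if "r < x" for x using dec[of r x] that r by simp
  have cont: "continuous_on A (f_rho \<rho>)" for A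
    using deriv by (meson DERIV_isCont continuous_at_imp_continuous_on)
  show thesis
  proof (rule that[OF r0])
    fix x y :: real assume xy: "x < y" "y \<le> r"
    show "f_rho \<rho> x < f_rho \<rho> y"
      by (rule DERIV_pos_imp_increasing_open[OF xy(1)]) (use xy deriv pos cont in \<open>force+\<close>)
  next
    fix x y :: real assume xy: "r \<le> x" "x < y"
    show "f_rho \<rho> y < f_rho \<rho> x"
      by (rule DERIV_neg_imp_decreasing_open[OF xy(2)]) (use xy deriv neg' cont in \<open>force+\<close>)
  qed
qed

section \<open>Exponential bounds for \<open>srad\<close> and the Gaussian limit of one
  coordinate\<close>

lemma sqrt_exp: "sqrt (exp a) = exp (a / 2)"
  by (rule real_sqrt_unique) (simp_all add: power2_eq_square flip: exp_add)

lemma srad_le_exp: "srad u \<le> exp (- u\<^sup>2 / 2)"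
proof -
  have "max 0 (1 - u\<^sup>2) \<le> exp (- u\<^sup>2)" using exp_ge_add_one_self[of "- u\<^sup>2"] by simp
  then have "srad u \<le> sqrt (exp (- u\<^sup>2))" unfolding srad_def by (rule real_sqrt_le_mono)
  also have "\<dots> = exp (- u\<^sup>2 / 2)" by (rule sqrt_exp)
  finally show ?thesis .
qed

text \<open>From 1 / (1 - v) = 1 + v / (1 - v) <= exp (v / (1 - v)) with v = u^2. Near u = 0 the
  exponent agrees to leading order with the one in \<open>srad_le_exp\<close>.\<close>

lemma srad_ge_exp: assumes "u\<^sup>2 < 1" shows "exp (- (u\<^sup>2 / (1 - u\<^sup>2)) / 2) \<le> srad u"
proof -
  define v where "v = u\<^sup>2"
  have v: "v < 1" using assms by (simp add: v_def)
  have "1 / (1 - v) = 1 + v / (1 - v)" using v by (simp add: field_simps)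
  also have "\<dots> \<le> exp (v / (1 - v))" by (rule exp_ge_add_one_self)
  finally have "exp (- (v / (1 - v))) \<le> 1 - v" using v by (simp add: exp_minus field_simps)
  then have "sqrt (exp (- (v / (1 - v)))) \<le> sqrt (1 - v)" by (rule real_sqrt_le_mono)
  moreover have "srad u = sqrt (1 - v)" using v by (simp add: srad_def v_def)
  ultimately show ?thesis unfolding sqrt_exp v_def by simp
qed

lemma srad_power_le_exp:
  assumes "d > 0" shows "srad (x / sqrt d) ^ m \<le> exp (- (real m / real d) * x\<^sup>2 / 2)"
proof -
  have "srad (x / sqrt d) ^ m \<le> exp (- (x / sqrt d)\<^sup>2 / 2) ^ m"
    by (intro power_mono srad_le_exp srad_nonneg)
  also have "\<dots> = exp (- (real m / real d) * x\<^sup>2 / 2)"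
    using assms by (simp add: exp_of_nat_mult[symmetric] power_divide)
  finally show ?thesis .
qed

lemma gauss_integrable: "integrable lborel (\<lambda>x::real. exp (- x\<^sup>2 / 2))"
proof -
  have "integrable lborel (\<lambda>x. sqrt (2 * pi) * std_normal_density x)" by simp
  then show ?thesis by (simp add: std_normal_density_def)
qed

lemma gauss_integral: "(LBINT x. exp (- x\<^sup>2 / 2)) = sqrt (2 * pi)"
proof -
  have "(LBINT x. sqrt (2 * pi) * std_normal_density x) = sqrt (2 * pi)"
    using integral_normal_density[of 1 0] by simp
  then show ?thesis by (simp add: std_normal_density_def)
qed

lemma gauss_integrable': "c > 0 \<Longrightarrow> integrable lborel (\<lambda>x::real. exp (- c * x\<^sup>2))"
proof -
  assume c: "c > 0"
  have "integrable lborel (\<lambda>x. exp (- (0 + sqrt (2 * c) * x)\<^sup>2 / 2))"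
    by (rule lborel_integrable_real_affine[OF gauss_integrable]) (use c in auto)
  then show ?thesis using c by (simp add: power_mult_distrib)
qed

text \<open>Unnormalised density of sqrt d times one coordinate.\<close>

definition coord_density :: "nat \<Rightarrow> real \<Rightarrow> real" where "coord_density d x = srad (x / sqrt d) ^ (d - 3)"

lemma coord_density_measurable[measurable]: "coord_density d \<in> borel_measurable borel"
  unfolding coord_density_def by measurable

lemma coord_density_nonneg: "0 \<le> coord_density d x" by (simp add: coord_density_def srad_nonneg)

text \<open>For d >= 4 the ratio (d - 3) / d is at least 1 / 4, which gives the constant 1 / 8 and
  one integrable majorant for all these dimensions.\<close>

lemma coord_density_bound: assumes "d \<ge> 4" shows "coord_density d x \<le> exp (- (1/8) * x\<^sup>2)"
proof -
  define c where "c = real (d - 3) / real d"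
  have "real (d - 3) = real d - 3" "real d \<ge> 4" using assms by (simp_all add: of_nat_diff)
  then have "1 / 4 \<le> c" by (simp add: c_def field_simps)
  then have "1 / 4 * x\<^sup>2 \<le> c * x\<^sup>2" by (intro mult_right_mono) auto
  then have "- c * x\<^sup>2 / 2 \<le> - (1/8) * x\<^sup>2" by linarith
  then have "exp (- c * x\<^sup>2 / 2) \<le> exp (- (1/8) * x\<^sup>2)" by (simp only: exp_le_cancel_iff)
  moreover have "coord_density d x \<le> exp (- c * x\<^sup>2 / 2)"
    unfolding coord_density_def c_def by (rule srad_power_le_exp) (use assms in simp)
  ultimately show ?thesis by linarith
qed

lemma coord_density_tendsto: "(\<lambda>d. coord_density d x) \<longlonglongrightarrow> exp (- x\<^sup>2 / 2)"
proof -
  have "(\<lambda>d::nat. (1 - x\<^sup>2 / real d) powr ((real d - 3) / 2)) \<longlonglongrightarrow> exp (- x\<^sup>2 / 2)"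
    by real_asymp
  moreover have "\<forall>\<^sub>F d in sequentially. (1 - x\<^sup>2 / real d) powr ((real d - 3) / 2) = coord_density d x"
  proof -
    have "\<forall>\<^sub>F d::nat in sequentially. x\<^sup>2 < real d" by real_asymp
    then show ?thesis using eventually_ge_at_top[of 4]
    proof eventually_elim
      case (elim d)
      define y where "y = 1 - x\<^sup>2 / real d"
      have y: "y > 0" using elim by (simp add: y_def field_simps)
      have "srad (x / sqrt d) = sqrt y" using y by (simp add: srad_def power_divide y_def)
      then have "coord_density d x = (y powr (1/2)) ^ (d - 3)" using y by (simp add: coord_density_def powr_half_sqrt)
      also have "\<dots> = (y powr (1/2)) powr real (d - 3)" using y by (simp add: powr_realpow)
      also have "\<dots> = y powr ((real d - 3) / 2)" using elim(2) by (simp add: powr_powr of_nat_diff)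
      finally show ?case by (simp add: y_def)
    qed
  qed
  ultimately show ?thesis by (rule Lim_transform_eventually)
qed

lemma coord_density_integrable: "d \<ge> 4 \<Longrightarrow> integrable lborel (coord_density d)"
  by (rule Bochner_Integration.integrable_bound[OF gauss_integrable'[of "1/8"]])
    (auto simp: coord_density_nonneg intro!: coord_density_bound[simplified])

text \<open>Dominated convergence with the majorant of \<open>coord_density_bound\<close>; the shift
  by 4 restricts to the dimensions where it holds.\<close>

lemma coord_density_L1:
  "(\<lambda>d. LBINT x. \<bar>coord_density d x - exp (- x\<^sup>2 / 2)\<bar>) \<longlonglongrightarrow> 0"
proof -
  have "(\<lambda>d. LBINT x. \<bar>coord_density (d + 4) x - exp (- x\<^sup>2 / 2)\<bar>) \<longlonglongrightarrow> (LBINT (x::real). 0)"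
  proof (rule integral_dominated_convergence[where w = "\<lambda>x. exp (- (1/8) * x\<^sup>2) + exp (- x\<^sup>2 / 2)"])
    show "integrable lborel (\<lambda>x::real. exp (- (1/8) * x\<^sup>2) + exp (- x\<^sup>2 / 2))"
      by (intro Bochner_Integration.integrable_add gauss_integrable gauss_integrable') simp
    show "AE x in lborel. (\<lambda>d. \<bar>coord_density (d + 4) x - exp (- x\<^sup>2 / 2)\<bar>) \<longlonglongrightarrow> 0"
    proof (rule AE_I2)
      fix x
      have "(\<lambda>d. coord_density (d + 4) x) \<longlonglongrightarrow> exp (- x\<^sup>2 / 2)" by (rule LIMSEQ_ignore_initial_segment[OF coord_density_tendsto])
      then have "(\<lambda>d. \<bar>coord_density (d + 4) x - exp (- x\<^sup>2 / 2)\<bar>) \<longlonglongrightarrow> \<bar>exp (- x\<^sup>2 / 2) - exp (- x\<^sup>2 / 2)\<bar>"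
        by (intro tendsto_rabs tendsto_diff tendsto_const)
      then show "(\<lambda>d. \<bar>coord_density (d + 4) x - exp (- x\<^sup>2 / 2)\<bar>) \<longlonglongrightarrow> 0" by simp
    qed
    show "AE x in lborel. norm \<bar>coord_density (d + 4) x - exp (- x\<^sup>2 / 2)\<bar> \<le> exp (- (1/8) * x\<^sup>2) + exp (- x\<^sup>2 / 2)" for d
    proof (rule AE_I2)
      fix x
      show "norm \<bar>coord_density (d + 4) x - exp (- x\<^sup>2 / 2)\<bar> \<le> exp (- (1/8) * x\<^sup>2) + exp (- x\<^sup>2 / 2)"
        using coord_density_bound[of "d + 4" x] coord_density_nonneg[of "d + 4" x] exp_gt_zero[of "- x\<^sup>2 / 2"]
        unfolding real_norm_def abs_abs by linarith
    qed
  qed measurable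
  then have "(\<lambda>d. LBINT x. \<bar>coord_density (d + 4) x - exp (- x\<^sup>2 / 2)\<bar>) \<longlonglongrightarrow> 0" by simp
  then show ?thesis by (rule LIMSEQ_offset)
qed

text \<open>Convergence of the densities in \<open>L\<^sup>1\<close> makes the convergence of the distribution functions uniform.\<close>

lemma coord_cdf_uniform:
  obtains \<eta> where "\<eta> \<longlonglongrightarrow> 0" "\<And>d x. d \<ge> 4 \<Longrightarrow> \<bar>coord_cdf d (x / sqrt d) - Phi x\<bar> \<le> \<eta> d"
proof -
  let ?g = "\<lambda>x::real. exp (- x\<^sup>2 / 2)"
  define N where "N = sqrt (2 * pi)"
  have N: "N > 0" by (simp add: N_def)
  define Nd where "Nd d = (LBINT x. coord_density d x)" for d
  define e where "e d = (LBINT x. \<bar>coord_density d x - ?g x\<bar>)" for d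
  \<comment> \<open>The first term accounts for the unnormalised integrals, the second for the
    change between the normalising constants \<open>Nd d\<close> and \<open>N\<close>; neither
    involves \<open>x\<close>.\<close>
  define \<eta> where "\<eta> d = e d / Nd d + N * \<bar>1 / Nd d - 1 / N\<bar>" for d
  have e0: "e \<longlonglongrightarrow> 0" unfolding e_def by (rule coord_density_L1)
  have part: "\<bar>(LBINT x. indicator A x * coord_density d x) - (LBINT x. indicator A x * ?g x)\<bar> \<le> e d"
    if d: "d \<ge> 4" and A[measurable]: "A \<in> sets borel" for A d
  proof -
    have i1: "integrable lborel (\<lambda>x. indicator A x * coord_density d x)"
      using integrable_real_mult_indicator[OF _ coord_density_integrable[OF d], of A] by (simp add: mult.commute)
    have i2: "integrable lborel (\<lambda>x. indicator A x * ?g x)"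
      using integrable_real_mult_indicator[OF _ gauss_integrable, of A] by (simp add: mult.commute)
    have "\<bar>(LBINT x. indicator A x * coord_density d x) - (LBINT x. indicator A x * ?g x)\<bar> =
      \<bar>LBINT x. indicator A x * coord_density d x - indicator A x * ?g x\<bar>"
      using i1 i2 by (simp add: Bochner_Integration.integral_diff)
    also have "\<dots> \<le> (LBINT x. \<bar>indicator A x * coord_density d x - indicator A x * ?g x\<bar>)"
      by (rule integral_abs_bound)
    also have "\<dots> \<le> e d"
      unfolding e_def
      by (rule integral_mono)
        (use i1 i2 coord_density_integrable[OF d] gauss_integrable in \<open>auto simp: indicator_def intro!: Bochner_Integration.integrable_diff Bochner_Integration.integrable_abs\<close>)
    finally show ?thesis .
  qed
  have NdN: "\<bar>Nd d - N\<bar> \<le> e d" if "d \<ge> 4" for d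
    using part[OF that, of UNIV] by (simp only: Nd_def N_def gauss_integral indicator_UNIV mult_1_left) simp
  have NdL: "Nd \<longlonglongrightarrow> N"
  proof -
    have "(\<lambda>d. Nd d - N) \<longlonglongrightarrow> 0"
      by (rule Lim_null_comparison[OF _ e0])
        (use NdN in \<open>auto intro!: eventually_mono[OF eventually_ge_at_top[of 4]]\<close>)
    then show ?thesis by (simp add: LIM_zero_iff)
  qed
  have "\<eta> \<longlonglongrightarrow> 0 / N + N * \<bar>1 / N - 1 / N\<bar>"
    unfolding \<eta>_def[abs_def] using N by (intro tendsto_intros e0 NdL) auto
  then have \<eta>0: "\<eta> \<longlonglongrightarrow> 0" by simp
  have main: "\<bar>coord_cdf d (x / sqrt d) - Phi x\<bar> \<le> \<eta> d" if d: "d \<ge> 4" for d x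
  proof -
    have sd: "sqrt d > 0" using d by simp
    have sub: "(LBINT t. f t) = (1 / sqrt d) * (LBINT x. f (x / sqrt d))" for f :: "real \<Rightarrow> real"
      using lborel_integral_real_affine[of "1 / sqrt d" f 0] sd by simp
    have w: "coord_mass d = (1 / sqrt d) * Nd d" unfolding coord_mass_def by (subst sub) (simp add: Nd_def coord_density_def)
    have "(LBINT t. indicator {..x / sqrt d} t * srad t ^ (d - 3)) = (1 / sqrt d) * (LBINT y. indicator {..x / sqrt d} (y / sqrt d) * coord_density d y)"
      by (subst sub) (simp add: coord_density_def)
    also have "(LBINT y. indicator {..x / sqrt d} (y / sqrt d) * coord_density d y) = (LBINT y. indicator {..x} y * coord_density d y)"
      by (rule Bochner_Integration.integral_cong) (use sd in \<open>auto simp: indicator_def divide_le_cancel\<close>)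
    finally have F: "coord_cdf d (x / sqrt d) = (LBINT y. indicator {..x} y * coord_density d y) / Nd d"
      unfolding coord_cdf_def w using sd by simp
    have Nd: "Nd d > 0" using coord_mass_pos[OF d] sd unfolding w by (simp add: zero_less_mult_iff zero_less_divide_iff)
    have P: "Phi x = (LBINT y. indicator {..x} y * ?g y) / N"
      unfolding Phi_eq by (simp add: std_normal_density_def N_def mult.commute mult.left_commute flip: integral_divide_zero)
    define a where "a = (LBINT y. indicator {..x} y * coord_density d y)"
    define b where "b = (LBINT y. indicator {..x} y * ?g y)"
    have ab: "\<bar>a - b\<bar> \<le> e d" unfolding a_def b_def by (rule part[OF d]) simp
    have b: "0 \<le> b" "b \<le> N"
      using Phi_nonneg[of x] Phi_le_1[of x] N unfolding P b_def[symmetric] by (auto simp: field_simps zero_le_divide_iff)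
    have "a / Nd d - b / N = (a - b) / Nd d + b * (1 / Nd d - 1 / N)"
      by (simp add: diff_divide_distrib right_diff_distrib)
    then have "\<bar>a / Nd d - b / N\<bar> \<le> \<bar>(a - b) / Nd d\<bar> + \<bar>b * (1 / Nd d - 1 / N)\<bar>" by linarith
    also have "\<bar>(a - b) / Nd d\<bar> \<le> e d / Nd d" using ab Nd by (simp add: abs_divide divide_right_mono)
    also have "\<bar>b * (1 / Nd d - 1 / N)\<bar> \<le> N * \<bar>1 / Nd d - 1 / N\<bar>"
      using b by (simp add: abs_mult mult_right_mono)
    finally show ?thesis unfolding F P \<eta>_def a_def b_def by simp
  qed
  show thesis by (rule that[OF \<eta>0 main])
qed

text \<open>Uniform continuity of u powr s on the compact set [0, 1] x [rho / 2, 2 rho]. Keeping the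
  exponent away from 0 retains continuity at u = 0, so the comparison is uniform even where
  \<open>Phi\<close> is close to 0 and logarithms would diverge.\<close>

lemma powr_uniform:
  fixes \<rho> \<delta> :: real
  assumes \<rho>: "\<rho> > 0" and \<delta>: "\<delta> > 0"
  obtains \<gamma> where "\<gamma> > 0"
    "\<And>u v s. 0 \<le> u \<Longrightarrow> u \<le> 1 \<Longrightarrow> 0 \<le> v \<Longrightarrow> v \<le> 1 \<Longrightarrow> \<bar>u - v\<bar> < \<gamma> \<Longrightarrow> \<bar>s - \<rho>\<bar> < \<gamma> \<Longrightarrow> u powr s \<le> v powr \<rho> + \<delta>"
proof -
  let ?S = "{0..1} \<times> {\<rho> / 2..2 * \<rho>}"
  have "continuous_on ?S (\<lambda>p. fst p powr snd p)"
    by (rule continuous_on_powr') (use \<rho> in \<open>auto intro!: continuous_intros\<close>)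
  then have "uniformly_continuous_on ?S (\<lambda>p. fst p powr snd p)"
    by (rule compact_uniformly_continuous) (intro compact_Times compact_Icc)
  then have "\<forall>e>0. \<exists>\<gamma>>0. \<forall>p\<in>?S. \<forall>q\<in>?S. dist q p < \<gamma> \<longrightarrow> dist (fst q powr snd q) (fst p powr snd p) < e"
    by (simp only: uniformly_continuous_on_def)
  then obtain \<gamma> where \<gamma>: "\<gamma> > 0"
    "\<forall>p\<in>?S. \<forall>q\<in>?S. dist q p < \<gamma> \<longrightarrow> dist (fst q powr snd q) (fst p powr snd p) < \<delta>"
    using \<delta> by meson
  show thesis
  proof (rule that[of "min (\<rho> / 2) (\<gamma> / 2)"])
    fix u v s :: real
    assume a: "0 \<le> u" "u \<le> 1" "0 \<le> v" "v \<le> 1" "\<bar>u - v\<bar> < min (\<rho> / 2) (\<gamma> / 2)" "\<bar>s - \<rho>\<bar> < min (\<rho> / 2) (\<gamma> / 2)"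
    have "dist (u, s) (v, \<rho>) \<le> dist u v + dist s \<rho>"
      unfolding dist_Pair_Pair by (rule sqrt_sum_squares_le_sum) auto
    then have "dist (u, s) (v, \<rho>) < \<gamma>" using a by (simp add: dist_real_def)
    moreover have "\<bar>s - \<rho>\<bar> < \<rho> / 2" using a(6) by simp
    then have "\<rho> / 2 \<le> s" "s \<le> 2 * \<rho>" using \<rho> by (linarith+)
    then have "(u, s) \<in> ?S" using a(1,2) by simp
    moreover have "(v, \<rho>) \<in> ?S" using a(3,4) \<rho> by simp
    ultimately have "dist (fst (u, s) powr snd (u, s)) (fst (v, \<rho>) powr snd (v, \<rho>)) < \<delta>" using \<gamma>(2) by blast
    then have "\<bar>u powr s - v powr \<rho>\<bar> < \<delta>" by (simp only: dist_real_def fst_conv snd_conv)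
    then show "u powr s \<le> v powr \<rho> + \<delta>" by linarith
  qed (use \<rho> \<gamma> in auto)
qed

lemma exp_f_rho: "exp (f_rho \<rho> x) = Phi x powr \<rho> * exp (- x\<^sup>2 / 2)"
proof -
  have "f_rho \<rho> x = \<rho> * ln (Phi x) + - x\<^sup>2 / 2" by (simp add: f_rho_def)
  then have "exp (f_rho \<rho> x) = exp (\<rho> * ln (Phi x)) * exp (- x\<^sup>2 / 2)" by (simp only: exp_add)
  then show ?thesis using Phi_pos[of x] by (simp add: powr_def)
qed

text \<open>After v = x / sqrt d the integrand is roughly the \<open>d\<close>-th power of exp
  (f_rho x). Outside the window each factor is at most \<open>q0\<close>, on an interval next to the
  maximiser at least \<open>q1\<close> > \<open>q0\<close>, so the quotient is bounded by a
  geometric sequence. One Gaussian factor is held back in the numerator to keep the bound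
  integrable.\<close>

lemma laplace:
  fixes d :: "nat \<Rightarrow> nat" and \<psi> :: "real \<Rightarrow> real"
  assumes \<rho>: "\<rho> > 0" and d: "filterlim d at_top sequentially"
    and dn: "\<forall>\<^sub>F n in sequentially. d n < n"
    and reg: "(\<lambda>n. (real n - real (d n)) / real (d n)) \<longlonglongrightarrow> \<rho>"
    and inc: "\<And>x y. x < y \<Longrightarrow> y \<le> r \<Longrightarrow> f_rho \<rho> x < f_rho \<rho> y"
    and dec: "\<And>x y. r \<le> x \<Longrightarrow> x < y \<Longrightarrow> f_rho \<rho> y < f_rho \<rho> x"
    and r: "r > 0" and \<epsilon>: "\<epsilon> > 0"
    and \<psi>m[measurable]: "\<psi> \<in> borel_measurable borel"
    and \<psi>: "\<And>x. 0 \<le> \<psi> x" "\<And>x. \<psi> x \<le> 1" "\<And>x. \<bar>x - r\<bar> < \<epsilon> \<Longrightarrow> \<psi> x = 0"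
  shows "(\<lambda>n. (LBINT v. \<psi> (sqrt (d n) * v) * coord_cdf (d n) v ^ (n - d n) * srad v ^ hexp (d n)) /
    (LBINT v. indicator {0<..} v * coord_cdf (d n) v ^ (n - d n) * srad v ^ hexp (d n))) \<longlonglongrightarrow> 0"
proof -
  \<comment> \<open>By unimodality the supremum of exp (f_rho x) outside the window is attained at
    one of its two edges.\<close>
  define M' where "M' = exp (max (f_rho \<rho> (r - \<epsilon>)) (f_rho \<rho> (r + \<epsilon>)))"
  have M'lt: "M' < exp (f_rho \<rho> r)"
    unfolding M'_def using inc[of "r - \<epsilon>" r] dec[of r "r + \<epsilon>"] \<epsilon> by simp
  have out: "exp (f_rho \<rho> x) \<le> M'" if "\<not> \<bar>x - r\<bar> < \<epsilon>" for x
  proof (cases "x \<le> r - \<epsilon>")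
    case True
    then have "f_rho \<rho> x \<le> f_rho \<rho> (r - \<epsilon>)" using inc[of x "r - \<epsilon>"] \<epsilon> by (cases "x = r - \<epsilon>") auto
    then show ?thesis by (simp add: M'_def)
  next
    case False
    then have "x \<ge> r + \<epsilon>" using that by linarith
    then have "f_rho \<rho> x \<le> f_rho \<rho> (r + \<epsilon>)" using dec[of "r + \<epsilon>" x] \<epsilon> by (cases "x = r + \<epsilon>") auto
    then show ?thesis by (simp add: M'_def)
  qed
  \<comment> \<open>Lower bound for exp (f_rho x) on [r, r + \<kappa>]: \<open>Phi\<close> is taken
    at the left end and the Gaussian factor at the right end. It tends to the maximum as \<kappa>
    tends to 0.\<close>
  define b where "b \<kappa> = Phi r powr \<rho> * exp (- (r + \<kappa>)\<^sup>2 / 2)" for \<kappa>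
  have "isCont b 0" unfolding b_def[abs_def] by (intro continuous_intros) auto
  then have "(b \<longlongrightarrow> exp (f_rho \<rho> r)) (at 0)" by (simp add: isCont_def b_def exp_f_rho)
  then have "\<forall>\<^sub>F \<kappa> in at 0. b \<kappa> > M'" using M'lt by (rule order_tendstoD)
  then obtain k0 where k0: "k0 > 0" "\<And>\<kappa>. \<kappa> \<noteq> 0 \<Longrightarrow> dist \<kappa> 0 < k0 \<Longrightarrow> b \<kappa> > M'"
    unfolding eventually_at by auto
  define \<kappa> where "\<kappa> = k0 / 2"
  have \<kappa>: "\<kappa> > 0" "b \<kappa> > M'" using k0(1) k0(2)[of \<kappa>] by (auto simp: \<kappa>_def dist_real_def)
  \<comment> \<open>The gap between \<open>M'\<close> and \<open>b \<kappa>\<close> is cut into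
    thirds: the lower third absorbs the errors in the numerator, the upper one those in the
    denominator, and the middle one gives q0 < q1.\<close>
  define q0 where "q0 = M' + (b \<kappa> - M') / 3"
  define q1 where "q1 = M' + 2 * (b \<kappa> - M') / 3"
  have M'0: "M' > 0" by (simp add: M'_def)
  have q: "M' < q0" "q0 < q1" "q1 < b \<kappa>" "0 < q0" using \<kappa>(2) M'0 by (auto simp: q0_def q1_def field_simps)
  obtain \<gamma> where \<gamma>: "\<gamma> > 0"
    "\<And>u v s. 0 \<le> u \<Longrightarrow> u \<le> 1 \<Longrightarrow> 0 \<le> v \<Longrightarrow> v \<le> 1 \<Longrightarrow> \<bar>u - v\<bar> < \<gamma> \<Longrightarrow> \<bar>s - \<rho>\<bar> < \<gamma> \<Longrightarrow> u powr s \<le> v powr \<rho> + (q0 - M')"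
    using powr_uniform[OF \<rho>, of "q0 - M'"] q by auto
  obtain \<eta> where \<eta>: "\<eta> \<longlonglongrightarrow> 0" "\<And>d x. d \<ge> 4 \<Longrightarrow> \<bar>coord_cdf d (x / sqrt d) - Phi x\<bar> \<le> \<eta> d"
    by (rule coord_cdf_uniform) blast
  define L where "L = (r + \<kappa>)\<^sup>2"
  have dreal: "filterlim (\<lambda>n. real (d n)) at_top sequentially"
    by (rule filterlim_compose[OF filterlim_real_sequentially d])
  have lim_inv: "(\<lambda>n. c / real (d n)) \<longlonglongrightarrow> 0" for c
    by (rule tendsto_divide_0[OF tendsto_const filterlim_at_top_imp_at_infinity[OF dreal]])
  have \<eta>d: "(\<lambda>n. \<eta> (d n)) \<longlonglongrightarrow> 0" by (rule filterlim_compose[OF \<eta>(1) d])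
  have ev_d: "\<forall>\<^sub>F n in sequentially. d n \<ge> c" for c
    using d by (simp add: filterlim_at_top)
  \<comment> \<open>The exponent \<open>n - d n\<close> is spread over \<open>d n - 4\<close>
    factors, since d - 3 Gaussian factors are available in the numerator and one of them stays
    outside the power.\<close>
  have lim_m4: "(\<lambda>n. real (n - d n) / real (d n - 4)) \<longlonglongrightarrow> \<rho>"
  proof -
    have "(\<lambda>n. ((real n - real (d n)) / real (d n)) / (1 - 4 / real (d n))) \<longlonglongrightarrow> \<rho> / (1 - 0)"
      by (intro tendsto_divide reg tendsto_diff tendsto_const lim_inv) auto
    moreover have "\<forall>\<^sub>F n in sequentially. ((real n - real (d n)) / real (d n)) / (1 - 4 / real (d n)) = real (n - d n) / real (d n - 4)"
      using dn ev_d[of 5]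
    proof eventually_elim
      case (elim n)
      then have "real (n - d n) = real n - real (d n)" "real (d n - 4) = real (d n) - 4" "real (d n) \<ge> 5"
        by (auto simp: of_nat_diff)
      then show ?case by (simp add: field_simps)
    qed
    ultimately show ?thesis by (simp add: Lim_transform_eventually)
  qed
  have lim_m: "(\<lambda>n. real (n - d n) / real (d n)) \<longlonglongrightarrow> \<rho>"
    by (rule Lim_transform_eventually[OF reg]) (use dn in \<open>auto elim!: eventually_mono simp: of_nat_diff\<close>)
  \<comment> \<open>Version of \<open>b \<kappa>\<close> before the limit; its \<open>d n\<close>-th
    power bounds the integrand from below on [r, r + \<kappa>]. The term 1 - L / d comes from
    \<open>srad_ge_exp\<close>.\<close>
  define bn where "bn n = coord_cdf (d n) (r / sqrt (d n)) powr (real (n - d n) / real (d n)) * exp (- (L / (1 - L / real (d n))) / 2)" for n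
  have "bn \<longlonglongrightarrow> b \<kappa>"
  proof -
    have "(\<lambda>n. coord_cdf (d n) (r / sqrt (d n))) \<longlonglongrightarrow> Phi r"
    proof -
      have "(\<lambda>n. coord_cdf (d n) (r / sqrt (d n)) - Phi r) \<longlonglongrightarrow> 0"
        by (rule Lim_null_comparison[OF _ \<eta>d])
          (use ev_d[of 4] in \<open>auto elim!: eventually_mono intro!: \<eta>(2)\<close>)
      then show ?thesis by (simp add: LIM_zero_iff)
    qed
    then have 1: "(\<lambda>n. coord_cdf (d n) (r / sqrt (d n)) powr (real (n - d n) / real (d n))) \<longlonglongrightarrow> Phi r powr \<rho>"
      using Phi_pos[of r] by (intro tendsto_powr lim_m) auto
    have 2: "(\<lambda>n. exp (- (L / (1 - L / real (d n))) / 2)) \<longlonglongrightarrow> exp (- (L / (1 - 0)) / 2)"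
      by (intro tendsto_exp tendsto_divide tendsto_minus tendsto_diff tendsto_const lim_inv) auto
    show ?thesis unfolding bn_def[abs_def] b_def using tendsto_mult[OF 1 2] by (simp add: L_def)
  qed
  then have ev_b: "\<forall>\<^sub>F n in sequentially. bn n > q1" using q(3) by (rule order_tendstoD)
  have ev_\<eta>: "\<forall>\<^sub>F n in sequentially. \<eta> (d n) < \<gamma>" using order_tendstoD(2)[OF \<eta>d \<gamma>(1)] .
  have ev_s: "\<forall>\<^sub>F n in sequentially. \<bar>real (n - d n) / real (d n - 4) - \<rho>\<bar> < \<gamma>"
    using tendstoD[OF lim_m4 \<gamma>(1)] by (simp add: dist_real_def)
  have ev_L: "\<forall>\<^sub>F n in sequentially. L / real (d n) < 1"
    using order_tendstoD(2)[OF lim_inv[of L], of 1] by simp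
  let ?num = "\<lambda>n. LBINT v. \<psi> (sqrt (d n) * v) * coord_cdf (d n) v ^ (n - d n) * srad v ^ hexp (d n)"
  let ?den = "\<lambda>n. LBINT v. indicator {0<..} v * coord_cdf (d n) v ^ (n - d n) * srad v ^ hexp (d n)"
  have bound: "\<forall>\<^sub>F n in sequentially. norm (?num n / ?den n) \<le> sqrt (2 * pi) / (\<kappa> * q0 ^ 4) * (q0 / q1) ^ d n"
    using dn ev_d[of 5] ev_b ev_\<eta> ev_s ev_L
  proof eventually_elim
    case (elim n)
    define D where "D = d n"
    define m where "m = n - D"
    have D: "D \<ge> 5" "D \<ge> 4" "m > 0" using elim by (auto simp: D_def m_def)
    have Dm[measurable]: "coord_cdf D \<in> borel_measurable borel"
      by (rule borel_measurable_continuous_onI[OF coord_cdf_continuous[OF D(2)]])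
    have sD: "sqrt D > 0" using D by simp
    have eeD: "D * (D - 3) \<le> hexp D" "hexp D \<le> D * D" "0 < hexp D"
    proof -
      obtain k where "D = k + 5" using D(1) le_Suc_ex[of 5 D] by (auto simp: add.commute)
      then show "D * (D - 3) \<le> hexp D" "hexp D \<le> D * D" "0 < hexp D"
        by (auto simp: hexp_def algebra_simps)
    qed
    have sub: "(LBINT t. f t) = (1 / sqrt D) * (LBINT x. f (x / sqrt D))" for f :: "real \<Rightarrow> real"
      using lborel_integral_real_affine[of "1 / sqrt D" f 0] sD by simp
    let ?a = "\<lambda>x. coord_cdf D (x / sqrt D) ^ m * srad (x / sqrt D) ^ hexp D"
    have a0: "0 \<le> ?a x" for x using coord_cdf_nonneg[OF D(2)] by (simp add: srad_nonneg)
    have num: "?num n = (1 / sqrt D) * (LBINT x. \<psi> x * ?a x)"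
      unfolding D_def[symmetric] m_def[symmetric] by (subst sub) (use sD in \<open>simp add: mult.assoc\<close>)
    have den: "?den n = (1 / sqrt D) * (LBINT x. indicator {0<..} x * ?a x)"
    proof -
      have "indicator {0<..} (x / sqrt D) = (indicator {0<..} x :: real)" for x
        using sD by (simp add: indicator_def zero_less_divide_iff)
      then show ?thesis
        unfolding D_def[symmetric] m_def[symmetric] by (subst sub) (simp add: mult.assoc)
    qed
    \<comment> \<open>\<open>hexp D\<close> / D is at least D - 3, which supplies D - 3 Gaussian
      factors.\<close>
    have a_exp: "srad (x / sqrt D) ^ hexp D \<le> exp (- x\<^sup>2 / 2) ^ (D - 4) * exp (- x\<^sup>2 / 2)" for x
    proof -
      have "real (D * (D - 3)) \<le> real (hexp D)" using eeD(1) by (simp only: of_nat_le_iff)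
      then have "real (D - 3) \<le> real (hexp D) / real D" using D by (simp add: field_simps)
      then have "real (D - 3) * x\<^sup>2 \<le> real (hexp D) / real D * x\<^sup>2" by (intro mult_right_mono) auto
      moreover have "- C / 2 \<le> - E / 2" if "E \<le> C" for C E :: real using that by simp
      ultimately have 1: "- ((real (hexp D) / real D) * x\<^sup>2) / 2 \<le> - (real (D - 3) * x\<^sup>2) / 2" by blast
      have "- (real (hexp D) / real D) * x\<^sup>2 / 2 = - ((real (hexp D) / real D) * x\<^sup>2) / 2"
        by (simp only: mult_minus_left)
      also note 1
      also have "- (real (D - 3) * x\<^sup>2) / 2 = real (D - 3) * (- x\<^sup>2 / 2)" by simp
      finally have "- (real (hexp D) / real D) * x\<^sup>2 / 2 \<le> real (D - 3) * (- x\<^sup>2 / 2)" .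
      then have "exp (- (real (hexp D) / real D) * x\<^sup>2 / 2) \<le> exp (real (D - 3) * (- x\<^sup>2 / 2))" by (simp only: exp_le_cancel_iff)
      also have "\<dots> = exp (- x\<^sup>2 / 2) ^ (D - 3)" by (rule exp_of_nat_mult)
      also have "D - 3 = Suc (D - 4)" using D by simp
      finally have "exp (- (real (hexp D) / real D) * x\<^sup>2 / 2) \<le> exp (- x\<^sup>2 / 2) ^ (D - 4) * exp (- x\<^sup>2 / 2)"
        by (simp only: power_Suc2)
      moreover have "srad (x / sqrt D) ^ hexp D \<le> exp (- (real (hexp D) / real D) * x\<^sup>2 / 2)"
        by (rule srad_power_le_exp) (use D in simp)
      ultimately show ?thesis by linarith
    qed
    have a_int: "integrable lborel (\<lambda>x. g x * ?a x)"
      if g[measurable]: "g \<in> borel_measurable borel" and g1: "\<And>x. \<bar>g x\<bar> \<le> 1" for g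
    proof (rule Bochner_Integration.integrable_bound[OF gauss_integrable])
      show "AE x in lborel. norm (g x * ?a x) \<le> norm (exp (- x\<^sup>2 / 2))"
      proof (rule AE_I2)
        fix x
        have "coord_cdf D (x / sqrt D) ^ m \<le> 1" using coord_cdf_nonneg[OF D(2)] coord_cdf_le_1[OF D(2)] by (simp add: power_le_one)
        moreover have "srad (x / sqrt D) ^ hexp D \<le> exp (- x\<^sup>2 / 2)"
        proof -
          have "exp (- x\<^sup>2 / 2) ^ (D - 4) \<le> 1" by (rule power_le_one) auto
          then have "exp (- x\<^sup>2 / 2) ^ (D - 4) * exp (- x\<^sup>2 / 2) \<le> 1 * exp (- x\<^sup>2 / 2)" by (rule mult_right_mono) simp
          then show ?thesis using a_exp[of x] by linarith
        qed
        ultimately have "?a x \<le> 1 * exp (- x\<^sup>2 / 2)"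
          using coord_cdf_nonneg[OF D(2)] by (intro mult_mono) (auto simp: srad_nonneg)
        moreover have "\<bar>g x\<bar> * ?a x \<le> 1 * ?a x" using g1 a0 by (intro mult_right_mono) auto
        ultimately have "\<bar>g x\<bar> * ?a x \<le> exp (- x\<^sup>2 / 2)" by simp
        then show "norm (g x * ?a x) \<le> norm (exp (- x\<^sup>2 / 2))" by (simp only: real_norm_def abs_mult[of "g x" "?a x"] abs_of_nonneg[OF a0] abs_exp_cancel)
      qed
    qed measurable
    have upper: "\<psi> x * ?a x \<le> q0 ^ (D - 4) * exp (- x\<^sup>2 / 2)" for x
    proof (cases "\<bar>x - r\<bar> < \<epsilon>")
      case True
      then show ?thesis using \<psi>(3)[OF True] q(4) by simp
    next
      case False
      let ?F = "coord_cdf D (x / sqrt D)"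
      let ?s = "real m / real (D - 4)"
      have F: "0 \<le> ?F" "?F \<le> 1" using coord_cdf_nonneg[OF D(2)] coord_cdf_le_1[OF D(2)] by auto
      have Fm: "?F ^ m = (?F powr ?s) ^ (D - 4)"
      proof (cases "?F = 0")
        case True
        then show ?thesis using D by (simp add: zero_power)
      next
        case False
        then have F0: "?F > 0" using F by simp
        then have "(?F powr ?s) ^ (D - 4) = (?F powr ?s) powr real (D - 4)" by (simp add: powr_realpow)
        also have "\<dots> = ?F powr real m" using D by (simp add: powr_powr)
        finally show ?thesis using F0 by (simp add: powr_realpow)
      qed
      \<comment> \<open>The distribution function of dimension \<open>D\<close> and the exponent
        \<open>?s\<close> are exchanged for \<open>Phi\<close> and \<rho>, uniformly in
        \<open>x\<close>, at the cost q0 - M'.\<close>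
      have "?F powr ?s \<le> Phi x powr \<rho> + (q0 - M')"
      proof (rule \<gamma>(2)[OF F Phi_nonneg Phi_le_1])
        show "\<bar>?F - Phi x\<bar> < \<gamma>" using \<eta>(2)[OF D(2), of x] elim(4) by (simp add: D_def)
        show "\<bar>?s - \<rho>\<bar> < \<gamma>" using elim(5) by (simp add: D_def m_def)
      qed
      then have "?F powr ?s * exp (- x\<^sup>2 / 2) \<le> (Phi x powr \<rho> + (q0 - M')) * exp (- x\<^sup>2 / 2)"
        by (rule mult_right_mono) simp
      also have "\<dots> = exp (f_rho \<rho> x) + (q0 - M') * exp (- x\<^sup>2 / 2)" by (simp add: exp_f_rho algebra_simps)
      also have "\<dots> \<le> M' + (q0 - M') * 1"
        using out[OF False] q by (intro add_mono mult_left_mono) auto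
      finally have key: "?F powr ?s * exp (- x\<^sup>2 / 2) \<le> q0" by simp
      have "?a x \<le> (?F powr ?s) ^ (D - 4) * (exp (- x\<^sup>2 / 2) ^ (D - 4) * exp (- x\<^sup>2 / 2))"
        unfolding Fm by (rule mult_left_mono[OF a_exp]) simp
      also have "\<dots> = (?F powr ?s * exp (- x\<^sup>2 / 2)) ^ (D - 4) * exp (- x\<^sup>2 / 2)"
        by (simp only: power_mult_distrib mult.assoc)
      also have "\<dots> \<le> q0 ^ (D - 4) * exp (- x\<^sup>2 / 2)"
        by (intro mult_right_mono power_mono key) auto
      finally have "?a x \<le> q0 ^ (D - 4) * exp (- x\<^sup>2 / 2)" .
      moreover have "\<psi> x * ?a x \<le> 1 * ?a x" using \<psi>(2) a0 by (intro mult_right_mono) auto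
      ultimately show ?thesis by simp
    qed
    have N1: "(LBINT x. \<psi> x * ?a x) \<le> q0 ^ (D - 4) * sqrt (2 * pi)"
    proof -
      have "(LBINT x. \<psi> x * ?a x) \<le> (LBINT x. q0 ^ (D - 4) * exp (- x\<^sup>2 / 2))"
        by (rule integral_mono[OF a_int]) (use \<psi> upper gauss_integrable in \<open>auto intro!: integrable_mult_right\<close>)
      then show ?thesis using gauss_integral by simp
    qed
    have lower: "bn n ^ D \<le> ?a x" if x: "r \<le> x" "x \<le> r + \<kappa>" for x
    proof -
      have x2: "x\<^sup>2 \<le> L" unfolding L_def using x r by (intro power_mono) auto
      have L0: "0 \<le> L" by (simp add: L_def)
      have emono: "exp (- P / 2) \<le> exp (- Q / 2)" if "Q \<le> P" for P Q :: real using that by simp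
      have LD: "L / D < 1" using elim(6) by (simp add: D_def)
      have "x\<^sup>2 / D \<le> L / D" using x2 by (simp add: divide_right_mono)
      then have u: "(x / sqrt D)\<^sup>2 \<le> L / D" by (simp add: power_divide)
      have e1: "exp (- ((L / D) / (1 - L / D)) / 2) \<le> srad (x / sqrt D)"
      proof -
        have "(x / sqrt D)\<^sup>2 / (1 - (x / sqrt D)\<^sup>2) \<le> (L / D) / (1 - L / D)"
          using u LD L0 D by (intro frac_le) auto
        then have "exp (- ((L / D) / (1 - L / D)) / 2) \<le> exp (- ((x / sqrt D)\<^sup>2 / (1 - (x / sqrt D)\<^sup>2)) / 2)" by (rule emono)
        also have "\<dots> \<le> srad (x / sqrt D)" by (rule srad_ge_exp) (use u LD in linarith)
        finally show ?thesis .
      qed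
      \<comment> \<open>As D L = D^2 (L / D), the bound from \<open>srad_ge_exp\<close> is taken to
        the power \<open>D * D\<close>; since \<open>srad\<close> is at most 1, the smaller exponent
        \<open>hexp D\<close> only increases the right-hand side.\<close>
      have "exp (- (L / (1 - L / D)) / 2) ^ D = exp (- ((L / D) / (1 - L / D)) / 2) ^ (D * D)"
      proof -
        have "real D * (- (L / (1 - L / D)) / 2) = real (D * D) * (- ((L / D) / (1 - L / D)) / 2)"
          using D by simp
        then show ?thesis by (simp only: exp_of_nat_mult[symmetric])
      qed
      also have "\<dots> \<le> srad (x / sqrt D) ^ (D * D)" by (intro power_mono e1) simp
      also have "\<dots> \<le> srad (x / sqrt D) ^ hexp D"
        by (rule power_decreasing[OF eeD(2)]) (auto simp: srad_nonneg srad_le_1)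
      finally have e2: "exp (- (L / (1 - L / D)) / 2) ^ D \<le> srad (x / sqrt D) ^ hexp D" .
      have Fr: "0 \<le> coord_cdf D (r / sqrt D)" by (rule coord_cdf_nonneg[OF D(2)])
      have "(coord_cdf D (r / sqrt D) powr (real m / real D)) ^ D = coord_cdf D (r / sqrt D) ^ m"
      proof (cases "coord_cdf D (r / sqrt D) = 0")
        case True
        then show ?thesis using D by (simp add: zero_power)
      next
        case False
        then have F0: "coord_cdf D (r / sqrt D) > 0" using Fr by simp
        then have "(coord_cdf D (r / sqrt D) powr (real m / real D)) ^ D = (coord_cdf D (r / sqrt D) powr (real m / real D)) powr real D" by (simp add: powr_realpow)
        also have "\<dots> = coord_cdf D (r / sqrt D) powr real m" using D by (simp add: powr_powr)
        finally show ?thesis using F0 by (simp add: powr_realpow)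
      qed
      also have "\<dots> \<le> coord_cdf D (x / sqrt D) ^ m"
      proof (rule power_mono[OF _ Fr])
        have "r / sqrt D \<le> x / sqrt D" using x sD by (simp add: divide_right_mono)
        then show "coord_cdf D (r / sqrt D) \<le> coord_cdf D (x / sqrt D)" using coord_cdf_diff(1)[OF D(2)] by fastforce
      qed
      finally have e3: "(coord_cdf D (r / sqrt D) powr (real m / real D)) ^ D \<le> coord_cdf D (x / sqrt D) ^ m" .
      show ?thesis
        unfolding bn_def D_def[symmetric] m_def[symmetric] power_mult_distrib
        by (intro mult_mono e2 e3) (auto simp: coord_cdf_nonneg[OF D(2)])
    qed
    have N2: "\<kappa> * q1 ^ D \<le> (LBINT x. indicator {0<..} x * ?a x)"
    proof -
      have q1: "0 \<le> q1" using q by simp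
      have "q1 ^ D * \<kappa> = (LBINT x. q1 ^ D * indicator {r..r + \<kappa>} x)" using \<kappa> by simp
      also have "\<dots> \<le> (LBINT x. indicator {0<..} x * ?a x)"
      proof (rule integral_mono)
        have "emeasure lborel {r..r + \<kappa>} < \<infinity>" using \<kappa> by simp
        then show "integrable lborel (\<lambda>x. q1 ^ D * indicator {r..r + \<kappa>} x)"
          by (intro integrable_mult_right integrable_real_indicator) auto
        show "integrable lborel (\<lambda>x. indicator {0<..} x * ?a x)" by (rule a_int) auto
        fix x
        show "q1 ^ D * indicator {r..r + \<kappa>} x \<le> indicator {0<..} x * ?a x"
        proof (cases "x \<in> {r..r + \<kappa>}")
          case True
          have "q1 ^ D \<le> bn n ^ D" using elim(3) q1 by (intro power_mono) auto
          also have "\<dots> \<le> ?a x" using True by (intro lower) auto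
          finally show ?thesis using True r by simp
        next
          case False
          then have "q1 ^ D * indicator {r..r + \<kappa>} x = 0" by simp
          moreover have "0 \<le> indicator {0<..} x * ?a x" by (intro mult_nonneg_nonneg a0) simp
          ultimately show ?thesis by linarith
        qed
      qed
      finally show ?thesis by (simp only: mult.commute)
    qed
    have q1: "0 < q1" using q by simp
    have pos: "0 < \<kappa> * q1 ^ D" using \<kappa> q1 by simp
    have "0 \<le> (LBINT x. \<psi> x * ?a x)"
      by (rule integral_nonneg_AE) (use \<psi> a0 in auto)
    then have "norm (?num n / ?den n) = (LBINT x. \<psi> x * ?a x) / (LBINT x. indicator {0<..} x * ?a x)"
      unfolding num den using sD N2 pos by (simp add: abs_divide)
    also have "\<dots> \<le> (q0 ^ (D - 4) * sqrt (2 * pi)) / (\<kappa> * q1 ^ D)"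
      using N1 N2 pos q(4) by (intro frac_le) auto
    also have "\<dots> = sqrt (2 * pi) / (\<kappa> * q0 ^ 4) * (q0 / q1) ^ D"
    proof -
      have "q0 ^ D = q0 ^ 4 * q0 ^ (D - 4)" using D(2) by (simp flip: power_add)
      then show ?thesis using q \<kappa> q1 by (simp add: power_divide field_simps)
    qed
    finally show ?case unfolding D_def .
  qed
  have "(\<lambda>n. sqrt (2 * pi) / (\<kappa> * q0 ^ 4) * (q0 / q1) ^ d n) \<longlonglongrightarrow> sqrt (2 * pi) / (\<kappa> * q0 ^ 4) * 0"
  proof (intro tendsto_mult tendsto_const)
    have "(\<lambda>k. (q0 / q1) ^ k) \<longlonglongrightarrow> 0" using q by (intro LIMSEQ_power_zero) auto
    then show "(\<lambda>n. (q0 / q1) ^ d n) \<longlonglongrightarrow> 0" by (rule filterlim_compose[OF _ d])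
  qed
  then have "(\<lambda>n. sqrt (2 * pi) / (\<kappa> * q0 ^ 4) * (q0 / q1) ^ d n) \<longlonglongrightarrow> 0" by simp
  then show ?thesis by (rule Lim_null_comparison[OF bound])
qed

subsection \<open>The typical height\<close>

text \<open>Independence identifies the joint law of X 1, ..., X n with a product measure, and
  reindexing by \<open>Suc\<close> moves it to \<open>{..<n}\<close>. The sphere measure is a
  probability measure because it is the law of X 1.\<close>

lemma iid_joint_law:
  assumes iid: "iid_uniform_sphere M n d X" and n: "0 < n"
  shows "prob_space (uniform_sphere d)"
    and "(\<lambda>\<omega>. \<lambda>i\<in>{..<n}. X (Suc i) \<omega>) \<in> measurable M (sphere_prod d {..<n})"
    and "distr M (sphere_prod d {..<n}) (\<lambda>\<omega>. \<lambda>i\<in>{..<n}. X (Suc i) \<omega>) = sphere_prod d {..<n}"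
    and "\<And>i \<omega>. i \<in> {1..n} \<Longrightarrow> \<omega> \<in> space M \<Longrightarrow> X i \<omega> \<in> Rd d"
proof -
  interpret prob_space M using iid by (simp add: iid_uniform_sphere_def)
  have ind: "indep_vars (\<lambda>_. borel_Rd d) X {1..n}" and law: "\<And>i. i \<in> {1..n} \<Longrightarrow> distr M (borel_Rd d) (X i) = uniform_sphere d"
    using iid by (auto simp: iid_uniform_sphere_def)
  have rv: "random_variable (borel_Rd d) (X i)" if "i \<in> {1..n}" for i
    using ind that unfolding indep_vars_def by blast
  have one: "1 \<in> {1..n}" using n by simp
  show P: "prob_space (uniform_sphere d)"
    using prob_space_distr[OF rv[OF one]] law[OF one] by simp
  have sb: "sets (borel_Rd d) = sets (uniform_sphere d)" by (simp add: borel_Rd_def)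
  have J: "distr M (Pi\<^sub>M {1..n} (\<lambda>_. borel_Rd d)) (\<lambda>\<omega>. \<lambda>i\<in>{1..n}. X i \<omega>) = sphere_prod d {1..n}"
  proof -
    have "distr M (Pi\<^sub>M {1..n} (\<lambda>_. borel_Rd d)) (\<lambda>\<omega>. \<lambda>i\<in>{1..n}. X i \<omega>) = Pi\<^sub>M {1..n} (\<lambda>i. distr M (borel_Rd d) (X i))"
      using ind indep_vars_iff_distr_eq_PiM'[where I = "{1..n}" and M' = "\<lambda>_. borel_Rd d" and X = X] rv one by blast
    also have "\<dots> = sphere_prod d {1..n}" by (rule PiM_cong) (auto simp: law)
    finally show ?thesis .
  qed
  have sP: "sets (Pi\<^sub>M I (\<lambda>_. borel_Rd d)) = sets (sphere_prod d I)" for I :: "nat set"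
    by (rule sets_PiM_cong) (auto simp: sb)
  have m1: "(\<lambda>\<omega>. \<lambda>i\<in>{1..n}. X i \<omega>) \<in> measurable M (Pi\<^sub>M {1..n} (\<lambda>_. borel_Rd d))"
    by (rule measurable_restrict) (rule rv)
  have m2: "(\<lambda>x. \<lambda>i\<in>{..<n}. x (Suc i)) \<in> measurable (Pi\<^sub>M {1..n} (\<lambda>_. borel_Rd d)) (sphere_prod d {..<n})"
  proof (rule measurable_restrict)
    fix i assume "i \<in> {..<n}"
    then have "(\<lambda>x. x (Suc i)) \<in> measurable (Pi\<^sub>M {1..n} (\<lambda>_. borel_Rd d)) (borel_Rd d)"
      using measurable_component_singleton[of "Suc i" "{1..n}" "\<lambda>_. borel_Rd d"] by auto
    then show "(\<lambda>x. x (Suc i)) \<in> measurable (Pi\<^sub>M {1..n} (\<lambda>_. borel_Rd d)) (uniform_sphere d)"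
      by (simp add: measurable_cong_sets[OF refl sb])
  qed
  have comp: "(\<lambda>\<omega>. \<lambda>i\<in>{..<n}. X (Suc i) \<omega>) = (\<lambda>x. \<lambda>i\<in>{..<n}. x (Suc i)) \<circ> (\<lambda>\<omega>. \<lambda>i\<in>{1..n}. X i \<omega>)"
    by (auto simp: fun_eq_iff)
  show "(\<lambda>\<omega>. \<lambda>i\<in>{..<n}. X (Suc i) \<omega>) \<in> measurable M (sphere_prod d {..<n})"
    unfolding comp by (rule measurable_comp[OF m1 m2])
  have "distr M (sphere_prod d {..<n}) (\<lambda>\<omega>. \<lambda>i\<in>{..<n}. X (Suc i) \<omega>) =
      distr (distr M (Pi\<^sub>M {1..n} (\<lambda>_. borel_Rd d)) (\<lambda>\<omega>. \<lambda>i\<in>{1..n}. X i \<omega>)) (sphere_prod d {..<n}) (\<lambda>x. \<lambda>i\<in>{..<n}. x (Suc i))"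
    unfolding comp by (rule distr_distr[OF m2 m1, symmetric])
  also have "\<dots> = sphere_prod d {..<n}"
    unfolding J by (rule distr_PiM_reindex) (use P in auto)
  finally show "distr M (sphere_prod d {..<n}) (\<lambda>\<omega>. \<lambda>i\<in>{..<n}. X (Suc i) \<omega>) = sphere_prod d {..<n}" .
  fix i \<omega> assume "i \<in> {1..n}" "\<omega> \<in> space M"
  then show "X i \<omega> \<in> Rd d"
    using measurable_space[OF rv] by (simp add: borel_Rd_def Rd_def space_PiM)
qed

section \<open>Positivity and normalisation of the height density\<close>

lemma coord_cdf_zero_pos: assumes d: "d \<ge> 4" shows "coord_cdf d 0 > 0"
proof -
  have "0 < (LBINT t. indicator {0<..} t * srad t ^ (d - 3))" by (rule integral_srad_pos) (use d in simp)
  also have "\<dots> \<le> (LBINT t. indicator {0..} t * srad t ^ (d - 3))"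
    by (rule integral_mono[OF integrable_srad_bounded[of _ _ 1] integrable_srad_bounded[of _ _ 1]])
      (use d in \<open>auto simp: indicator_def srad_nonneg\<close>)
  finally show ?thesis using coord_cdf_minus[OF d, of 0] coord_mass_pos[OF d] by simp
qed

lemma coord_cdf_measurable: "d \<ge> 4 \<Longrightarrow> coord_cdf d \<in> borel_measurable borel"
  by (rule borel_measurable_continuous_onI[OF coord_cdf_continuous])

lemma coord_cdf_power_bounds: assumes "d \<ge> 4" shows "0 \<le> coord_cdf d x ^ m" "coord_cdf d x ^ m \<le> 1"
  using coord_cdf_nonneg[OF assms] coord_cdf_le_1[OF assms] by (auto intro: power_le_one)

lemma hexp_pos: "d \<ge> 4 \<Longrightarrow> 0 < hexp d"
  by (simp add: hexp_def)

lemma integrable_psi_coord_cdf: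
  assumes d: "d \<ge> 4" and [measurable]: "\<psi> \<in> borel_measurable borel" and \<psi>: "\<And>x. \<bar>\<psi> x\<bar> \<le> (1::real)"
  shows "integrable lborel (\<lambda>v. \<psi> v * coord_cdf d v ^ m * srad v ^ hexp d)"
proof (rule integrable_srad_bounded[OF hexp_pos[OF d]])
  note [measurable] = coord_cdf_measurable[OF d]
  show "(\<lambda>v. \<psi> v * coord_cdf d v ^ m) \<in> borel_measurable borel" by measurable
  fix v
  have "\<bar>\<psi> v\<bar> * \<bar>coord_cdf d v ^ m\<bar> \<le> 1 * 1"
    using \<psi>[of v] coord_cdf_power_bounds[OF d, of v m] by (intro mult_mono) auto
  then show "\<bar>\<psi> v * coord_cdf d v ^ m\<bar> \<le> 1" by (simp add: abs_mult)
qed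

text \<open>On the positive axis the distribution function is at least its value at 0, which is
  positive by symmetry.\<close>

lemma denominator_pos:
  assumes d: "d \<ge> 4"
  shows "0 < (LBINT v. indicator {0<..} v * coord_cdf d v ^ m * srad v ^ hexp d)"
proof -
  have "0 < coord_cdf d 0 ^ m * (LBINT v. indicator {0<..} v * srad v ^ hexp d)"
    using coord_cdf_zero_pos[OF d] integral_srad_pos[OF hexp_pos[OF d]] by simp
  also have "\<dots> = (LBINT v. coord_cdf d 0 ^ m * (indicator {0<..} v * srad v ^ hexp d))" by simp
  also have "\<dots> \<le> (LBINT v. indicator {0<..} v * coord_cdf d v ^ m * srad v ^ hexp d)"
  proof (rule integral_mono)
    show "integrable lborel (\<lambda>v. coord_cdf d 0 ^ m * (indicator {0<..} v * srad v ^ hexp d))"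
      by (intro integrable_mult_right integrable_srad_bounded[OF hexp_pos[OF d], of _ 1]) auto
    show "integrable lborel (\<lambda>v. indicator {0<..} v * coord_cdf d v ^ m * srad v ^ hexp d)"
      by (rule integrable_psi_coord_cdf[OF d]) auto
    fix v :: real
    show "coord_cdf d 0 ^ m * (indicator {0<..} v * srad v ^ hexp d) \<le> indicator {0<..} v * coord_cdf d v ^ m * srad v ^ hexp d"
    proof (cases "v > 0")
      case True
      have "coord_cdf d 0 ^ m \<le> coord_cdf d v ^ m"
        using coord_cdf_diff(1)[OF d, of 0 v] True coord_cdf_nonneg[OF d] by (intro power_mono) auto
      then show ?thesis using True by (simp add: mult_right_mono srad_nonneg)
    qed simp
  qed
  finally show ?thesis .
qed

text \<open>The test function 1 gives C * I = 1 with a finite positive I, so C is neither 0 nor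
  infinite.\<close>

lemma height_law_normalized:
  assumes d: "d \<ge> 4" "prob_space (uniform_sphere d)"
  shows "\<exists>c>0. \<forall>g. continuous_on UNIV g \<longrightarrow> (\<forall>x. 0 \<le> g x) \<longrightarrow> (\<forall>x. g x \<le> (1::real)) \<longrightarrow>
    (\<integral>\<^sup>+a. ennreal (g (plane_height d a (ones d))) \<partial>sphere_prod d {..<d}) =
      ennreal c * (\<integral>\<^sup>+v. ennreal (g v * srad v ^ hexp d) * indicator {0<..} v \<partial>lborel)"
proof (rule height_law[OF d])
  fix C assume C: "\<And>g B. continuous_on UNIV g \<Longrightarrow> (\<And>x. 0 \<le> g x) \<Longrightarrow> (\<And>x. g x \<le> (B::real)) \<Longrightarrow>
    (\<integral>\<^sup>+a. ennreal (g (plane_height d a (ones d))) \<partial>sphere_prod d {..<d}) =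
      C * (\<integral>\<^sup>+v. ennreal (g v * srad v ^ hexp d) * indicator {0<..} v \<partial>lborel)"
  interpret S: prob_space "sphere_prod d {..<d}" by (rule prob_space_sphere_prod[OF d(2)])
  define I where "I = (LBINT v. indicator {0<..} v * srad v ^ hexp d)"
  have I: "I > 0" unfolding I_def by (rule integral_srad_pos[OF hexp_pos[OF d(1)]])
  have "1 = C * (\<integral>\<^sup>+v. ennreal (1 * srad v ^ hexp d) * indicator {0<..} v \<partial>lborel)"
    using C[of "\<lambda>_. 1" 1] by (simp add: S.emeasure_space_1)
  also have "(\<integral>\<^sup>+v. ennreal (1 * srad v ^ hexp d) * indicator {0<..} v \<partial>lborel) = (\<integral>\<^sup>+v. ennreal (indicator {0<..} v * srad v ^ hexp d) \<partial>lborel)"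
    by (rule nn_integral_cong) (simp add: indicator_def)
  also have "\<dots> = ennreal I"
    unfolding I_def by (rule nn_integral_eq_integral)
      (use hexp_pos[OF d(1)] in \<open>auto intro!: integrable_srad_bounded[of _ _ 1] simp: srad_nonneg\<close>)
  finally have CI: "1 = C * ennreal I" .
  then have "C \<noteq> \<top>" "C \<noteq> 0" using I by (auto simp: ennreal_top_mult)
  then obtain c where c: "C = ennreal c" "c > 0"
    by (cases C) (auto simp: less_le)
  show ?thesis
    by (intro exI[of _ c] conjI allI impI C[unfolded c(1)]) (use c(2) in auto)
qed

lemma plane_height_cong_rows:
  assumes "\<And>i. i < d \<Longrightarrow> a i = b i"
  shows "det_fun d a = det_fun d b" "cramer_sol d a y = cramer_sol d b y" "plane_height d a y = plane_height d b y"
proof -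
  show 1: "det_fun d a = det_fun d b" by (rule det_fun_cong) (simp add: assms)
  have "det_fun d (\<lambda>i k. if k = j then y i else a i k) = det_fun d (\<lambda>i k. if k = j then y i else b i k)" for j
    by (rule det_fun_cong) (simp add: assms)
  then show 2: "cramer_sol d a y = cramer_sol d b y" by (simp add: cramer_sol_def 1)
  show "plane_height d a y = plane_height d b y" by (simp add: plane_height_def 2)
qed

lemma AE_det_nonzero:
  assumes d: "d \<ge> 4" "prob_space (uniform_sphere d)" and n: "d \<le> n"
  shows "AE x in sphere_prod d {..<n}. det_fun d x \<noteq> 0"
proof -
  have P: "prob_space (uniform_sphere d)" by (rule d(2))
  have D: "distr (sphere_prod d {..<n}) (sphere_prod d {..<d}) (\<lambda>x. restrict x {..<d}) = sphere_prod d {..<d}"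
    using distr_PiM_reindex[of "{..<n}" "\<lambda>_. uniform_sphere d" "\<lambda>i. i" "{..<d}"] P n
    by (auto simp: restrict_def)
  have "AE a in distr (sphere_prod d {..<n}) (sphere_prod d {..<d}) (\<lambda>x. restrict x {..<d}). \<forall>k\<le>d. det_fun d (lead k a) \<noteq> 0"
    unfolding D by (rule AE_leading_minors[OF P])
  then have "AE a in distr (sphere_prod d {..<n}) (sphere_prod d {..<d}) (\<lambda>x. restrict x {..<d}). det_fun d a \<noteq> 0"
    by eventually_elim (metis lead_full order_refl)
  moreover have "(\<lambda>x. restrict x {..<d}) \<in> measurable (sphere_prod d {..<n}) (sphere_prod d {..<d})"
    by (rule measurable_restrict_subset) (use n in auto)
  ultimately have "AE x in sphere_prod d {..<n}. det_fun d (restrict x {..<d}) \<noteq> 0"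
    by (rule AE_distrD[rotated])
  then show ?thesis
    by eventually_elim (use plane_height_cong_rows(1)[of d "restrict _ {..<d}"] in auto)
qed

text \<open>
  The facet events are not shown to be measurable, so the numerator is only bounded above and the denominator below:
  \<open>measure\<close> is \<open>0\<close> on non-measurable sets, and a zero denominator is excluded because \<open>H\<close> has total mass \<open>1\<close>.
\<close>

lemma typical_height_bound:
  fixes H :: "'b \<Rightarrow> real" and X :: "nat \<Rightarrow> 'a \<Rightarrow> nat \<Rightarrow> real"
  assumes d: "d \<ge> 4" and dn: "d < n"
    and iid: "iid_uniform_sphere M n d X" and th: "is_typical_height M n d X N H"
    and \<psi>c: "continuous_on UNIV \<psi>" and \<psi>: "\<And>x. 0 \<le> \<psi> x" "\<And>x. \<psi> x \<le> (1::real)"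
    and B: "B \<in> sets borel" "\<And>h. h \<in> B \<Longrightarrow> \<psi> h = 1"
  shows "\<P>(\<eta> in N. H \<eta> \<in> B) \<le>
    (LBINT v. \<psi> v * coord_cdf d v ^ (n - d) * srad v ^ hexp d) / (LBINT v. indicator {0<..} v * coord_cdf d v ^ (n - d) * srad v ^ hexp d)"
proof -
  let ?J = "LBINT v. \<psi> v * coord_cdf d v ^ (n - d) * srad v ^ hexp d"
  let ?K = "LBINT v. indicator {0<..} v * coord_cdf d v ^ (n - d) * srad v ^ hexp d"
  define m where "m = n - d"
  have n: "0 < n" "d \<le> n" using dn by auto
  note law = iid_joint_law[OF iid n(1)]
  note P = law(1)
  interpret M: prob_space M using iid by (simp add: iid_uniform_sphere_def)
  interpret N: prob_space N using th by (simp add: is_typical_height_def)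
  let ?\<mu> = "sphere_prod d {..<n}"
  interpret \<mu>: prob_space ?\<mu> by (rule prob_space_sphere_prod[OF P])
  define Y where "Y = (\<lambda>\<omega>. \<lambda>i\<in>{..<n}. X (Suc i) \<omega>)"
  have Ym[measurable]: "Y \<in> measurable M ?\<mu>" unfolding Y_def by (rule law(2))
  have Yl: "distr M ?\<mu> Y = ?\<mu>" unfolding Y_def by (rule law(3))
  have \<psi>m[measurable]: "\<psi> \<in> borel_measurable borel" by (rule borel_measurable_continuous_onI[OF \<psi>c])
  note Fm[measurable] = coord_cdf_measurable[OF d]
  note Fc = coord_cdf_continuous[OF d]
  define t where "t x l = (\<Sum>j<d. x l j * cramer_sol d x (ones d) j)" for x :: "nat \<Rightarrow> nat \<Rightarrow> real" and l
  define h where "h x = plane_height d x (ones d)" for x :: "nat \<Rightarrow> nat \<Rightarrow> real"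
  have tm: "(\<lambda>x. t x l) \<in> borel_measurable ?\<mu>" if "l < n" for l
    unfolding t_def by (rule inner_cramer_sol_measurable[OF n(2) that])
  have hm[measurable]: "h \<in> borel_measurable ?\<mu>"
  proof -
    have "(\<lambda>x. normI {..<d} (cramer_sol d x (ones d))) \<in> borel_measurable ?\<mu>"
      by (rule measurable_compose[OF cramer_sol_sphere_prod_measurable(1)[OF n(2)] normI_measurable_leb])
    then show ?thesis unfolding h_def plane_height_def by simp
  qed
  have dm[measurable]: "(\<lambda>x. det_fun d x) \<in> borel_measurable ?\<mu>" by (rule cramer_sol_sphere_prod_measurable(2)[OF n(2)])
  have all_m: "Measurable.pred ?\<mu> (\<lambda>x. \<forall>l\<in>{d..<n}. t x l \<in> Q)" if "Q \<in> sets borel" for Q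
  proof (rule pred_intros_finite(3))
    fix l assume "l \<in> {d..<n}"
    then have "l < n" by simp
    from measurable_sets[OF tm[OF this] that]
    show "Measurable.pred ?\<mu> (\<lambda>x. t x l \<in> Q)"
      by (simp add: pred_def vimage_def Int_def conj_commute)
  qed simp
  note [measurable] = all_m[of "{..1}"] all_m[of "{1..}"] all_m[of "{..<1}"]
  \<comment> \<open>\<open>S\<close> covers the event of a facet with height in \<open>B\<close>:
    the simplex is degenerate, or all further points lie weakly on the side of the origin (height
    \<open>h\<close>), or weakly beyond the hyperplane (height \<open>- h\<close>). \<open>T\<close>
    sits inside the facet event, through strict inequalities on the side of the origin.\<close>
  define S where "S = {x \<in> space ?\<mu>. det_fun d x = 0 \<or> (h x \<in> B \<and> (\<forall>l\<in>{d..<n}. t x l \<in> {..1})) \<or>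
     (- h x \<in> B \<and> (\<forall>l\<in>{d..<n}. t x l \<in> {1..}))}"
  define T where "T = {x \<in> space ?\<mu>. det_fun d x \<noteq> 0 \<and> (\<forall>l\<in>{d..<n}. t x l \<in> {..<1})}"
  note B(1)[measurable]
  have S[measurable]: "S \<in> sets ?\<mu>" unfolding S_def by measurable
  have T[measurable]: "T \<in> sets ?\<mu>" unfolding T_def by measurable
  obtain c where c: "c > 0" "\<And>g. continuous_on UNIV g \<Longrightarrow> (\<And>x. 0 \<le> g x) \<Longrightarrow> (\<And>x. g x \<le> (1::real)) \<Longrightarrow>
    (\<integral>\<^sup>+a. ennreal (g (plane_height d a (ones d))) \<partial>sphere_prod d {..<d}) =
      ennreal c * (\<integral>\<^sup>+v. ennreal (g v * srad v ^ hexp d) * indicator {0<..} v \<partial>lborel)"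
    using height_law_normalized[OF d P] by auto
  \<comment> \<open>\<open>\<psi>\<close> is a continuous majorant of the indicator of
    \<open>B\<close>, because the height law is known for continuous test functions.
    \<open>?f1\<close> and \<open>?f2\<close> belong to the two signs of the height in
    \<open>S\<close>, \<open>?f3\<close> to \<open>T\<close>.\<close>
  let ?f1 = "\<lambda>x. ennreal (\<psi> (plane_height d x (ones d))) * (\<Prod>l\<in>{d..<n}. indicator {..1} (\<Sum>j<d. x l j * cramer_sol d x (ones d) j))"
  let ?f2 = "\<lambda>x. ennreal (\<psi> (- plane_height d x (ones d))) * (\<Prod>l\<in>{d..<n}. indicator {1..} (\<Sum>j<d. x l j * cramer_sol d x (ones d) j))"
  let ?f3 = "\<lambda>x. ennreal 1 * (\<Prod>l\<in>{d..<n}. indicator {..<1} (\<Sum>j<d. x l j * cramer_sol d x (ones d) j))"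
  have prod_ind: "(\<Prod>l\<in>{d..<n}. indicator Q (t x l)) = (if \<forall>l\<in>{d..<n}. t x l \<in> Q then 1 else 0 :: ennreal)" for Q :: "real set" and x
  proof (cases "\<forall>l\<in>{d..<n}. t x l \<in> Q")
    case False
    then obtain l where "l \<in> {d..<n}" "t x l \<notin> Q" by auto
    then have "(\<Prod>l\<in>{d..<n}. indicator Q (t x l) :: ennreal) = 0" by (intro prod_zero bexI[of _ l]) auto
    then show ?thesis using False by simp
  qed simp
  have i1: "(\<integral>\<^sup>+x. ?f1 x \<partial>?\<mu>) = ennreal c * (\<integral>\<^sup>+v. ennreal (\<psi> v * coord_cdf d v ^ m * srad v ^ hexp d) * indicator {0<..} v \<partial>lborel)"
  proof -
    have "(\<integral>\<^sup>+x. ?f1 x \<partial>?\<mu>) = (\<integral>\<^sup>+a. ennreal (\<psi> (plane_height d a (ones d)) * coord_cdf d (plane_height d a (ones d)) ^ (n - d)) \<partial>sphere_prod d {..<d})"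
      by (rule joint_integral[OF d P n(2) \<psi>m \<psi>(1)]) (auto intro!: coord_cdf_nonneg[OF d] halfspace_le[OF d P])
    also have "\<dots> = ennreal c * (\<integral>\<^sup>+v. ennreal (\<psi> v * coord_cdf d v ^ m * srad v ^ hexp d) * indicator {0<..} v \<partial>lborel)"
      unfolding m_def[symmetric]
      by (rule c(2)[of "\<lambda>v. \<psi> v * coord_cdf d v ^ m"]) (auto intro!: continuous_on_mult continuous_on_power \<psi>c Fc mult_nonneg_nonneg mult_le_one \<psi> coord_cdf_power_bounds[OF d])
    finally show ?thesis .
  qed
  have i2: "(\<integral>\<^sup>+x. ?f2 x \<partial>?\<mu>) = ennreal c * (\<integral>\<^sup>+v. ennreal (\<psi> v * coord_cdf d v ^ m * srad v ^ hexp d) * indicator {..<0} v \<partial>lborel)"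
  proof -
    have cm: "continuous_on UNIV (\<lambda>v. f (- v))" if "continuous_on UNIV f" for f :: "real \<Rightarrow> real"
      by (rule continuous_on_compose2[OF that]) (auto intro!: continuous_intros)
    have "(\<integral>\<^sup>+x. ?f2 x \<partial>?\<mu>) = (\<integral>\<^sup>+a. ennreal (\<psi> (- plane_height d a (ones d)) * coord_cdf d (- plane_height d a (ones d)) ^ (n - d)) \<partial>sphere_prod d {..<d})"
      by (rule joint_integral[OF d P n(2), of "\<lambda>v. \<psi> (- v)" _ "\<lambda>v. coord_cdf d (- v)"])
        (auto intro!: coord_cdf_nonneg[OF d] halfspace_ge[OF d P] \<psi>)
    also have "\<dots> = ennreal c * (\<integral>\<^sup>+v. ennreal (\<psi> (- v) * coord_cdf d (- v) ^ m * srad v ^ hexp d) * indicator {0<..} v \<partial>lborel)"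
      unfolding m_def[symmetric]
      by (rule c(2)[of "\<lambda>v. \<psi> (- v) * coord_cdf d (- v) ^ m"]) (auto intro!: continuous_on_mult continuous_on_power cm \<psi>c Fc mult_nonneg_nonneg mult_le_one \<psi> coord_cdf_power_bounds[OF d])
    \<comment> \<open>Substituting - v for v turns the contribution of negative heights into the
      integral of the same function over the negative axis, so that \<open>?J\<close>, over the
      whole line, covers both signs.\<close>
    also have "(\<integral>\<^sup>+v. ennreal (\<psi> (- v) * coord_cdf d (- v) ^ m * srad v ^ hexp d) * indicator {0<..} v \<partial>lborel) =
      (\<integral>\<^sup>+v. ennreal (\<psi> v * coord_cdf d v ^ m * srad v ^ hexp d) * indicator {..<0} v \<partial>lborel)"
    proof -
      have k1: "(\<lambda>v. ennreal (\<psi> v * coord_cdf d v ^ m * srad v ^ hexp d) * indicator {..<0} v) \<in> borel_measurable borel"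
        by measurable
      have "(\<integral>\<^sup>+v. ennreal (\<psi> v * coord_cdf d v ^ m * srad v ^ hexp d) * indicator {..<0} v \<partial>lborel) =
        ennreal \<bar>- 1\<bar> * (\<integral>\<^sup>+v. ennreal (\<psi> (0 + (- 1) * v) * coord_cdf d (0 + (- 1) * v) ^ m * srad (0 + (- 1) * v) ^ hexp d) * indicator {..<0} (0 + (- 1) * v) \<partial>lborel)"
        by (rule nn_integral_real_affine[OF k1]) simp
      also have "\<dots> = (\<integral>\<^sup>+v. ennreal (\<psi> (- v) * coord_cdf d (- v) ^ m * srad v ^ hexp d) * indicator {0<..} v \<partial>lborel)"
        by (auto intro!: nn_integral_cong simp: srad_minus indicator_def)
      finally show ?thesis by simp
    qed
    finally show ?thesis .
  qed
  have i3: "(\<integral>\<^sup>+x. ?f3 x \<partial>?\<mu>) = ennreal (c * ?K)"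
  proof -
    have "(\<integral>\<^sup>+x. ?f3 x \<partial>?\<mu>) = (\<integral>\<^sup>+a. ennreal (1 * coord_cdf d (plane_height d a (ones d)) ^ (n - d)) \<partial>sphere_prod d {..<d})"
      by (rule joint_integral[OF d P n(2), of "\<lambda>_. 1"]) (auto intro!: coord_cdf_nonneg[OF d] halfspace_less[OF d P])
    also have "\<dots> = ennreal c * (\<integral>\<^sup>+v. ennreal (1 * coord_cdf d v ^ m * srad v ^ hexp d) * indicator {0<..} v \<partial>lborel)"
      unfolding m_def[symmetric]
      by (rule c(2)[of "\<lambda>v. 1 * coord_cdf d v ^ m"]) (auto intro!: continuous_intros Fc coord_cdf_power_bounds[OF d])
    also have "(\<integral>\<^sup>+v. ennreal (1 * coord_cdf d v ^ m * srad v ^ hexp d) * indicator {0<..} v \<partial>lborel) =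
        (\<integral>\<^sup>+v. ennreal (indicator {0<..} v * coord_cdf d v ^ m * srad v ^ hexp d) \<partial>lborel)"
      by (rule nn_integral_cong) (simp add: indicator_def)
    also have "\<dots> = ennreal ?K"
      unfolding m_def[symmetric]
      by (rule nn_integral_eq_integral)
        (auto intro!: integrable_psi_coord_cdf[OF d] AE_I2 mult_nonneg_nonneg coord_cdf_power_bounds[OF d] simp: srad_nonneg)
    finally show ?thesis using c(1) denominator_pos[OF d, of "n - d"] by (simp add: ennreal_mult)
  qed
  have J0: "0 \<le> ?J"
    by (rule integral_nonneg_AE) (auto intro!: AE_I2 mult_nonneg_nonneg \<psi> coord_cdf_power_bounds[OF d] simp: srad_nonneg)
  have i12: "(\<integral>\<^sup>+x. ?f1 x + ?f2 x \<partial>?\<mu>) \<le> ennreal (c * ?J)"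
  proof -
    have f1m: "?f1 \<in> borel_measurable ?\<mu>" by (rule joint_integrand_measurable[OF n(2)]) auto
    have f2m: "?f2 \<in> borel_measurable ?\<mu>" by (rule joint_integrand_measurable[OF n(2), of "\<lambda>v. \<psi> (- v)"]) auto
    let ?k = "\<lambda>v. ennreal (\<psi> v * coord_cdf d v ^ m * srad v ^ hexp d)"
    have km: "?k \<in> borel_measurable borel" by measurable
    have "(\<integral>\<^sup>+x. ?f1 x + ?f2 x \<partial>?\<mu>) = (\<integral>\<^sup>+x. ?f1 x \<partial>?\<mu>) + (\<integral>\<^sup>+x. ?f2 x \<partial>?\<mu>)"
      by (rule nn_integral_add[OF f1m f2m])
    also have "\<dots> = ennreal c * ((\<integral>\<^sup>+v. ?k v * indicator {0<..} v \<partial>lborel) + (\<integral>\<^sup>+v. ?k v * indicator {..<0} v \<partial>lborel))"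
      unfolding i1 i2 by (rule distrib_left[symmetric])
    also have "(\<integral>\<^sup>+v. ?k v * indicator {0<..} v \<partial>lborel) + (\<integral>\<^sup>+v. ?k v * indicator {..<0} v \<partial>lborel) =
        (\<integral>\<^sup>+v. ?k v * indicator {0<..} v + ?k v * indicator {..<0} v \<partial>lborel)"
      by (rule nn_integral_add[symmetric]) measurable
    also have "ennreal c * \<dots> \<le> ennreal c * (\<integral>\<^sup>+v. ?k v \<partial>lborel)"
      by (intro mult_left_mono nn_integral_mono) (auto simp: indicator_def)
    also have "(\<integral>\<^sup>+v. ?k v \<partial>lborel) = ennreal ?J"
      unfolding m_def
      by (rule nn_integral_eq_integral)
        (use \<psi> in \<open>auto intro!: integrable_psi_coord_cdf[OF d] AE_I2 mult_nonneg_nonneg coord_cdf_power_bounds[OF d] simp: srad_nonneg\<close>)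
    also have "ennreal c * ennreal ?J = ennreal (c * ?J)" using c(1) J0 by (simp add: ennreal_mult)
    finally show ?thesis .
  qed
  have muS: "measure ?\<mu> S \<le> c * ?J"
  proof -
    have "emeasure ?\<mu> S = (\<integral>\<^sup>+x. indicator S x \<partial>?\<mu>)" by simp
    also have "\<dots> \<le> (\<integral>\<^sup>+x. ?f1 x + ?f2 x \<partial>?\<mu>)"
    proof (rule nn_integral_mono_AE)
      show "AE x in ?\<mu>. indicator S x \<le> ?f1 x + ?f2 x"
        using AE_det_nonzero[OF d P n(2)]
      proof eventually_elim
        case (elim x)
        show ?case
        proof (cases "x \<in> S")
          case True
          then consider "h x \<in> B" "\<forall>l\<in>{d..<n}. t x l \<in> {..1}" | "- h x \<in> B" "\<forall>l\<in>{d..<n}. t x l \<in> {1..}"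
            using elim unfolding S_def by blast
          then show ?thesis
          proof cases
            case 1
            then have "?f1 x = 1" unfolding t_def[symmetric] prod_ind h_def[symmetric] by (simp add: B(2))
            then show ?thesis using True by simp
          next
            case 2
            then have "?f2 x = 1" unfolding t_def[symmetric] prod_ind h_def[symmetric] by (simp add: B(2))
            then show ?thesis using True by simp
          qed
        qed simp
      qed
    qed
    also have "\<dots> \<le> ennreal (c * ?J)" by (rule i12)
    finally have "ennreal (measure ?\<mu> S) \<le> ennreal (c * ?J)" by (simp add: \<mu>.emeasure_eq_measure)
    then show ?thesis using c(1) J0 by (subst (asm) ennreal_le_iff) auto
  qed
  have muT: "measure ?\<mu> T \<ge> c * ?K"
  proof -
    have "ennreal (c * ?K) = (\<integral>\<^sup>+x. ?f3 x \<partial>?\<mu>)" by (rule i3[symmetric])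
    also have "\<dots> \<le> (\<integral>\<^sup>+x. indicator T x \<partial>?\<mu>)"
    proof (rule nn_integral_mono_AE)
      have "AE x in ?\<mu>. x \<in> space ?\<mu>" by (rule AE_space)
      with AE_det_nonzero[OF d P n(2)] show "AE x in ?\<mu>. ?f3 x \<le> indicator T x"
      proof eventually_elim
        case (elim x)
        then show ?case unfolding t_def[symmetric] prod_ind by (auto simp: T_def indicator_def)
      qed
    qed
    also have "\<dots> = ennreal (measure ?\<mu> T)" by (simp add: \<mu>.emeasure_eq_measure)
    finally show ?thesis by (subst (asm) ennreal_le_iff) auto
  qed
  have pull: "measure M (Y -` A \<inter> space M) = measure ?\<mu> A" if "A \<in> sets ?\<mu>" for A
    using measure_distr[OF Ym that] unfolding Yl by simp
  have pullm: "Y -` A \<inter> space M \<in> sets M" if "A \<in> sets ?\<mu>" for A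
    by (rule measurable_sets[OF Ym that])
  let ?P = "\<lambda>\<omega>. conv_hull_Rd d {1..n} (\<lambda>i. X i \<omega>)" and ?F = "\<lambda>\<omega>. conv_hull_Rd d {1..d} (\<lambda>i. X i \<omega>)"
  have Ydet: "det_fun d (Y \<omega>) = det_fun d (\<lambda>i. X (Suc i) \<omega>)" "cramer_sol d (Y \<omega>) y = cramer_sol d (\<lambda>i. X (Suc i) \<omega>) y"
    "plane_height d (Y \<omega>) y = plane_height d (\<lambda>i. X (Suc i) \<omega>) y" for \<omega> y
    using plane_height_cong_rows[of d "Y \<omega>" "\<lambda>i. X (Suc i) \<omega>"] n by (auto simp: Y_def)
  have loc: "simplex_points d n (\<lambda>i. X i \<omega>)" if "\<omega> \<in> space M" "det_fun d (Y \<omega>) \<noteq> 0" for \<omega>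
    using that law(4) d n by unfold_locales (auto simp: Ydet)
  have tw: "t (Y \<omega>) l = inner_Rd d (X (Suc l) \<omega>) (simplex_points.w d (\<lambda>i. X i \<omega>))"
    if "\<omega> \<in> space M" "det_fun d (Y \<omega>) \<noteq> 0" "l < n" for \<omega> l
    using that(3) unfolding t_def inner_Rd_def simplex_points.w_def[OF loc[OF that(1,2)]] Ydet by (simp add: Y_def)
  have hw: "h (Y \<omega>) = simplex_points.h d (\<lambda>i. X i \<omega>)" if "\<omega> \<in> space M" "det_fun d (Y \<omega>) \<noteq> 0" for \<omega>
    unfolding h_def simplex_points.h_def[OF loc[OF that]] Ydet ..
  have num_sub: "{\<omega> \<in> space M. (\<exists>\<eta>\<in>B. has_height d (?P \<omega>) (?F \<omega>) \<eta>) \<and> is_facet d (?P \<omega>) (?F \<omega>)} \<subseteq> Y -` S \<inter> space M"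
  proof
    fix \<omega> assume "\<omega> \<in> {\<omega> \<in> space M. (\<exists>\<eta>\<in>B. has_height d (?P \<omega>) (?F \<omega>) \<eta>) \<and> is_facet d (?P \<omega>) (?F \<omega>)}"
    then obtain \<eta> u where \<omega>: "\<omega> \<in> space M" "\<eta> \<in> B" "supports_at d (?P \<omega>) (?F \<omega>) u \<eta>"
      by (auto simp: has_height_def)
    have sp: "Y \<omega> \<in> space ?\<mu>" using measurable_space[OF Ym \<omega>(1)] .
    have "Y \<omega> \<in> S"
    proof (cases "det_fun d (Y \<omega>) = 0")
      case True
      then show ?thesis using sp by (simp add: S_def)
    next
      case False
      have l: "Suc l \<in> {1..n}" if "l \<in> {d..<n}" for l using that by auto
      from simplex_points.supports_at_cases[OF loc[OF \<omega>(1) False] \<omega>(3)]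
      show ?thesis
      proof
        assume a: "\<eta> = simplex_points.h d (\<lambda>i. X i \<omega>) \<and> (\<forall>j\<in>{1..n}. inner_Rd d (X j \<omega>) (simplex_points.w d (\<lambda>i. X i \<omega>)) \<le> 1)"
        then have "h (Y \<omega>) \<in> B" using hw[OF \<omega>(1) False] \<omega>(2) by simp
        moreover have "\<forall>l\<in>{d..<n}. t (Y \<omega>) l \<in> {..1}" using a l tw[OF \<omega>(1) False] by auto
        ultimately show ?thesis using sp by (simp add: S_def)
      next
        assume a: "\<eta> = - simplex_points.h d (\<lambda>i. X i \<omega>) \<and> (\<forall>j\<in>{1..n}. inner_Rd d (X j \<omega>) (simplex_points.w d (\<lambda>i. X i \<omega>)) \<ge> 1)"
        then have "- h (Y \<omega>) \<in> B" using hw[OF \<omega>(1) False] \<omega>(2) by simp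
        moreover have "\<forall>l\<in>{d..<n}. t (Y \<omega>) l \<in> {1..}" using a l tw[OF \<omega>(1) False] by auto
        ultimately show ?thesis using sp by (simp add: S_def)
      qed
    qed
    then show "\<omega> \<in> Y -` S \<inter> space M" using \<omega>(1) by simp
  qed
  have den_sub: "Y -` T \<inter> space M \<subseteq> {\<omega> \<in> space M. is_facet d (?P \<omega>) (?F \<omega>)}"
  proof
    fix \<omega> assume "\<omega> \<in> Y -` T \<inter> space M"
    then have \<omega>: "\<omega> \<in> space M" "det_fun d (Y \<omega>) \<noteq> 0" "\<forall>l\<in>{d..<n}. t (Y \<omega>) l < 1" by (auto simp: T_def)
    have "is_facet d (?P \<omega>) (?F \<omega>)"
    proof (rule simplex_points.facet_if_strict[OF loc[OF \<omega>(1,2)]])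
      fix j assume j: "j \<in> {d<..n}"
      then have j': "j - 1 \<in> {d..<n}" "j - 1 < n" "Suc (j - 1) = j" by auto
      then have "t (Y \<omega>) (j - 1) < 1" using \<omega>(3) by blast
      then show "inner_Rd d (X j \<omega>) (simplex_points.w d (\<lambda>i. X i \<omega>)) < 1"
        unfolding tw[OF \<omega>(1,2) j'(2)] j'(3) .
    qed
    then show "\<omega> \<in> {\<omega> \<in> space M. is_facet d (?P \<omega>) (?F \<omega>)}" using \<omega>(1) by simp
  qed
  have num: "measure M {\<omega> \<in> space M. (\<exists>\<eta>\<in>B. has_height d (?P \<omega>) (?F \<omega>) \<eta>) \<and> is_facet d (?P \<omega>) (?F \<omega>)} \<le> c * ?J"
    using M.finite_measure_mono[OF num_sub pullm[OF S]] pull[OF S] muS by linarith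
  have law_H: "\<P>(\<eta> in N. H \<eta> \<in> A) =
      measure M {\<omega> \<in> space M. (\<exists>\<eta>\<in>A. has_height d (?P \<omega>) (?F \<omega>) \<eta>) \<and> is_facet d (?P \<omega>) (?F \<omega>)} /
      measure M {\<omega> \<in> space M. is_facet d (?P \<omega>) (?F \<omega>)}" if "A \<in> sets borel" for A
    using th that unfolding is_typical_height_def cond_prob_def by blast
  have "\<P>(\<eta> in N. H \<eta> \<in> UNIV) = 1" using N.prob_space by simp
  \<comment> \<open>A nonzero value of \<open>measure\<close> certifies that the facet event is
    measurable, which monotonicity in the bound from below requires.\<close>
  then have "measure M {\<omega> \<in> space M. is_facet d (?P \<omega>) (?F \<omega>)} \<noteq> 0" using law_H[of UNIV] by auto
  then have facet_sets: "{\<omega> \<in> space M. is_facet d (?P \<omega>) (?F \<omega>)} \<in> sets M"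
    using measure_notin_sets by blast
  have den: "c * ?K \<le> measure M {\<omega> \<in> space M. is_facet d (?P \<omega>) (?F \<omega>)}"
    using M.finite_measure_mono[OF den_sub facet_sets] pull[OF T] muT by linarith
  have pos: "0 < c * ?K" using c(1) denominator_pos[OF d] by simp
  have "\<P>(\<eta> in N. H \<eta> \<in> B) \<le> (c * ?J) / (c * ?K)"
    unfolding law_H[OF B(1)] using num den pos c(1) J0 by (intro frac_le) auto
  also have "\<dots> = ?J / ?K" using c(1) by simp
  finally show ?thesis .
qed

theorem theorem3:
  fixes d :: "nat \<Rightarrow> nat"
    and \<rho> :: real
    and M :: "nat \<Rightarrow> 'a measure"
    and X :: "nat \<Rightarrow> nat \<Rightarrow> 'a \<Rightarrow> nat \<Rightarrow> real"
    and N :: "nat \<Rightarrow> 'b measure"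
    and H_typ :: "nat \<Rightarrow> 'b \<Rightarrow> real"
  assumes dim_range: "\<forall>\<^sub>F n in sequentially. d n \<in> {2..n - 1}"
    and dim_dichotomy:
      "(\<exists>c. \<forall>\<^sub>F n in sequentially. d n = c) \<or> filterlim d at_top sequentially"
    and iid: "\<forall>\<^sub>F n in sequentially. iid_uniform_sphere (M n) n (d n) (X n)"
    and typ_height: "\<forall>\<^sub>F n in sequentially. is_typical_height (M n) n (d n) (X n) (N n) (H_typ n)"
    and rho_pos: "\<rho> > 0"
    and regime: "(\<lambda>n. (real n - real (d n)) / real (d n)) \<longlonglongrightarrow> \<rho>"
  shows "(\<exists>!r. is_arg_max (f_rho \<rho>) (\<lambda>_. True) r) \<and> r_rho \<rho> > 0 \<and>
    converges_in_prob N (\<lambda>n \<eta>. sqrt (real (d n)) * H_typ n \<eta>) (r_rho \<rho>)"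
proof -
  obtain r where r: "r > 0" and inc: "\<And>x y. x < y \<Longrightarrow> y \<le> r \<Longrightarrow> f_rho \<rho> x < f_rho \<rho> y"
    and dec: "\<And>x y. r \<le> x \<Longrightarrow> x < y \<Longrightarrow> f_rho \<rho> y < f_rho \<rho> x"
    using f_rho_unimodal[OF rho_pos] by metis
  have max: "f_rho \<rho> x < f_rho \<rho> r" if "x \<noteq> r" for x
    using inc[of x r] dec[of r x] that by (cases "x < r") auto
  have am: "is_arg_max (f_rho \<rho>) (\<lambda>_. True) r"
    unfolding is_arg_max_def using max by (metis less_asym less_irrefl)
  have uniq: "x = r" if "is_arg_max (f_rho \<rho>) (\<lambda>_. True) x" for x
    using that max[of x] unfolding is_arg_max_def by blast
  have rr: "r_rho \<rho> = r"
    unfolding r_rho_def arg_max_def using am uniq by (rule some_equality)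
  \<comment> \<open>A constant dimension would make (n - d) / d diverge, so the regime leaves only
    dimensions tending to infinity.\<close>
  have d_top: "filterlim d at_top sequentially"
    using dim_dichotomy
  proof
    assume "\<exists>c. \<forall>\<^sub>F n in sequentially. d n = c"
    then obtain c where c: "\<forall>\<^sub>F n in sequentially. d n = c" by blast
    have "\<forall>\<^sub>F n in sequentially. c \<ge> 2" using c dim_range by eventually_elim auto
    then have c2: "c \<ge> 2" by (auto dest: eventually_happens)
    have "(\<lambda>n. (real n - real c) / real c) \<longlonglongrightarrow> \<rho>"
      by (rule Lim_transform_eventually[OF regime]) (use c in \<open>auto elim!: eventually_mono\<close>)
    moreover have "filterlim (\<lambda>n. (real n - real c) / real c) at_top sequentially"
      using c2 by real_asymp
    ultimately have False
      using not_tendsto_and_filterlim_at_infinity[OF sequentially_bot] filterlim_at_top_imp_at_infinity by blast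
    then show ?thesis ..
  qed
  have dn: "\<forall>\<^sub>F n in sequentially. d n < n"
    using dim_range eventually_gt_at_top[of 0] by eventually_elim auto
  have conv: "(\<lambda>n. \<P>(\<eta> in N n. \<bar>sqrt (real (d n)) * H_typ n \<eta> - r\<bar> > \<epsilon>)) \<longlonglongrightarrow> 0" if \<epsilon>: "\<epsilon> > 0" for \<epsilon>
  proof -
    \<comment> \<open>Piecewise linear cut-off: 0 within \<epsilon> / 2 of \<open>r\<close> and 1
      beyond \<epsilon>. It meets the hypotheses of \<open>laplace\<close> with \<epsilon> / 2 and
      majorises the indicator of the event with \<epsilon>.\<close>
    define \<psi> where "\<psi> x = min 1 (max 0 (2 * \<bar>x - r\<bar> / \<epsilon> - 1))" for x
    have \<psi>c: "continuous_on UNIV (\<lambda>v. \<psi> (s * v))" for s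
      unfolding \<psi>_def using \<epsilon> by (intro continuous_intros) auto
    have \<psi>: "0 \<le> \<psi> x" "\<psi> x \<le> 1" for x by (auto simp: \<psi>_def)
    have \<psi>0: "\<psi> x = 0" if "\<bar>x - r\<bar> < \<epsilon> / 2" for x using that \<epsilon> by (simp add: \<psi>_def field_simps)
    have \<psi>1: "\<psi> x = 1" if "\<bar>x - r\<bar> > \<epsilon>" for x using that \<epsilon> by (simp add: \<psi>_def field_simps)
    have \<psi>m: "\<psi> \<in> borel_measurable borel"
      using \<psi>c[of 1] by (simp add: borel_measurable_continuous_onI)
    have lap: "(\<lambda>n. (LBINT v. \<psi> (sqrt (d n) * v) * coord_cdf (d n) v ^ (n - d n) * srad v ^ hexp (d n)) /
      (LBINT v. indicator {0<..} v * coord_cdf (d n) v ^ (n - d n) * srad v ^ hexp (d n))) \<longlonglongrightarrow> 0"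
      by (rule laplace[OF rho_pos d_top dn regime inc dec r _ \<psi>m, of "\<epsilon> / 2"]) (use \<epsilon> \<psi> \<psi>0 in auto)
    have d4: "\<forall>\<^sub>F n in sequentially. d n \<ge> 4" using d_top by (simp add: filterlim_at_top)
    have "\<forall>\<^sub>F n in sequentially. norm \<P>(\<eta> in N n. \<bar>sqrt (real (d n)) * H_typ n \<eta> - r\<bar> > \<epsilon>) \<le>
      (LBINT v. \<psi> (sqrt (d n) * v) * coord_cdf (d n) v ^ (n - d n) * srad v ^ hexp (d n)) /
      (LBINT v. indicator {0<..} v * coord_cdf (d n) v ^ (n - d n) * srad v ^ hexp (d n))"
      using d4 dn iid typ_height
    proof eventually_elim
      case (elim n)
      let ?B = "{h. \<bar>sqrt (real (d n)) * h - r\<bar> > \<epsilon>}"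
      have B: "?B \<in> sets borel" by measurable
      have "\<P>(\<eta> in N n. H_typ n \<eta> \<in> ?B) \<le>
        (LBINT v. \<psi> (sqrt (d n) * v) * coord_cdf (d n) v ^ (n - d n) * srad v ^ hexp (d n)) /
        (LBINT v. indicator {0<..} v * coord_cdf (d n) v ^ (n - d n) * srad v ^ hexp (d n))"
        by (rule typical_height_bound[OF elim(1-4) \<psi>c \<psi> B]) (auto intro: \<psi>1)
      then show ?case by simp
    qed
    then show ?thesis by (rule Lim_null_comparison[OF _ lap])
  qed
  show ?thesis
    unfolding rr converges_in_prob_def using r am uniq conv by blast
qed

end
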